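(* Let $\mathcal{H}$ be a finite-dimensional Hilbert space, $H$ a Hermitian operator on $\mathcal{H}$, and $\mathcal{S}$ a Lindbladian on $\mathcal{H}$ having GNS detailed balance with respect to a faithful density. Let $\mathcal{L}(\rho) = i[H,\rho] + \mathcal{S}(\rho)$ and $\Phi^t = \exp(-t\mathcal{L})$ for $t \geq 0$. Let $\mathcal{E}$ be the invariant subspace projection of $\mathcal{L}$, up to a possible persistent rotation $R_t$. Then for any finite timescale $\tau > 0$ there exists $\lambda_\tau > 0$ such that \[ D\big(\Phi^t(\rho) \,\big\|\, R_t \mathcal{E}(\rho)\big) \leq \exp\big(-\lambda_\tau \lfloor t/\tau \rfloor\big)\, D\big(\rho \,\big\|\, \mathcal{E}(\rho)\big) \] for every $t > 0$ and every density $\rho$ on $\mathcal{H}$, where $\lfloor\cdot\rfloor$ is the floor function.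
   Context: Sign convention: a Lindbladian $\mathcal{L}$ acts on operators (Schrödinger picture) and $-\mathcal{L}$ is the generator, so $\Phi^t=\exp(-t\mathcal{L})$ is a quantum Markov semigroup (a family of completely positive trace-preserving maps with $\Phi^t\Phi^s=\Phi^{t+s}$). $D(\rho\|\sigma) = \mathrm{tr}(\rho\log\rho - \rho\log\sigma)$ is the quantum relative entropy. GNS detailed balance of $\mathcal{S}$ with respect to a faithful density $\omega$ means $\mathrm{tr}(\omega x^\dagger \mathcal{S}(y)) = \mathrm{tr}(\omega \mathcal{S}(x)^\dagger y)$ for all operators $x,y$. "Invariant subspace projection of $\mathcal{L}$ up to a persistent rotation $R_t$" means: $\mathcal{E}$ is an idempotent quantum channel (projection) onto the subspace that does not decay under $\Phi^t$, and $R_t = R_{U_t}$, $R_{U}(X)=UXU^\dagger$, is a continuously parametrized family of unitary conjugations commuting with $\mathcal{E}$ such that $\Phi^t\mathcal{E} = \mathcal{E}\Phi^t = R_t\mathcal{E} = \mathcal{E}R_t$ and $\Phi^t - R_t\mathcal{E} \to 0$ as $t\to\infty$. *)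

theory Defs
  imports "HOL-Analysis.Analysis"
begin

text \<open>Operators on the finite-dimensional Hilbert space \<open>complex ^ 'n\<close> are
  matrices \<open>complex ^ 'n ^ 'n\<close>; superoperators are functions on matrices.\<close>

type_synonym 'n cmat = "complex ^ 'n ^ 'n"

definition madj :: "'n::finite cmat \<Rightarrow> 'n cmat" where
  "madj A = (\<chi> i j. cnj (A $ j $ i))"

definition mtrace :: "'n::finite cmat \<Rightarrow> complex" where
  "mtrace A = (\<Sum>i\<in>UNIV. A $ i $ i)"

definition cscale :: "complex \<Rightarrow> 'n::finite cmat \<Rightarrow> 'n cmat" where
  "cscale c A = (\<chi> i j. c * A $ i $ j)"

definition cinner :: "complex ^ 'n::finite \<Rightarrow> complex ^ 'n \<Rightarrow> complex" where
  "cinner v w = (\<Sum>i\<in>UNIV. cnj (v $ i) * w $ i)"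

definition hermitian :: "'n::finite cmat \<Rightarrow> bool" where
  "hermitian A \<longleftrightarrow> madj A = A"

definition unitary_mat :: "'n::finite cmat \<Rightarrow> bool" where
  "unitary_mat U \<longleftrightarrow> madj U ** U = mat 1 \<and> U ** madj U = mat 1"

definition psd :: "'n::finite cmat \<Rightarrow> bool" where
  "psd A \<longleftrightarrow> (\<forall>v. Im (cinner v (A *v v)) = 0 \<and> Re (cinner v (A *v v)) \<ge> 0)"

definition density :: "'n::finite cmat \<Rightarrow> bool" where
  "density \<rho> \<longleftrightarrow> psd \<rho> \<and> mtrace \<rho> = 1"

definition faithful_density :: "'n::finite cmat \<Rightarrow> bool" where
  "faithful_density \<rho> \<longleftrightarrow> density \<rho> \<and> (\<forall>v. \<rho> *v v = 0 \<longrightarrow> v = 0)"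

definition superop_linear :: "('n::finite cmat \<Rightarrow> 'n cmat) \<Rightarrow> bool" where
  "superop_linear \<Phi> \<longleftrightarrow> (\<forall>X Y. \<Phi> (X + Y) = \<Phi> X + \<Phi> Y) \<and> (\<forall>c X. \<Phi> (cscale c X) = cscale c (\<Phi> X))"

text \<open>A block matrix \<open>(X i j)\<close>, \<open>i, j < k\<close>, of \<open>n\<times>n\<close> blocks, i.e. an element of
  \<open>M_k \<otimes> M_n\<close>, is positive semidefinite.\<close>
definition block_psd :: "nat \<Rightarrow> (nat \<Rightarrow> nat \<Rightarrow> 'n::finite cmat) \<Rightarrow> bool" where
  "block_psd k X \<longleftrightarrow> (\<forall>v :: nat \<Rightarrow> complex ^ 'n.
      Im (\<Sum>i<k. \<Sum>j<k. cinner (v i) (X i j *v v j)) = 0 \<and>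
      Re (\<Sum>i<k. \<Sum>j<k. cinner (v i) (X i j *v v j)) \<ge> 0)"

definition completely_positive :: "('n::finite cmat \<Rightarrow> 'n cmat) \<Rightarrow> bool" where
  "completely_positive \<Phi> \<longleftrightarrow>
     (\<forall>k X. block_psd k X \<longrightarrow> block_psd k (\<lambda>i j. \<Phi> (X i j)))"

definition quantum_channel :: "('n::finite cmat \<Rightarrow> 'n cmat) \<Rightarrow> bool" where
  "quantum_channel \<Phi> \<longleftrightarrow> superop_linear \<Phi> \<and> completely_positive \<Phi> \<and>
     (\<forall>X. mtrace (\<Phi> X) = mtrace X)"

definition superop_exp :: "('n::finite cmat \<Rightarrow> 'n cmat) \<Rightarrow> 'n cmat \<Rightarrow> 'n cmat" where
  "superop_exp A X = (\<Sum>k. (1 / fact k) *\<^sub>R (A ^^ k) X)"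

text \<open>Lindbladian (sign convention of the paper): \<open>-S\<close> generates a quantum Markov
  semigroup, i.e. \<open>exp(-t S)\<close> is a quantum channel for all \<open>t \<ge> 0\<close>.\<close>
definition lindbladian :: "('n::finite cmat \<Rightarrow> 'n cmat) \<Rightarrow> bool" where
  "lindbladian S \<longleftrightarrow> superop_linear S \<and>
     (\<forall>t::real. t \<ge> 0 \<longrightarrow> quantum_channel (superop_exp (\<lambda>X. (- t) *\<^sub>R S X)))"

definition GNS_detailed_balance :: "('n::finite cmat \<Rightarrow> 'n cmat) \<Rightarrow> 'n cmat \<Rightarrow> bool" where
  "GNS_detailed_balance S \<omega> \<longleftrightarrow>
     (\<forall>x y. mtrace (\<omega> ** madj x ** S y) = mtrace (\<omega> ** madj (S x) ** y))"

definition diag_mat :: "('n::finite \<Rightarrow> real) \<Rightarrow> 'n cmat" where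
  "diag_mat d = (\<chi> i j. if i = j then complex_of_real (d i) else 0)"

definition mlog :: "'n::finite cmat \<Rightarrow> 'n cmat" where
  "mlog A = (SOME B. \<exists>U d. unitary_mat U \<and> A = U ** diag_mat d ** madj U \<and>
               B = U ** diag_mat (\<lambda>i. if d i > 0 then ln (d i) else 0) ** madj U)"

definition rel_entropy :: "'n::finite cmat \<Rightarrow> 'n cmat \<Rightarrow> ereal" where
  "rel_entropy \<rho> \<sigma> =
     (if (\<forall>v. \<sigma> *v v = 0 \<longrightarrow> \<rho> *v v = 0)
      then ereal (Re (mtrace (\<rho> ** mlog \<rho> - \<rho> ** mlog \<sigma>)))
      else \<infinity>)"

end

theory Submission
  imports Defs "HOL-Complex_Analysis.Conformal_Mappings"
begin

text \<open>The map \<open>\<Phi>\<^sup>\<tau>\<close> dominates \<open>\<epsilon> \<Phi>\<^sup>\<tau> \<E>\<close> in the completely positive order for some \<open>0 < \<epsilon> < 1\<close>. Writing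
  \<open>\<Phi>\<^sup>\<tau> = (1 - \<epsilon>) \<Psi> + \<epsilon> \<Phi>\<^sup>\<tau> \<E>\<close> with a channel \<open>\<Psi>\<close>, both \<open>\<Phi>\<^sup>\<tau> (\<rho>)\<close> and \<open>\<Phi>\<^sup>\<tau> (\<E> (\<rho>))\<close> contain the same
  part \<open>\<epsilon> \<Phi>\<^sup>\<tau> \<E> (\<rho>)\<close>, so joint convexity and data processing contract the relative entropy by
  \<open>1 - \<epsilon>\<close> in each step of length \<open>\<tau>\<close>. Both properties of the relative entropy follow from its
  representation as an integral of divergences that are suprema of expressions affine in the two
  states.

  In finite dimension the domination is an inclusion between kernels of Choi forms. If the Choi
  form of \<open>\<Phi>\<^sup>\<tau>\<close> vanishes at \<open>M\<close>, monotonicity and analyticity along the flow of the drift \<open>K\<^sup>*\<close> transport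
  this zero to all times. Detailed balance makes the span of the jump operators closed under
  adjoints, so every kernel is invariant under \<open>K + K\<^sup>*\<close>, and the drift may be replaced by a unitary
  flow. By recurrence there are times \<open>m \<rightarrow> \<infinity>\<close> at which this unitary flow returns to \<open>M\<close> and \<open>\<Phi>\<^sup>m\<close>
  converges to \<open>\<E>\<close>, hence the Choi form of \<open>\<Phi>\<^sup>\<tau> \<E>\<close> vanishes at \<open>M\<close> as well.\<close>

subsection \<open>Matrices and the Hilbert--Schmidt inner product\<close>

text \<open>\<open>H\<close> need not commute with \<open>S\<close>, so detailed balance holds for
  \<open>S\<close> but in general not for \<open>L\<close>, and the entropy production can vanish at
  a state that \<open>H\<close> is about to move away from equilibrium. Hence \<epsilon> belongs to
  a whole step of length \<tau> and the bound counts completed steps only.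

  Domination is required in the completely positive order because the remainder \<Psi> has to be a
  channel before data processing applies to it. The obstacle is that \<E> is a limit of large times,
  while the comparison takes place at the fixed time \<tau>: the kernel has to be followed to
  infinity and back. The flow of \<open>madj K\<close> need not be isometric, so it gives no return
  to \<open>M\<close>; its skew part does. Detailed balance is used through one consequence that
  concerns the jump operators of \<open>S\<close> alone and therefore survives the addition of
  \<open>H\<close>.\<close>

definition hs :: "'n::finite cmat \<Rightarrow> 'n cmat \<Rightarrow> complex" where
  "hs M N = (\<Sum>i\<in>UNIV. \<Sum>j\<in>UNIV. cnj (M $ i $ j) * N $ i $ j)"

definition munit :: "'n::finite \<Rightarrow> 'n \<Rightarrow> 'n cmat" where
  "munit i j = (\<chi> a b. if a = i \<and> b = j then 1 else 0)"

lemma matrix_eqI: "(\<And>i j. A $ i $ j = B $ i $ j) \<Longrightarrow> A = B"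
  by (simp add: vec_eq_iff)

lemma mm_nth: "(A ** B) $ i $ j = (\<Sum>k\<in>UNIV. A $ i $ k * B $ k $ j)"
  by (simp add: matrix_matrix_mult_def)

lemma madj_nth [simp]: "madj A $ i $ j = cnj (A $ j $ i)"
  by (simp add: madj_def)

lemma cscale_nth [simp]: "cscale c A $ i $ j = c * A $ i $ j"
  by (simp add: cscale_def)

lemma munit_nth: "munit i j $ a $ b = (if a = i \<and> b = j then 1 else 0)"
  by (simp add: munit_def)

lemma mat_one_nth: "(mat 1 :: 'n::finite cmat) $ i $ j = (if i = j then 1 else 0)"
  by (simp add: mat_def)

lemma madj_madj [simp]: "madj (madj A) = A"
  by (rule matrix_eqI) simp

lemma madj_mult: "madj (A ** B) = madj B ** madj A"
  by (rule matrix_eqI) (simp add: mm_nth mult.commute)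

lemma madj_add: "madj (A + B) = madj A + madj B"
  by (rule matrix_eqI) simp

lemma madj_diff: "madj (A - B) = madj A - madj B"
  by (rule matrix_eqI) simp

lemma madj_minus: "madj (- A) = - madj A"
  by (rule matrix_eqI) simp

lemma madj_scaleR: "madj (r *\<^sub>R A) = r *\<^sub>R madj A"
  by (rule matrix_eqI) simp

lemma madj_cscale: "madj (cscale c A) = cscale (cnj c) (madj A)"
  by (rule matrix_eqI) simp

lemma madj_zero [simp]: "madj 0 = 0"
  by (rule matrix_eqI) simp

lemma madj_mat_one [simp]: "madj (mat 1) = mat 1"
  by (rule matrix_eqI) (auto simp: mat_one_nth)

lemma madj_sum: "madj (sum f I) = (\<Sum>i\<in>I. madj (f i))"
  by (induction I rule: infinite_finite_induct) (simp_all add: madj_add)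

lemma scaleR_eq_cscale: "r *\<^sub>R A = cscale (of_real r) A"
  by (rule matrix_eqI) (simp add: scaleR_conv_of_real[where 'a = complex])

lemma minus_eq_cscale: "- A = cscale (-1) A"
  by (rule matrix_eqI) simp

lemma cscale_add_right: "cscale c (A + B) = cscale c A + cscale c B"
  by (rule matrix_eqI) (simp add: algebra_simps)

lemma cscale_diff_right: "cscale c (A - B) = cscale c A - cscale c B"
  by (rule matrix_eqI) (simp add: algebra_simps)

lemma cscale_add_left: "cscale (c + d) A = cscale c A + cscale d A"
  by (rule matrix_eqI) (simp add: algebra_simps)

lemma cscale_cscale: "cscale c (cscale d A) = cscale (c * d) A"
  by (rule matrix_eqI) simp

lemma cscale_one [simp]: "cscale 1 A = A"
  by (rule matrix_eqI) simp

lemma cscale_zero [simp]: "cscale c 0 = 0" "cscale 0 A = 0"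
  by (rule matrix_eqI, simp)+

lemma cscale_mult_left: "cscale c A ** B = cscale c (A ** B)"
  by (rule matrix_eqI) (simp add: mm_nth sum_distrib_left mult_ac)

lemma cscale_mult_right: "A ** cscale c B = cscale c (A ** B)"
  by (rule matrix_eqI) (simp add: mm_nth sum_distrib_left mult_ac)

lemma bounded_bilinear_mm:
  "bounded_bilinear ((**) :: 'n::finite cmat \<Rightarrow> 'n cmat \<Rightarrow> 'n cmat)"
  unfolding bilinear_conv_bounded_bilinear[symmetric] bilinear_def
  by (auto intro!: linearI matrix_eqI
      simp: mm_nth algebra_simps sum.distrib scaleR_sum_right)

lemmas mm_add_left = bounded_bilinear.add_left[OF bounded_bilinear_mm]
lemmas mm_add_right = bounded_bilinear.add_right[OF bounded_bilinear_mm]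
lemmas mm_diff_left = bounded_bilinear.diff_left[OF bounded_bilinear_mm]
lemmas mm_diff_right = bounded_bilinear.diff_right[OF bounded_bilinear_mm]
lemmas mm_minus_left = bounded_bilinear.minus_left[OF bounded_bilinear_mm]
lemmas mm_minus_right = bounded_bilinear.minus_right[OF bounded_bilinear_mm]
lemmas mm_zero_left = bounded_bilinear.zero_left[OF bounded_bilinear_mm]
lemmas mm_zero_right = bounded_bilinear.zero_right[OF bounded_bilinear_mm]
lemmas mm_scaleR_left = bounded_bilinear.scaleR_left[OF bounded_bilinear_mm]
lemmas mm_scaleR_right = bounded_bilinear.scaleR_right[OF bounded_bilinear_mm]
lemmas mm_sum_left = bounded_bilinear.sum_left[OF bounded_bilinear_mm]
lemmas mm_sum_right = bounded_bilinear.sum_right[OF bounded_bilinear_mm]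
lemmas mm_assoc = matrix_mul_assoc[symmetric]

lemma mtrace_mult: "mtrace (A ** B) = (\<Sum>i\<in>UNIV. \<Sum>j\<in>UNIV. A $ i $ j * B $ j $ i)"
  by (simp add: mtrace_def mm_nth)

lemma mtrace_commute: "mtrace (A ** B) = mtrace (B ** A)"
  unfolding mtrace_mult by (subst sum.swap) (simp add: mult.commute)

lemma mtrace_add: "mtrace (A + B) = mtrace A + mtrace B"
  by (simp add: mtrace_def sum.distrib)

lemma mtrace_diff: "mtrace (A - B) = mtrace A - mtrace B"
  by (simp add: mtrace_def sum_subtractf)

lemma mtrace_minus: "mtrace (- A) = - mtrace A"
  by (simp add: mtrace_def sum_negf)

lemma mtrace_zero [simp]: "mtrace 0 = 0"
  by (simp add: mtrace_def)

lemma mtrace_cscale: "mtrace (cscale c A) = c * mtrace A"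
  by (simp add: mtrace_def sum_distrib_left)

lemma mtrace_scaleR: "mtrace (r *\<^sub>R A) = r *\<^sub>R mtrace A"
  by (simp add: mtrace_def scaleR_sum_right)

lemma mtrace_madj: "mtrace (madj A) = cnj (mtrace A)"
  by (simp add: mtrace_def)

lemma mtrace_sum: "mtrace (sum f I) = (\<Sum>i\<in>I. mtrace (f i))"
  by (induction I rule: infinite_finite_induct) (simp_all add: mtrace_add)

lemma mtrace_mat_one: "mtrace (mat 1 :: 'n::finite cmat) = of_nat CARD('n)"
  by (simp add: mtrace_def mat_one_nth)

lemma hs_eq_mtrace: "hs M N = mtrace (madj M ** N)"
  unfolding hs_def mtrace_mult by (subst sum.swap) simp

lemma hs_add_right: "hs M (A + B) = hs M A + hs M B"
  by (simp add: hs_eq_mtrace mm_add_right mtrace_add)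

lemma hs_diff_right: "hs M (A - B) = hs M A - hs M B"
  by (simp add: hs_eq_mtrace mm_diff_right mtrace_diff)

lemma hs_cscale_right: "hs M (cscale c A) = c * hs M A"
  by (simp add: hs_eq_mtrace cscale_mult_right mtrace_cscale)

lemma hs_scaleR_right: "hs M (c *\<^sub>R A) = c *\<^sub>R hs M A"
  by (simp add: hs_eq_mtrace mm_scaleR_right mtrace_scaleR)

lemma hs_zero_right [simp]: "hs M 0 = 0"
  by (simp add: hs_def)

lemma hs_cnj: "cnj (hs M N) = hs N M"
  by (simp add: hs_def mult.commute)

lemma hs_inner: "Re (hs M N) = M \<bullet> N"
  by (simp add: hs_def inner_vec_def inner_complex_def)

lemma hs_self: "hs M M = of_real ((norm M)\<^sup>2)"
proof (rule complex_eqI)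
  show "Re (hs M M) = Re (of_real ((norm M)\<^sup>2))"
    by (simp add: hs_inner dot_square_norm)
  have "cnj (hs M M) = hs M M" by (rule hs_cnj)
  then show "Im (hs M M) = Im (of_real ((norm M)\<^sup>2))"
    by (simp add: complex_eq_iff)
qed

lemma hs_eq_0: "hs M M = 0 \<Longrightarrow> M = 0"
  by (simp add: hs_self)

lemma hs_mult_left: "hs (P ** M) N = hs M (madj P ** N)"
  by (simp add: hs_eq_mtrace madj_mult mm_assoc)

lemma hs_mult_right: "hs (M ** Q) N = hs M (N ** madj Q)"
  by (simp add: hs_eq_mtrace madj_mult) (metis mm_assoc mtrace_commute)

lemma hs_right_mult_right: "hs M (N ** Q) = hs (M ** madj Q) N"
  by (simp add: hs_mult_right)

lemma hs_one_left: "hs (mat 1) M = mtrace M"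
  by (simp add: hs_eq_mtrace)

section \<open>Complex inner product, positivity and the spectral theorem\<close>

lemma cinner_cnj: "cnj (cinner v w) = cinner w v"
  by (simp add: cinner_def mult.commute)

lemma cinner_inner: "Re (cinner v w) = v \<bullet> w"
  by (simp add: cinner_def inner_vec_def inner_complex_def)

lemma cinner_self: "cinner v v = of_real ((norm v)\<^sup>2)"
proof (rule complex_eqI)
  show "Re (cinner v v) = Re (of_real ((norm v)\<^sup>2))"
    by (simp add: cinner_inner dot_square_norm)
  have "cnj (cinner v v) = cinner v v" by (rule cinner_cnj)
  then show "Im (cinner v v) = Im (of_real ((norm v)\<^sup>2))"
    by (simp add: complex_eq_iff)
qed

lemma cinner_adj: "cinner v (A *v w) = cinner (madj A *v v) w"
  unfolding cinner_def matrix_vector_mult_def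
  by (simp add: sum_distrib_left sum_distrib_right) (subst sum.swap, simp add: mult_ac)

lemma cinner_add_right: "cinner v (a + b) = cinner v a + cinner v b"
  by (simp add: cinner_def algebra_simps sum.distrib)

lemma cinner_add_left: "cinner (a + b) v = cinner a v + cinner b v"
  by (simp add: cinner_def algebra_simps sum.distrib)

lemma cinner_smult_right: "cinner v (c *s a) = c * cinner v a"
  by (simp add: cinner_def sum_distrib_left mult_ac)

lemma cinner_smult_left: "cinner (c *s a) v = cnj c * cinner a v"
  by (simp add: cinner_def sum_distrib_left mult_ac)

lemma cinner_zero [simp]: "cinner v 0 = 0" "cinner 0 v = 0"
  by (simp_all add: cinner_def)

lemma cinner_axis_left: "cinner (axis i 1) w = w $ i"
proof -
  have "cnj (axis i 1 $ k) * w $ k = (if k = i then w $ k else 0)" for k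
    by (simp add: axis_def)
  then show ?thesis by (simp add: cinner_def)
qed

lemma cinner_axis: "cinner (axis i 1) (A *v axis j 1) = A $ i $ j"
proof -
  have "A $ i $ k * axis j 1 $ k = (if k = j then A $ i $ k else 0)" for k
    by (simp add: axis_def)
  then show ?thesis by (simp add: cinner_axis_left matrix_vector_mult_def)
qed

lemma mv_linear: "linear ((*v) (A :: 'n::finite cmat))"
  by (rule linearI) (simp_all add: vec_eq_iff matrix_vector_mult_def algebra_simps sum.distrib
      scaleR_sum_right)

text \<open>Polarisation: the form is real at \<open>v + w\<close>, so its mixed part is real. The
  pairs \<open>axis i 1\<close>, \<open>axis j 1\<close> and \<open>axis i 1\<close>,
  \<open>\<i> *s axis j 1\<close> then relate the two opposite entries.\<close>

lemma psd_hermitian: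
  assumes "psd A"
  shows "hermitian A"
  unfolding hermitian_def
proof (rule matrix_eqI)
  fix i j
  have sym: "cinner v (A *v w) + cinner w (A *v v) = cnj (cinner v (A *v w) + cinner w (A *v v))" for v w
  proof -
    have r: "cinner u (A *v u) = cnj (cinner u (A *v u))" for u
      using assms by (simp add: psd_def complex_eq_iff)
    have "cinner (v + w) (A *v (v + w)) =
       cinner v (A *v v) + cinner w (A *v w) + (cinner v (A *v w) + cinner w (A *v v))"
      by (simp add: cinner_add_right cinner_add_left linear_add[OF mv_linear] algebra_simps)
    with r[of "v + w"] r[of v] r[of w] show ?thesis
      by (metis (no_types, lifting) add_left_cancel complex_cnj_add)
  qed
  define x where "x = A $ i $ j"
  define y where "y = A $ j $ i"
  have 1: "x + y = cnj (x + y)"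
    using sym[of "axis i 1" "axis j 1"] by (simp add: cinner_axis x_def y_def)
  have "\<i> * x - \<i> * y = cnj (\<i> * x - \<i> * y)"
    using sym[of "axis i 1" "\<i> *s axis j 1"]
    by (simp add: cinner_axis x_def y_def cinner_smult_right cinner_smult_left
        vector_scalar_commute)
  with 1 have "cnj y = x"
    by (auto simp: complex_eq_iff)
  then show "madj A $ i $ j = A $ i $ j"
    by (simp add: x_def y_def)
qed

text \<open>Eigenvectors are found one index at a time. On the complement \<open>V\<close> of those
  already found the form attains a maximum over the unit sphere, and varying the maximiser in the
  direction of its residual \<open>r\<close>, which stays in \<open>V\<close>, shows that
  \<open>r\<close> is zero.\<close>

lemma hermitian_orthonormal_eigen:
  fixes A :: "'n::finite cmat"
  assumes herm: "hermitian A"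
  shows "\<exists>u d. (\<forall>i\<in>S. \<forall>j\<in>S. cinner (u i) (u j) = (if i = j then 1 else 0)) \<and>
    (\<forall>i\<in>S. A *v u i = of_real (d i) *s u (i::'n))"
proof -
  have sa: "cinner (A *v v) w = cinner v (A *v w)" for v w
    using herm by (simp add: hermitian_def cinner_adj)
  have "finite S" by simp
  then show ?thesis
  proof (induction S rule: finite_induct)
    case empty
    then show ?case by simp
  next
    case (insert k S)
    then obtain u d where u: "\<And>i j. i \<in> S \<Longrightarrow> j \<in> S \<Longrightarrow> cinner (u i) (u j) = (if i = j then 1 else 0)"
      and d: "\<And>i. i \<in> S \<Longrightarrow> A *v u i = of_real (d i) *s u i"
      by blast
    define V where "V = {v. \<forall>i\<in>S. cinner (u i) v = 0}"
    \<comment> \<open>Dimensions are counted over the reals: complex orthogonality to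
      \<open>u i\<close> is real orthogonality to both \<open>u i\<close> and
      \<open>\<i> *s u i\<close>, so \<open>Bs\<close> has at most twice as many elements as
      \<open>S\<close>.\<close>
    define Bs where "Bs = u ` S \<union> (\<lambda>i. \<i> *s u i) ` S"
    have subV: "subspace V"
    proof (rule subspaceI)
      fix c :: real and x assume "x \<in> V"
      moreover have "cinner (u i) (c *\<^sub>R x) = c *\<^sub>R cinner (u i) x" for i
        by (simp add: cinner_def scaleR_sum_right)
      ultimately show "c *\<^sub>R x \<in> V" by (simp add: V_def)
    qed (auto simp: V_def cinner_add_right)
    have cB: "card Bs \<le> card S + card S"
      unfolding Bs_def using card_Un_le[of "u ` S" "(\<lambda>i. \<i> *s u i) ` S"]
        card_image_le[OF insert(1), of u] card_image_le[OF insert(1), of "\<lambda>i. \<i> *s u i"]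
      by linarith
    have "card S < CARD('n)"
      using insert(2) by (intro psubset_card_mono) auto
    with cB have "card Bs < DIM(complex ^ 'n)" by simp
    moreover have "dim Bs \<le> card Bs"
      by (rule dim_le_card') (use insert(1) in \<open>simp add: Bs_def\<close>)
    ultimately obtain x where x: "x \<noteq> 0" "\<And>y. y \<in> span Bs \<Longrightarrow> orthogonal x y"
      using orthogonal_to_subspace_exists[of Bs] le_less_trans by blast
    have xV: "x \<in> V"
      unfolding V_def
    proof safe
      fix i assume i: "i \<in> S"
      have "orthogonal x (u i)" "orthogonal x (\<i> *s u i)"
        using i by (auto intro!: x(2) span_base simp: Bs_def)
      then have "Re (cinner x (u i)) = 0" "Re (\<i> * cinner x (u i)) = 0"
        using cinner_inner cinner_smult_right unfolding orthogonal_def by metis+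
      then have "cinner x (u i) = 0" by (simp add: complex_eq_iff)
      then show "cinner (u i) x = 0" by (metis cinner_cnj complex_cnj_zero)
    qed
    have AV: "A *v v \<in> V" if "v \<in> V" for v
      unfolding V_def
    proof safe
      fix i assume i: "i \<in> S"
      have "cinner (u i) (A *v v) = cinner (A *v u i) v" by (simp add: sa)
      also have "\<dots> = 0" using that i by (simp add: d cinner_smult_left V_def)
      finally show "cinner (u i) (A *v v) = 0" .
    qed
    define K where "K = V \<inter> sphere 0 1"
    have "compact K" unfolding K_def
      by (intro closed_Int_compact closed_subspace subV compact_sphere)
    moreover have "(1 / norm x) *\<^sub>R x \<in> K"
      using x(1) xV subV by (auto simp: K_def intro: subspace_scale)
    moreover have "continuous_on K (\<lambda>v. v \<bullet> (A *v v))"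
      by (intro continuous_intros linear_continuous_on linear_conv_bounded_linear[THEN iffD1] mv_linear)
    ultimately obtain v where vK: "v \<in> K" and vmax: "\<And>w. w \<in> K \<Longrightarrow> w \<bullet> (A *v w) \<le> v \<bullet> (A *v v)"
      using continuous_attains_sup[of K "\<lambda>v. v \<bullet> (A *v v)"] by blast
    define l where "l = v \<bullet> (A *v v)"
    have vV: "v \<in> V" and nv: "norm v = 1" using vK by (auto simp: K_def)
    have le: "w \<bullet> (A *v w) \<le> l * (norm w)\<^sup>2" if "w \<in> V" for w
    proof (cases "w = 0")
      case False
      have "(1 / norm w) *\<^sub>R w \<in> K"
        using that False subV by (auto simp: K_def intro: subspace_scale)
      from vmax[OF this] have "(w \<bullet> (A *v w)) / (norm w)\<^sup>2 \<le> l"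
        by (simp add: linear_scale[OF mv_linear] l_def power2_eq_square)
      with False show ?thesis by (simp add: field_simps)
    qed (simp add: linear_0[OF mv_linear])
    define r where "r = A *v v - l *\<^sub>R v"
    have rV: "r \<in> V" unfolding r_def using AV vV subV by (auto intro: subspace_diff subspace_scale)
    have sar: "w \<bullet> (A *v z) = (A *v w) \<bullet> z" for w z
      by (metis cinner_inner sa)
    have "r \<bullet> r = 0"
    proof (rule ccontr)
      assume nz: "r \<bullet> r \<noteq> 0"
      define c where "c = r \<bullet> (A *v r) - l * (norm r)\<^sup>2"
      have ineq: "2 * t * (r \<bullet> r) + t\<^sup>2 * c \<le> 0" for t
      proof -
        have "v + t *\<^sub>R r \<in> V" using vV rV subV by (auto intro: subspace_add subspace_scale)
        from le[OF this]
        have e0: "(v + t *\<^sub>R r) \<bullet> (A *v (v + t *\<^sub>R r)) - l * ((v + t *\<^sub>R r) \<bullet> (v + t *\<^sub>R r)) \<le> 0"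
          by (simp add: dot_square_norm)
        have e1: "(v + t *\<^sub>R r) \<bullet> (A *v (v + t *\<^sub>R r)) =
            l + 2 * t * (r \<bullet> (A *v v)) + t\<^sup>2 * (r \<bullet> (A *v r))"
        proof -
          have "v \<bullet> (A *v r) = r \<bullet> (A *v v)"
            using sar[of v r] by (simp add: inner_commute)
          then show ?thesis
            by (simp add: linear_add[OF mv_linear] linear_scale[OF mv_linear] inner_add_left
              l_def power2_eq_square inner_add_right algebra_simps)
        qed
        have e2: "(v + t *\<^sub>R r) \<bullet> (v + t *\<^sub>R r) = 1 + 2 * t * (r \<bullet> v) + t\<^sup>2 * (r \<bullet> r)"
        proof -
          have "v \<bullet> v = 1" using nv by (simp add: norm_eq_1)
          then show ?thesis
            by (simp add: inner_add_left inner_add_right power2_eq_square inner_commute[of v r] algebra_simps)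
        qed
        have e3: "r \<bullet> (A *v v) = l * (r \<bullet> v) + r \<bullet> r"
          by (simp add: r_def inner_diff_right inner_diff_left)
        have e4: "(norm r)\<^sup>2 = r \<bullet> r"
          by (simp add: dot_square_norm)
        show ?thesis
          using e0[unfolded e1 e2 e3] unfolding c_def e4 by (simp add: algebra_simps)
      qed
      have rr: "r \<bullet> r > 0" using nz by simp
      \<comment> \<open>Small enough for the quadratic term, at most
        \<open>t * (r \<bullet> r)\<close> in absolute value, to lose against the linear term
        \<open>2 * t * (r \<bullet> r)\<close>.\<close>
      define t where "t = (r \<bullet> r) / (\<bar>c\<bar> + 1)"
      have t0: "t > 0" using rr by (simp add: t_def)
      have "t * \<bar>c\<bar> \<le> r \<bullet> r" using rr by (simp add: t_def field_simps)
      then have "t * (t * \<bar>c\<bar>) \<le> t * (r \<bullet> r)" using t0 by simp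
      moreover have "t * t * (-c) \<le> t * t * \<bar>c\<bar>"
        by (rule mult_left_mono) auto
      ultimately have "2 * t * (r \<bullet> r) + t\<^sup>2 * c \<ge> t * (r \<bullet> r)"
        by (simp add: power2_eq_square algebra_simps)
      with ineq[of t] t0 rr show False by (smt (verit) mult_pos_pos)
    qed
    then have Av: "A *v v = of_real l *s v"
      by (simp add: r_def vec_eq_iff scaleR_conv_of_real[where 'a=complex])
    have orth: "cinner (u i) v = 0" "cinner v (u i) = 0" if "i \<in> S" for i
    proof -
      show "cinner (u i) v = 0" using vV that by (simp add: V_def)
      then show "cinner v (u i) = 0" by (metis cinner_cnj complex_cnj_zero)
    qed
    have vv: "cinner v v = 1" by (simp add: cinner_self nv)
    show ?case
      using insert(2) u d Av orth vv
      by (intro exI[of _ "u(k := v)"] exI[of _ "d(k := l)"]) auto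
  qed
qed

theorem hermitian_spectral:
  fixes A :: "'n::finite cmat"
  assumes "hermitian A"
  obtains U d where "unitary_mat U" "A = U ** diag_mat d ** madj U"
proof -
  obtain u d where u: "\<And>i j. cinner (u i) (u j) = (if i = j then 1 else 0)"
    and d: "\<And>i. A *v u i = of_real (d i) *s u (i::'n)"
    using hermitian_orthonormal_eigen[OF assms, of UNIV] by auto
  define U :: "'n cmat" where "U = (\<chi> i j. u j $ i)"
  have 1: "madj U ** U = mat 1"
    by (rule matrix_eqI) (use u in \<open>simp add: mm_nth U_def mat_one_nth cinner_def\<close>)
  then have 2: "U ** madj U = mat 1" by (simp add: matrix_left_right_inverse)
  have "A ** U = U ** diag_mat d"
  proof (rule matrix_eqI)
    fix i j
    have "(A ** U) $ i $ j = (A *v u j) $ i"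
      by (simp add: mm_nth U_def matrix_vector_mult_def)
    also have "\<dots> = (U ** diag_mat d) $ i $ j"
      by (simp add: d mm_nth U_def diag_mat_def if_distrib mult.commute cong: if_cong)
    finally show "(A ** U) $ i $ j = (U ** diag_mat d) $ i $ j" .
  qed
  then have "A = U ** diag_mat d ** madj U"
    by (metis 2 matrix_mul_assoc matrix_mul_rid)
  with 1 2 show thesis by (intro that) (auto simp: unitary_mat_def)
qed

subsection \<open>Choi forms and Kraus operators\<close>

text \<open>The sesquilinear form of the Choi matrix, with \<open>M\<close> and \<open>N\<close>
  read as the vectors of their entries. Keeping them as matrices lets multiplications of the output
  act on the arguments, see \<open>ch_left\<close> and \<open>ch_right\<close>.\<close>

definition ch :: "('n::finite cmat \<Rightarrow> 'n cmat) \<Rightarrow> 'n cmat \<Rightarrow> 'n cmat \<Rightarrow> complex" where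
  "ch X M N = (\<Sum>i\<in>UNIV. \<Sum>j\<in>UNIV. (madj M ** X (munit i j) ** N) $ i $ j)"

definition choi_psd :: "('n::finite cmat \<Rightarrow> 'n cmat) \<Rightarrow> bool" where
  "choi_psd X \<longleftrightarrow> (\<forall>M. Im (ch X M M) = 0 \<and> 0 \<le> Re (ch X M M))"

lemma ch_left: "ch (\<lambda>Y. P ** X Y) M N = ch X (madj P ** M) N"
  by (simp add: ch_def madj_mult matrix_mul_assoc)

lemma ch_right: "ch (\<lambda>Y. X Y ** Q) M N = ch X M (Q ** N)"
  by (simp add: ch_def matrix_mul_assoc)

lemma ch_add: "ch (\<lambda>Y. X1 Y + X2 Y) M N = ch X1 M N + ch X2 M N"
  by (simp add: ch_def mm_add_left mm_add_right sum.distrib)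

lemma ch_diff: "ch (\<lambda>Y. X1 Y - X2 Y) M N = ch X1 M N - ch X2 M N"
  by (simp add: ch_def mm_diff_left mm_diff_right sum_subtractf)

lemma ch_scaleR: "ch (\<lambda>Y. r *\<^sub>R X1 Y) M N = r *\<^sub>R ch X1 M N"
  by (simp add: ch_def mm_scaleR_left mm_scaleR_right scaleR_sum_right)

lemma ch_zero: "ch (\<lambda>Y. 0) M N = 0"
  by (simp add: ch_def mm_zero_left mm_zero_right)

lemma ch_sum: "ch (\<lambda>Y. \<Sum>i\<in>I. X i Y) M N = (\<Sum>i\<in>I. ch (X i) M N)"
  by (induction I rule: infinite_finite_induct) (simp_all add: ch_add ch_zero)

lemma ch_add_left: "ch X (M + M') N = ch X M N + ch X M' N"
  by (simp add: ch_def mm_add_left madj_add sum.distrib)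

lemma ch_add_right: "ch X M (N + N') = ch X M N + ch X M N'"
  by (simp add: ch_def mm_add_right sum.distrib)

lemma ch_diff_left: "ch X (M - M') N = ch X M N - ch X M' N"
  by (simp add: ch_def mm_diff_left madj_diff sum_subtractf)

lemma ch_diff_right: "ch X M (N - N') = ch X M N - ch X M N'"
  by (simp add: ch_def mm_diff_right sum_subtractf)

lemma ch_cscale_left: "ch X (cscale c M) N = cnj c * ch X M N"
  by (simp add: ch_def cscale_mult_left madj_cscale sum_distrib_left)

lemma ch_cscale_right: "ch X M (cscale c N) = c * ch X M N"
  by (simp add: ch_def cscale_mult_right sum_distrib_left)

lemma ch_scaleR_left: "ch X (r *\<^sub>R M) N = r *\<^sub>R ch X M N"
  by (simp add: scaleR_eq_cscale ch_cscale_left scaleR_conv_of_real)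

lemma ch_scaleR_right: "ch X M (r *\<^sub>R N) = r *\<^sub>R ch X M N"
  by (simp add: scaleR_eq_cscale ch_cscale_right scaleR_conv_of_real)

lemma munit_mult_nth: "(A ** munit i j ** B) $ k $ l = A $ k $ i * B $ j $ l"
proof -
  have 1: "(A ** munit i j) $ k $ m = (if m = j then A $ k $ i else 0)" for m
  proof -
    have "A $ k $ p * munit i j $ p $ m = (if p = i then (if m = j then A $ k $ i else 0) else 0)" for p
      by (simp add: munit_nth)
    then show ?thesis by (simp add: mm_nth)
  qed
  have "(A ** munit i j) $ k $ m * B $ m $ l = (if m = j then A $ k $ i * B $ j $ l else 0)" for m
    by (simp add: 1)
  then show ?thesis by (subst mm_nth) simp
qed

lemma ch_id: "ch (\<lambda>Y. Y) M N = cnj (mtrace M) * mtrace N"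
  by (simp add: ch_def munit_mult_nth mtrace_def sum_product)

text \<open>A sandwich map has a Choi form of rank one. The computations with drift and jump terms,
  both for the Lindblad form and for detailed balance, reduce to this product.\<close>

lemma ch_sandwich: "ch (\<lambda>Y. P ** Y ** Q) M N = hs M P * mtrace (Q ** N)"
proof -
  have "ch (\<lambda>Y. P ** Y ** Q) M N = ch (\<lambda>Y. Y) (madj P ** M) (Q ** N)"
    by (subst ch_right) (rule ch_left)
  moreover have "cnj (mtrace (madj P ** M)) = hs M P"
    by (simp add: hs_eq_mtrace madj_mult flip: mtrace_madj)
  ultimately show ?thesis by (simp add: ch_id)
qed

text \<open>So the Choi form of a Kraus sum vanishes exactly at the matrices orthogonal to all Kraus
  operators; the kernel arguments rest on this reading.\<close>

lemma ch_kraus_term: "ch (\<lambda>Y. P ** Y ** madj P) M M = of_real ((cmod (hs P M))\<^sup>2)"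
proof -
  have "ch (\<lambda>Y. P ** Y ** madj P) M M = cnj (hs P M) * hs P M"
    by (simp only: ch_sandwich hs_cnj) (simp only: hs_eq_mtrace)
  then show ?thesis by (simp only: complex_norm_square mult.commute)
qed

section \<open>Superoperators with positive Choi form and their Kraus operators\<close>

lemma superop_add: "superop_linear X \<Longrightarrow> X (A + B) = X A + X B"
  by (simp add: superop_linear_def)

lemma superop_cscale: "superop_linear X \<Longrightarrow> X (cscale c A) = cscale c (X A)"
  by (simp add: superop_linear_def)

lemma superop_linear_imp_linear: "superop_linear X \<Longrightarrow> linear X"
  by (rule linearI) (auto simp: superop_linear_def scaleR_eq_cscale)

lemma superop_diff: "superop_linear X \<Longrightarrow> X (A - B) = X A - X B"
  by (intro linear_diff superop_linear_imp_linear)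

lemma superop_sum: "superop_linear X \<Longrightarrow> X (sum f I) = (\<Sum>i\<in>I. X (f i))"
  by (intro linear_sum superop_linear_imp_linear)

lemma munit_expand: "Y = (\<Sum>i\<in>UNIV. \<Sum>j\<in>UNIV. cscale (Y $ i $ j) (munit i j))"
proof (rule matrix_eqI)
  fix a b
  have "(\<Sum>i\<in>UNIV. \<Sum>j\<in>UNIV. cscale (Y $ i $ j) (munit i j)) $ a $ b
     = (\<Sum>i\<in>UNIV. \<Sum>j\<in>UNIV. if b = j then (if a = i then Y $ i $ j else 0) else 0)"
    unfolding sum_component cscale_nth munit_nth by (intro sum.cong refl) auto
  also have "\<dots> = Y $ a $ b" by simp
  finally show "Y $ a $ b = (\<Sum>i\<in>UNIV. \<Sum>j\<in>UNIV. cscale (Y $ i $ j) (munit i j)) $ a $ b" ..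
qed

lemma superop_expand:
  assumes "superop_linear X"
  shows "X Y = (\<Sum>i\<in>UNIV. \<Sum>j\<in>UNIV. cscale (Y $ i $ j) (X (munit i j)))"
  by (subst munit_expand) (simp add: superop_sum[OF assms] superop_cscale[OF assms])

lemma ch_nth: "ch X M N = (\<Sum>i\<in>UNIV. \<Sum>j\<in>UNIV. \<Sum>k\<in>UNIV. \<Sum>l\<in>UNIV.
    cnj (M $ k $ i) * X (munit i j) $ k $ l * N $ l $ j)"
  unfolding ch_def
  apply (intro sum.cong refl)
  apply (simp add: mm_nth sum_distrib_right sum_distrib_left)
  apply (rule sum.swap)
  done

lemma sum_UNIV_prod:
  fixes f :: "'a::finite \<times> 'b::finite \<Rightarrow> 'c::comm_monoid_add"
  shows "(\<Sum>p\<in>UNIV. f p) = (\<Sum>a\<in>UNIV. \<Sum>b\<in>UNIV. f (a, b))"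
  by (simp add: sum.cartesian_product)

text \<open>Diagonalise the Choi matrix, whose indices are pairs, and fold each eigenvector, scaled
  by the square root of its eigenvalue, back into a square matrix. Hence the type
  \<open>'n \<times> 'n\<close> of Kraus indices.\<close>

theorem choi_psd_kraus:
  fixes X :: "'n::finite cmat \<Rightarrow> 'n cmat"
  assumes lin: "superop_linear X" and pos: "choi_psd X"
  obtains A :: "'n \<times> 'n \<Rightarrow> 'n cmat" where "\<And>Y. X Y = (\<Sum>c\<in>UNIV. A c ** Y ** madj (A c))"
proof -
  define C :: "('n \<times> 'n) cmat" where "C = (\<chi> p q. X (munit (snd p) (snd q)) $ fst p $ fst q)"
  have quad: "cinner v (C *v v) = ch X (\<chi> k i. v $ (k, i)) (\<chi> k i. v $ (k, i))" for v
  proof -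
    have "cinner v (C *v v) = (\<Sum>p\<in>UNIV. \<Sum>q\<in>UNIV. cnj (v $ p) * C $ p $ q * v $ q)"
      by (simp add: cinner_def matrix_vector_mult_def sum_distrib_left mult.assoc)
    also have "\<dots> = (\<Sum>k\<in>UNIV. \<Sum>i\<in>UNIV. \<Sum>l\<in>UNIV. \<Sum>j\<in>UNIV.
        cnj (v $ (k, i)) * X (munit i j) $ k $ l * v $ (l, j))"
      by (simp add: C_def sum_UNIV_prod)
    also have "\<dots> = (\<Sum>i\<in>UNIV. \<Sum>k\<in>UNIV. \<Sum>j\<in>UNIV. \<Sum>l\<in>UNIV.
        cnj (v $ (k, i)) * X (munit i j) $ k $ l * v $ (l, j))"
      by (subst sum.swap, rule sum.cong[OF refl], rule sum.cong[OF refl], rule sum.swap)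
    also have "\<dots> = (\<Sum>i\<in>UNIV. \<Sum>j\<in>UNIV. \<Sum>k\<in>UNIV. \<Sum>l\<in>UNIV.
        cnj (v $ (k, i)) * X (munit i j) $ k $ l * v $ (l, j))"
      by (rule sum.cong[OF refl], rule sum.swap)
    finally show ?thesis by (simp add: ch_nth)
  qed
  have psdC: "psd C"
    using pos by (simp add: psd_def quad choi_psd_def)
  obtain U d where U: "unitary_mat U" and C: "C = U ** diag_mat d ** madj U"
    using hermitian_spectral[OF psd_hermitian[OF psdC]] .
  have d0: "d c \<ge> 0" for c
  proof -
    have "madj U ** C ** U = (madj U ** U) ** diag_mat d ** (madj U ** U)"
      by (simp add: C mm_assoc)
    then have "madj U ** C ** U = diag_mat d"
      using U by (simp add: unitary_mat_def)
    then have "of_real (d c) = (madj U ** C ** U) $ c $ c"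
      by (simp add: diag_mat_def)
    also have "\<dots> = cinner (column c U) (C *v column c U)"
      by (simp add: mm_assoc) (simp add: mm_nth cinner_def column_def matrix_vector_mult_def)
    finally have "d c = Re (cinner (column c U) (C *v column c U))"
      by (metis Re_complex_of_real)
    with psdC show ?thesis by (simp add: psd_def)
  qed
  define A :: "'n \<times> 'n \<Rightarrow> 'n cmat" where "A c = (\<chi> k i. of_real (sqrt (d c)) * U $ (k, i) $ c)" for c
  have Cn: "X (munit i j) $ k $ l = (\<Sum>c\<in>UNIV. A c $ k $ i * cnj (A c $ l $ j))" for i j k l
  proof -
    have "X (munit i j) $ k $ l = C $ (k, i) $ (l, j)" by (simp add: C_def)
    also have "\<dots> = (\<Sum>c\<in>UNIV. (U ** diag_mat d) $ (k, i) $ c * cnj (U $ (l, j) $ c))"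
      by (simp add: C mm_nth[of "U ** diag_mat d"])
    also have "\<dots> = (\<Sum>c\<in>UNIV. A c $ k $ i * cnj (A c $ l $ j))"
    proof (rule sum.cong[OF refl])
      fix c
      have "U $ (k, i) $ b * diag_mat d $ b $ c = (if b = c then U $ (k, i) $ c * of_real (d c) else 0)" for b
        by (simp add: diag_mat_def)
      then have "(U ** diag_mat d) $ (k, i) $ c = U $ (k, i) $ c * of_real (d c)"
        by (simp add: mm_nth)
      moreover have "complex_of_real (d c) = of_real (sqrt (d c)) * of_real (sqrt (d c))"
        using d0[of c] by (simp flip: of_real_mult)
      ultimately show "(U ** diag_mat d) $ (k, i) $ c * cnj (U $ (l, j) $ c) = A c $ k $ i * cnj (A c $ l $ j)"
        by (simp add: A_def)
    qed
    finally show ?thesis .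
  qed
  have "X Y = (\<Sum>c\<in>UNIV. A c ** Y ** madj (A c))" for Y
  proof (rule matrix_eqI)
    fix k l
    have "X Y $ k $ l = (\<Sum>i\<in>UNIV. \<Sum>j\<in>UNIV. Y $ i $ j * X (munit i j) $ k $ l)"
      by (subst superop_expand[OF lin]) simp
    also have "\<dots> = (\<Sum>i\<in>UNIV. \<Sum>j\<in>UNIV. \<Sum>c\<in>UNIV. A c $ k $ i * Y $ i $ j * cnj (A c $ l $ j))"
      by (simp add: Cn sum_distrib_left mult_ac)
    also have "\<dots> = (\<Sum>i\<in>UNIV. \<Sum>c\<in>UNIV. \<Sum>j\<in>UNIV. A c $ k $ i * Y $ i $ j * cnj (A c $ l $ j))"
      by (rule sum.cong[OF refl], rule sum.swap)
    also have "\<dots> = (\<Sum>c\<in>UNIV. \<Sum>i\<in>UNIV. \<Sum>j\<in>UNIV. A c $ k $ i * Y $ i $ j * cnj (A c $ l $ j))"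
      by (rule sum.swap)
    also have "\<dots> = (\<Sum>c\<in>UNIV. (A c ** Y ** madj (A c)) $ k $ l)"
    proof (rule sum.cong[OF refl])
      fix c
      show "(\<Sum>i\<in>UNIV. \<Sum>j\<in>UNIV. A c $ k $ i * Y $ i $ j * cnj (A c $ l $ j)) = (A c ** Y ** madj (A c)) $ k $ l"
        by (subst sum.swap) (simp add: mm_nth sum_distrib_right)
    qed
    finally show "X Y $ k $ l = (\<Sum>c\<in>UNIV. A c ** Y ** madj (A c)) $ k $ l"
      by simp
  qed
  then show thesis by (rule that)
qed

lemma cscale_sum: "cscale c (sum f I) = (\<Sum>i\<in>I. cscale c (f i))"
  by (induction I rule: infinite_finite_induct) (simp_all add: cscale_add_right)

lemma mv_sum_left: "sum f I *v v = (\<Sum>i\<in>I. f i *v v)"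
  by (induction I rule: infinite_finite_induct)
    (simp_all add: vec_eq_iff matrix_vector_mult_def algebra_simps sum.distrib)

lemma cinner_sum_right: "cinner v (sum f I) = (\<Sum>i\<in>I. cinner v (f i))"
  by (induction I rule: infinite_finite_induct) (simp_all add: cinner_add_right)

lemma choi_psd_psd:
  fixes X :: "'n::finite cmat \<Rightarrow> 'n cmat"
  assumes "superop_linear X" "choi_psd X" "psd Y"
  shows "psd (X Y)"
proof -
  obtain A :: "'n \<times> 'n \<Rightarrow> 'n cmat" where A: "\<And>Y. X Y = (\<Sum>c\<in>UNIV. A c ** Y ** madj (A c))"
    using choi_psd_kraus[OF assms(1,2)] by blast
  have "cinner v (X Y *v v) = (\<Sum>c\<in>UNIV. cinner (madj (A c) *v v) (Y *v (madj (A c) *v v)))" for v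
  proof -
    have "X Y *v v = (\<Sum>c\<in>UNIV. (A c ** Y ** madj (A c)) *v v)"
      unfolding A by (rule mv_sum_left)
    then have "cinner v (X Y *v v) = (\<Sum>c\<in>UNIV. cinner v ((A c ** Y ** madj (A c)) *v v))"
      by (simp add: cinner_sum_right)
    also have "\<dots> = (\<Sum>c\<in>UNIV. cinner (madj (A c) *v v) (Y *v (madj (A c) *v v)))"
      by (simp add: cinner_adj[of v "A _"] flip: matrix_vector_mul_assoc)
    finally show ?thesis .
  qed
  then show ?thesis
    using assms(3) by (simp add: psd_def sum_nonneg)
qed

lemma choi_psd_comp:
  fixes X Y :: "'n::finite cmat \<Rightarrow> 'n cmat"
  assumes "superop_linear X" "choi_psd X" "choi_psd Y"
  shows "choi_psd (\<lambda>Z. X (Y Z))"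
proof -
  obtain A :: "'n \<times> 'n \<Rightarrow> 'n cmat" where A: "\<And>Y. X Y = (\<Sum>c\<in>UNIV. A c ** Y ** madj (A c))"
    using choi_psd_kraus[OF assms(1,2)] by blast
  have "ch (\<lambda>Z. X (Y Z)) M M = (\<Sum>c\<in>UNIV. ch Y (madj (A c) ** M) (madj (A c) ** M))" for M
    unfolding A by (subst ch_sum) (simp add: ch_right ch_left)
  then show ?thesis
    using assms(3) by (simp add: choi_psd_def sum_nonneg)
qed

text \<open>Complete positivity is applied to a single block matrix, that of all matrix units (an
  unnormalised maximally entangled state), with as many blocks as the dimension.\<close>

lemma cp_choi_psd:
  fixes X :: "'n::finite cmat \<Rightarrow> 'n cmat"
  assumes "completely_positive X"
  shows "choi_psd X"
  unfolding choi_psd_def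
proof
  fix M :: "'n cmat"
  \<comment> \<open>Blocks are numbered by naturals while matrix indices form a type.\<close>
  obtain b where b: "bij_betw b {..<CARD('n)} (UNIV :: 'n set)"
    using ex_bij_betw_nat_finite[of "UNIV :: 'n set"] by (auto simp: lessThan_atLeast0)
  have quad: "(\<Sum>i<CARD('n). \<Sum>j<CARD('n). cinner (v (b i)) (Z (munit (b i) (b j)) *v v (b j))) =
      ch Z (\<chi> k i. v i $ k) (\<chi> k i. v i $ k)" for v :: "'n \<Rightarrow> complex ^ 'n" and Z
  proof -
    have "(\<Sum>i<CARD('n). \<Sum>j<CARD('n). cinner (v (b i)) (Z (munit (b i) (b j)) *v v (b j)))
       = (\<Sum>i\<in>UNIV. \<Sum>j\<in>UNIV. cinner (v i) (Z (munit i j) *v v j))"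
      by (subst sum.reindex_bij_betw[OF b, symmetric])
        (intro sum.cong refl, subst sum.reindex_bij_betw[OF b, symmetric], rule refl)
    also have "\<dots> = ch Z (\<chi> k i. v i $ k) (\<chi> k i. v i $ k)"
      by (simp add: ch_nth cinner_def matrix_vector_mult_def sum_distrib_left mult.assoc)
    finally show ?thesis .
  qed
  have "block_psd (CARD('n)) (\<lambda>i j. munit (b i) (b j))"
    unfolding block_psd_def
  proof
    fix v :: "nat \<Rightarrow> complex ^ 'n"
    define w where "w = v \<circ> the_inv_into {..<CARD('n)} b"
    have w: "v i = w (b i)" if "i < CARD('n)" for i
      using that b by (simp add: w_def bij_betw_def the_inv_into_f_f)
    have "(\<Sum>i<CARD('n). \<Sum>j<CARD('n). cinner (v i) (munit (b i) (b j) *v v j)) =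
       (\<Sum>i<CARD('n). \<Sum>j<CARD('n). cinner (w (b i)) (munit (b i) (b j) *v w (b j)))"
      using w by (intro sum.cong refl) auto
    also have "\<dots> = ch (\<lambda>Y. Y) (\<chi> k i. w i $ k) (\<chi> k i. w i $ k)"
      by (rule quad)
    finally show "Im (\<Sum>i<CARD('n). \<Sum>j<CARD('n). cinner (v i) (munit (b i) (b j) *v v j)) = 0 \<and>
        0 \<le> Re (\<Sum>i<CARD('n). \<Sum>j<CARD('n). cinner (v i) (munit (b i) (b j) *v v j))"
      by (simp add: ch_id)
  qed
  then have "block_psd (CARD('n)) (\<lambda>i j. X (munit (b i) (b j)))"
    using assms by (simp add: completely_positive_def)
  then have *: "Im (\<Sum>i<CARD('n). \<Sum>j<CARD('n). cinner (v i) (X (munit (b i) (b j)) *v v j)) = 0 \<and>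
        0 \<le> Re (\<Sum>i<CARD('n). \<Sum>j<CARD('n). cinner (v i) (X (munit (b i) (b j)) *v v j))" for v
    by (simp add: block_psd_def)
  have "(\<chi> k i. column i M $ k) = M" by (simp add: vec_eq_iff column_def)
  with *[of "\<lambda>i. column (b i) M"] quad[of "\<lambda>i. column i M" X]
  show "Im (ch X M M) = 0 \<and> 0 \<le> Re (ch X M M)" by simp
qed

section \<open>Null vectors and comparison of positive semidefinite real forms\<close>

lemma psd_form_kernel:
  fixes h :: "'a::euclidean_space \<Rightarrow> 'a \<Rightarrow> real"
  assumes bh: "bounded_bilinear h" and sh: "\<And>x y. h x y = h y x" and ph: "\<And>x. 0 \<le> h x x"
    and 0: "h x x = 0"
  shows "h x y = 0"
proof (rule ccontr)
  assume nz: "h x y \<noteq> 0"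
  interpret bounded_bilinear h by fact
  \<comment> \<open>At \<open>y + t *\<^sub>R x\<close> the form is affine in \<open>t\<close> since
    \<open>x\<close> is a null vector; this \<open>t\<close> gives it the value -1.\<close>
  define t where "t = - (h y y + 1) / (2 * h x y)"
  have "h (y + t *\<^sub>R x) (y + t *\<^sub>R x) = h y y + 2 * t * h x y"
    by (simp add: add_left add_right scaleR_left scaleR_right 0 sh[of y x])
  also have "\<dots> = -1" using nz by (simp add: t_def field_simps)
  finally show False using ph[of "y + t *\<^sub>R x"] by simp
qed

text \<open>By compactness a positive semidefinite form is coercive on the orthogonal complement of its
  kernel.\<close>
lemma psd_form_dominates:
  fixes f g :: "'a::euclidean_space \<Rightarrow> 'a \<Rightarrow> real"
  assumes bf: "bounded_bilinear f" and sf: "\<And>x y. f x y = f y x" and pf: "\<And>x. 0 \<le> f x x"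
    and bg: "bounded_bilinear g" and sg: "\<And>x y. g x y = g y x" and pg: "\<And>x. 0 \<le> g x x"
    and ker: "\<And>x. f x x = 0 \<Longrightarrow> g x x = 0"
  obtains C where "C > 0" "\<And>x. g x x \<le> C * f x x"
proof -
  interpret f: bounded_bilinear f by fact
  interpret g: bounded_bilinear g by fact
  define N where "N = {x. f x x = 0}"
  have subN: "subspace N"
    by (rule subspaceI)
      (auto simp: N_def f.add_left f.add_right f.scaleR_left f.scaleR_right f.zero_left psd_form_kernel[OF bf sf pf])
  define W where "W = {y. \<forall>x\<in>N. x \<bullet> y = 0}"
  have clW: "closed W"
  proof -
    have "W = (\<Inter>x\<in>N. {y. x \<bullet> y = 0})" by (auto simp: W_def)
    then show ?thesis by (simp add: closed_hyperplane closed_INT)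
  qed
  define K where "K = W \<inter> sphere 0 1"
  have "compact K" unfolding K_def by (intro closed_Int_compact clW compact_sphere)
  have cont: "continuous_on S (\<lambda>x. f x x)" for S
    by (intro f.continuous_on continuous_intros)
  have Wsc: "c *\<^sub>R x \<in> W" if "x \<in> W" for c x using that by (simp add: W_def)
  have "\<exists>c>0. \<forall>x\<in>K. c \<le> f x x"
  proof (cases "K = {}")
    case True then show ?thesis by (intro exI[of _ 1]) auto
  next
    case False
    then obtain x where x: "x \<in> K" "\<And>y. y \<in> K \<Longrightarrow> f x x \<le> f y y"
      using continuous_attains_inf[OF \<open>compact K\<close> _ cont] by blast
    have "f x x \<noteq> 0"
    proof
      assume "f x x = 0"
      then have "x \<in> N" by (simp add: N_def)
      with x(1) have "x \<bullet> x = 0" by (simp add: K_def W_def)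
      with x(1) show False by (simp add: K_def)
    qed
    with pf[of x] x(2) show ?thesis by (intro exI[of _ "f x x"]) auto
  qed
  then obtain c where c: "c > 0" "\<And>x. x \<in> K \<Longrightarrow> c \<le> f x x" by blast
  have coer: "c * (norm x)\<^sup>2 \<le> f x x" if "x \<in> W" for x
  proof (cases "x = 0")
    case False
    have "(1 / norm x) *\<^sub>R x \<in> K" using False Wsc[OF that] by (simp add: K_def)
    from c(2)[OF this] have "c \<le> f x x / (norm x)\<^sup>2"
      by (simp add: f.scaleR_left f.scaleR_right power2_eq_square)
    then show ?thesis using False by (simp add: field_simps)
  qed (simp add: f.zero_left)
  obtain B where B: "B > 0" "\<And>x y. norm (g x y) \<le> norm x * norm y * B"
    using g.pos_bounded by blast
  show thesis
  proof (rule that[of "B / c"])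
    show "B / c > 0" using B(1) c(1) by simp
    fix x
    obtain y z where yz: "y \<in> span N" "\<And>w. w \<in> span N \<Longrightarrow> orthogonal z w" "x = y + z"
      using orthogonal_subspace_decomp_exists[of N x] by metis
    have "y \<in> N" using yz(1) subN by (metis span_eq_iff)
    then have y: "f y y = 0" by (simp add: N_def)
    have z: "z \<in> W" using yz(2) by (auto simp: W_def orthogonal_def inner_commute span_base)
    \<comment> \<open>\<open>y\<close> is a null vector of both forms, so only the component
      \<open>z\<close> in \<open>W\<close> counts, where \<open>f\<close> is coercive.\<close>
    have "f x x = f z z"
      by (simp add: yz(3) f.add_left f.add_right y psd_form_kernel[OF bf sf pf y] sf[of z y])
    moreover have "g x x = g z z"
      using ker[OF y]
      by (simp add: yz(3) g.add_left g.add_right psd_form_kernel[OF bg sg pg ker[OF y]] sg[of z y])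
    moreover have "g z z \<le> B * (norm z)\<^sup>2"
      using B(2)[of z z] by (simp add: power2_eq_square mult_ac)
    moreover have "B * (norm z)\<^sup>2 \<le> B / c * f z z"
      using coer[OF z] B(1) c(1) by (simp add: field_simps)
    ultimately show "g x x \<le> B / c * f x x" by simp
  qed
qed

subsection \<open>Relative entropy as an integral of quadratic divergences\<close>

lemma diag_mult_left_nth: "(diag_mat d ** A) $ i $ j = of_real (d i) * A $ i $ j"
proof -
  have "diag_mat d $ i $ k * A $ k $ j = (if k = i then of_real (d i) * A $ i $ j else 0)" for k
    by (simp add: diag_mat_def)
  then show ?thesis by (simp add: mm_nth)
qed

lemma diag_mult_right_nth: "(A ** diag_mat d) $ i $ j = A $ i $ j * of_real (d j)"
proof -
  have "A $ i $ k * diag_mat d $ k $ j = (if k = j then A $ i $ j * of_real (d j) else 0)" for k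
    by (simp add: diag_mat_def)
  then show ?thesis by (simp add: mm_nth)
qed

lemma unitary_mult:
  assumes "unitary_mat U" "unitary_mat V"
  shows "unitary_mat (madj U ** V)"
proof -
  have "madj (madj U ** V) ** (madj U ** V) = madj V ** (U ** madj U) ** V"
    by (simp add: madj_mult mm_assoc)
  moreover have "(madj U ** V) ** madj (madj U ** V) = madj U ** (V ** madj V) ** U"
    by (simp add: madj_mult mm_assoc)
  ultimately show ?thesis using assms by (simp add: unitary_mat_def)
qed

lemma unitary_row_sum:
  assumes "unitary_mat W"
  shows "(\<Sum>j\<in>UNIV. (cmod (W $ i $ j))\<^sup>2) = 1"
proof -
  have "(W ** madj W) $ i $ i = 1" using assms by (simp add: unitary_mat_def mat_one_nth)
  then have "of_real (\<Sum>j\<in>UNIV. (cmod (W $ i $ j))\<^sup>2) = (1 :: complex)"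
    by (simp only: mm_nth of_real_sum complex_norm_square madj_nth)
  then show ?thesis using of_real_eq_1_iff by blast
qed

lemma unitary_col_sum:
  assumes "unitary_mat W"
  shows "(\<Sum>i\<in>UNIV. (cmod (W $ i $ j))\<^sup>2) = 1"
proof -
  have "(madj W ** W) $ j $ j = 1" using assms by (simp add: unitary_mat_def mat_one_nth)
  then have "of_real (\<Sum>i\<in>UNIV. (cmod (W $ i $ j))\<^sup>2) = (1 :: complex)"
    by (simp only: mm_nth of_real_sum complex_norm_square madj_nth mult.commute)
  then show ?thesis using of_real_eq_1_iff by blast
qed

text \<open>The squared overlaps of two eigenbases act as weights on pairs of eigenvalues. They sum
  to one along rows and columns, so quantities of two noncommuting states become averages of scalar
  ones.\<close>

lemma mtrace_diag_diag:
  "mtrace (U ** diag_mat a ** madj U ** (V ** diag_mat b ** madj V)) =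
    of_real (\<Sum>i\<in>UNIV. \<Sum>j\<in>UNIV. (cmod ((madj U ** V) $ i $ j))\<^sup>2 * (a i * b j))"
proof -
  define W where "W = madj U ** V"
  have "mtrace (U ** diag_mat a ** madj U ** (V ** diag_mat b ** madj V)) =
      mtrace ((U ** diag_mat a ** madj U ** V ** diag_mat b) ** madj V)"
    by (simp add: matrix_mul_assoc)
  also have "\<dots> = mtrace (madj V ** (U ** diag_mat a ** madj U ** V ** diag_mat b))"
    by (rule mtrace_commute)
  also have "\<dots> = mtrace (madj W ** (diag_mat a ** W ** diag_mat b))"
    by (simp add: W_def madj_mult matrix_mul_assoc)
  also have "\<dots> = (\<Sum>i\<in>UNIV. \<Sum>j\<in>UNIV. cnj (W $ i $ j) * (diag_mat a ** W ** diag_mat b) $ i $ j)"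
    by (simp only: hs_eq_mtrace[symmetric] hs_def)
  also have "\<dots> = of_real (\<Sum>i\<in>UNIV. \<Sum>j\<in>UNIV. (cmod (W $ i $ j))\<^sup>2 * (a i * b j))"
    by (simp add: diag_mult_left_nth diag_mult_right_nth complex_norm_square mult_ac del: of_real_power)
  finally show ?thesis by (simp add: W_def)
qed

text \<open>\<open>mlog\<close> is a choice; the decomposition returned is one that witnesses it, so
  the matrix and its logarithm are diagonal in the same basis by construction.\<close>

lemma psd_spectral:
  assumes "psd A"
  obtains U d where "unitary_mat U" "A = U ** diag_mat d ** madj U" "\<And>i. d i \<ge> 0"
    "mlog A = U ** diag_mat (\<lambda>i. if d i > 0 then ln (d i) else 0) ** madj U"
proof -
  let ?P = "\<lambda>B. \<exists>U d. unitary_mat U \<and> A = U ** diag_mat d ** madj U \<and>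
               B = U ** diag_mat (\<lambda>i. if d i > 0 then ln (d i) else 0) ** madj U"
  have "\<exists>B. ?P B"
    using hermitian_spectral[OF psd_hermitian[OF assms]] by metis
  then have "?P (SOME B. ?P B)" by (rule someI_ex)
  then have "?P (mlog A)" by (simp only: mlog_def)
  then obtain U d where U: "unitary_mat U" and A: "A = U ** diag_mat d ** madj U"
    and l: "mlog A = U ** diag_mat (\<lambda>i. if d i > 0 then ln (d i) else 0) ** madj U"
    by blast
  have "d c \<ge> 0" for c
  proof -
    have "madj U ** A ** U = (madj U ** U) ** diag_mat d ** (madj U ** U)"
      by (simp add: A mm_assoc)
    then have "madj U ** A ** U = diag_mat d"
      using U by (simp add: unitary_mat_def)
    then have "of_real (d c) = (madj U ** A ** U) $ c $ c"
      by (simp add: diag_mat_def)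
    also have "\<dots> = cinner (column c U) (A *v column c U)"
      by (simp add: mm_assoc) (simp add: mm_nth cinner_def column_def matrix_vector_mult_def)
    finally have "d c = Re (cinner (column c U) (A *v column c U))"
      by (metis Re_complex_of_real)
    with assms show ?thesis by (simp add: psd_def)
  qed
  with U A l show thesis by (intro that) auto
qed

lemma mtrace_spectral:
  assumes "unitary_mat U"
  shows "mtrace (U ** diag_mat d ** madj U) = of_real (\<Sum>i\<in>UNIV. d i)"
proof -
  have "mtrace (U ** diag_mat d ** madj U) = mtrace (madj U ** (U ** diag_mat d))"
    by (rule mtrace_commute)
  also have "madj U ** (U ** diag_mat d) = diag_mat d"
    using assms by (simp add: matrix_mul_assoc unitary_mat_def)
  finally show ?thesis by (simp add: mtrace_def diag_mat_def)
qed

lemma psd_mtrace_nonneg: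
  assumes "psd A"
  shows "0 \<le> Re (mtrace (A ** (x ** madj x)))"
proof -
  have "mtrace (A ** (x ** madj x)) = mtrace (madj x ** (A ** x))"
    by (simp add: matrix_mul_assoc mtrace_commute[of _ "madj x"])
  also have "\<dots> = (\<Sum>i\<in>UNIV. cinner (column i x) (A *v column i x))"
    by (simp add: mtrace_def mm_nth[of "madj x"]) (simp add: mm_nth cinner_def column_def matrix_vector_mult_def)
  finally show ?thesis using assms by (simp add: psd_def sum_nonneg)
qed

text \<open>The \<open>\<chi>\<^sup>2\<close>-type divergence with parameter \<open>t\<close>, written as a variational problem (Kosaki): the
  form \<open>x \<mapsto> tr (\<rho> x x\<^sup>*) + t tr (\<sigma> x\<^sup>* x)\<close> is dualised against \<open>\<rho> - \<sigma>\<close>.\<close>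
definition chi_form :: "real \<Rightarrow> 'n::finite cmat \<Rightarrow> 'n cmat \<Rightarrow> 'n cmat \<Rightarrow> real" where
  "chi_form t \<rho> \<sigma> x = 2 * Re (mtrace (madj x ** (\<rho> - \<sigma>))) - Re (mtrace (\<rho> ** (x ** madj x)))
     - t * Re (mtrace (\<sigma> ** (madj x ** x)))"

definition chi_div :: "real \<Rightarrow> 'n::finite cmat \<Rightarrow> 'n cmat \<Rightarrow> real" where
  "chi_div t \<rho> \<sigma> = (SUP x. chi_form t \<rho> \<sigma> x)"

text \<open>The substitution \<open>x = U ** y ** madj V\<close> is adapted to both eigenbases and
  decouples the variational problem into one scalar quadratic problem per entry of
  \<open>y\<close>.\<close>

lemma chi_form_spectral:
  assumes U: "unitary_mat U" and V: "unitary_mat V"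
    and r: "\<rho> = U ** diag_mat p ** madj U" and s: "\<sigma> = V ** diag_mat q ** madj V"
  shows "chi_form t \<rho> \<sigma> (U ** y ** madj V) = (\<Sum>i\<in>UNIV. \<Sum>j\<in>UNIV.
    2 * (p i - q j) * Re (cnj (y $ i $ j) * (madj U ** V) $ i $ j) - (p i + t * q j) * (cmod (y $ i $ j))\<^sup>2)"
proof -
  define W where "W = madj U ** V"
  let ?x = "U ** y ** madj V"
  have adj: "madj ?x = V ** madj y ** madj U"
    by (simp add: madj_mult matrix_mul_assoc)
  have UU: "madj U ** U = mat 1" and VV: "madj V ** V = mat 1"
    using U V by (simp_all add: unitary_mat_def)
  have rU: "\<rho> ** U = U ** diag_mat p" "madj U ** \<rho> = diag_mat p ** madj U"
    using UU unfolding r by (simp_all add: matrix_mul_assoc) (simp add: mm_assoc)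
  have sV: "\<sigma> ** V = V ** diag_mat q"
    using VV unfolding s by (simp add: mm_assoc)
  have 1: "mtrace (madj ?x ** \<rho>) = mtrace (madj y ** (diag_mat p ** W))"
  proof -
    have "mtrace (madj ?x ** \<rho>) = mtrace (V ** (madj y ** (diag_mat p ** madj U)))"
      unfolding adj by (simp add: mm_assoc rU)
    also have "\<dots> = mtrace ((madj y ** (diag_mat p ** madj U)) ** V)"
      by (rule mtrace_commute)
    finally show ?thesis by (simp add: mm_assoc W_def)
  qed
  have 2: "mtrace (madj ?x ** \<sigma>) = mtrace (madj y ** (W ** diag_mat q))"
  proof -
    have "mtrace (madj ?x ** \<sigma>) = mtrace (V ** (madj y ** (madj U ** \<sigma>)))"
      unfolding adj by (simp add: mm_assoc)
    also have "\<dots> = mtrace ((madj y ** (madj U ** \<sigma>)) ** V)"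
      by (rule mtrace_commute)
    finally show ?thesis by (simp add: mm_assoc sV W_def)
  qed
  have 3: "mtrace (\<rho> ** (?x ** madj ?x)) = mtrace (madj y ** (diag_mat p ** y))"
  proof -
    have "?x ** madj ?x = U ** (y ** ((madj V ** V) ** (madj y ** madj U)))"
      unfolding adj by (simp add: mm_assoc)
    then have "mtrace (\<rho> ** (?x ** madj ?x)) = mtrace ((\<rho> ** U) ** (y ** (madj y ** madj U)))"
      by (simp add: VV mm_assoc)
    also have "\<dots> = mtrace (U ** (diag_mat p ** y ** madj y ** madj U))"
      by (simp add: rU mm_assoc)
    also have "\<dots> = mtrace ((diag_mat p ** y ** madj y ** madj U) ** U)"
      by (rule mtrace_commute)
    also have "\<dots> = mtrace ((diag_mat p ** y) ** madj y)"
      by (simp add: mm_assoc UU)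
    also have "\<dots> = mtrace (madj y ** (diag_mat p ** y))"
      by (rule mtrace_commute)
    finally show ?thesis .
  qed
  have 4: "mtrace (\<sigma> ** (madj ?x ** ?x)) = mtrace (madj y ** (y ** diag_mat q))"
  proof -
    have "madj ?x ** ?x = V ** (madj y ** ((madj U ** U) ** (y ** madj V)))"
      unfolding adj by (simp add: mm_assoc)
    then have "mtrace (\<sigma> ** (madj ?x ** ?x)) = mtrace ((\<sigma> ** V) ** (madj y ** (y ** madj V)))"
      by (simp add: UU mm_assoc)
    also have "\<dots> = mtrace (V ** (diag_mat q ** madj y ** y ** madj V))"
      by (simp add: sV mm_assoc)
    also have "\<dots> = mtrace ((diag_mat q ** madj y ** y ** madj V) ** V)"
      by (rule mtrace_commute)
    also have "\<dots> = mtrace (diag_mat q ** (madj y ** y))"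
      by (simp add: mm_assoc VV)
    also have "\<dots> = mtrace ((madj y ** y) ** diag_mat q)"
      by (rule mtrace_commute)
    finally show ?thesis by (simp add: mm_assoc)
  qed
  have sq: "Re (cnj z * (of_real a * z)) = a * (cmod z)\<^sup>2" for z a
    unfolding cmod_power2 by (simp add: power2_eq_square algebra_simps)
  have "chi_form t \<rho> \<sigma> ?x = (\<Sum>i\<in>UNIV. \<Sum>j\<in>UNIV.
     2 * (Re (cnj (y $ i $ j) * (of_real (p i) * W $ i $ j)) - Re (cnj (y $ i $ j) * (W $ i $ j * of_real (q j))))
     - Re (cnj (y $ i $ j) * (of_real (p i) * y $ i $ j))
     - t * Re (cnj (y $ i $ j) * (y $ i $ j * of_real (q j))))"
    unfolding chi_form_def mm_diff_right mtrace_diff 1 2 3 4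
    unfolding hs_eq_mtrace[symmetric] hs_def diag_mult_left_nth diag_mult_right_nth
    by (simp add: sum_subtractf sum_distrib_left right_diff_distrib)
  also have "\<dots> = (\<Sum>i\<in>UNIV. \<Sum>j\<in>UNIV.
    2 * (p i - q j) * Re (cnj (y $ i $ j) * W $ i $ j) - (p i + t * q j) * (cmod (y $ i $ j))\<^sup>2)"
    by (intro sum.cong refl)
      (simp only: mult.commute[of _ "complex_of_real _"] sq,
       simp add: mult.left_commute[of "cnj _" "complex_of_real _"] algebra_simps)
  finally show ?thesis by (simp add: W_def)
qed

text \<open>Completing the square in \<open>y\<close>. If the leading coefficient
  \<open>p + t * q\<close> is zero, so are \<open>p\<close> and \<open>q\<close>, and the quotient
  \<open>0 / 0 = 0\<close> is the right value.\<close>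

lemma chi_term_le:
  fixes y w :: complex
  assumes "p \<ge> 0" "q \<ge> 0" "t > 0"
  shows "2 * (p - q) * Re (cnj y * w) - (p + t * q) * (cmod y)\<^sup>2 \<le> (cmod w)\<^sup>2 * ((p - q)\<^sup>2 / (p + t * q))"
proof (cases "p + t * q = 0")
  case True
  then have "p = 0 \<and> q = 0" using assms by (smt (verit) mult_nonneg_nonneg mult_eq_0_iff)
  then show ?thesis by simp
next
  case False
  define s where "s = p + t * q"
  have s: "s > 0" using False assms unfolding s_def by (smt (verit) mult_nonneg_nonneg)
  have "0 \<le> (cmod (of_real s * y - of_real (p - q) * w))\<^sup>2" by simp
  also have "\<dots> = s\<^sup>2 * (cmod y)\<^sup>2 - s * (2 * (p - q) * Re (cnj y * w)) + (p - q)\<^sup>2 * (cmod w)\<^sup>2"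
    unfolding cmod_power2 by (simp add: power2_eq_square algebra_simps)
  finally have "s * (2 * (p - q) * Re (cnj y * w) - s * (cmod y)\<^sup>2) \<le> (p - q)\<^sup>2 * (cmod w)\<^sup>2"
    by (simp add: power2_eq_square algebra_simps)
  then have "2 * (p - q) * Re (cnj y * w) - s * (cmod y)\<^sup>2 \<le> (p - q)\<^sup>2 * (cmod w)\<^sup>2 / s"
    using s by (simp add: field_simps)
  then show ?thesis by (simp add: s_def mult.commute)
qed

lemma chi_term_eq:
  fixes w :: complex
  assumes "p \<ge> 0" "q \<ge> 0" "t > 0"
  defines "y \<equiv> of_real ((p - q) / (p + t * q)) * w"
  shows "2 * (p - q) * Re (cnj y * w) - (p + t * q) * (cmod y)\<^sup>2 = (cmod w)\<^sup>2 * ((p - q)\<^sup>2 / (p + t * q))"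
proof -
  have 1: "Re (cnj y * w) = (p - q) / (p + t * q) * (cmod w)\<^sup>2"
    unfolding cmod_power2 by (simp add: y_def power2_eq_square algebra_simps add_divide_distrib diff_divide_distrib)
  have 2: "(cmod y)\<^sup>2 = ((p - q) / (p + t * q))\<^sup>2 * (cmod w)\<^sup>2"
    unfolding y_def norm_mult norm_of_real power_mult_distrib power2_abs ..
  show ?thesis
  proof (cases "p + t * q = 0")
    case True
    with 1 2 show ?thesis by simp
  next
    case False
    define s where "s = p + t * q"
    define r where "r = (p - q) / s"
    have pq: "p - q = r * s" using False by (simp add: r_def s_def)
    show ?thesis
      using False unfolding 1 2 s_def[symmetric] r_def[symmetric] unfolding pq
      by (simp add: power2_eq_square)
  qed
qed

text \<open>The entrywise maximisers assemble to one matrix, so the supremum is attained and later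
  estimates can start from an optimal \<open>x\<close>. The explicit formula is what gets integrated
  over \<open>t\<close>.\<close>

lemma chi_div_spectral:
  assumes U: "unitary_mat U" and V: "unitary_mat V"
    and r: "\<rho> = U ** diag_mat p ** madj U" and s: "\<sigma> = V ** diag_mat q ** madj V"
    and p: "\<And>i. p i \<ge> 0" and q: "\<And>i. q i \<ge> 0" and t: "t > 0"
  shows "chi_form t \<rho> \<sigma> x \<le> chi_div t \<rho> \<sigma>"
    and "\<exists>x. chi_form t \<rho> \<sigma> x = chi_div t \<rho> \<sigma>"
    and "chi_div t \<rho> \<sigma> = (\<Sum>i\<in>UNIV. \<Sum>j\<in>UNIV. (cmod ((madj U ** V) $ i $ j))\<^sup>2 * ((p i - q j)\<^sup>2 / (p i + t * q j)))"
proof -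
  define m where "m = (\<Sum>i\<in>UNIV. \<Sum>j\<in>UNIV. (cmod ((madj U ** V) $ i $ j))\<^sup>2 * ((p i - q j)\<^sup>2 / (p i + t * q j)))"
  have le: "chi_form t \<rho> \<sigma> x \<le> m" for x
  proof -
    have "x = U ** (madj U ** x ** V) ** madj V"
      using U V by (simp add: unitary_mat_def matrix_mul_assoc) (simp add: mm_assoc)
    then have "chi_form t \<rho> \<sigma> x = chi_form t \<rho> \<sigma> (U ** (madj U ** x ** V) ** madj V)" by simp
    also have "\<dots> \<le> m"
      unfolding chi_form_spectral[OF U V r s] m_def
      by (intro sum_mono chi_term_le p q t)
    finally show ?thesis .
  qed
  define x0 where "x0 = U ** (\<chi> i j. of_real ((p i - q j) / (p i + t * q j)) * (madj U ** V) $ i $ j) ** madj V"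
  have eq: "chi_form t \<rho> \<sigma> x0 = m"
    unfolding x0_def chi_form_spectral[OF U V r s] m_def
    by (simp only: vec_lambda_beta chi_term_eq[OF p q t])
  have div: "chi_div t \<rho> \<sigma> = m"
    unfolding chi_div_def
  proof (rule cSup_eq_maximum)
    show "m \<in> range (chi_form t \<rho> \<sigma>)" using eq by (metis rangeI)
  qed (use le in auto)
  show "chi_form t \<rho> \<sigma> x \<le> chi_div t \<rho> \<sigma>" using le div by simp
  show "\<exists>x. chi_form t \<rho> \<sigma> x = chi_div t \<rho> \<sigma>" using eq div by auto
  show "chi_div t \<rho> \<sigma> = (\<Sum>i\<in>UNIV. \<Sum>j\<in>UNIV. (cmod ((madj U ** V) $ i $ j))\<^sup>2 * ((p i - q j)\<^sup>2 / (p i + t * q j)))"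
    using div by (simp add: m_def)
qed

lemma chi_div_psd:
  assumes "psd \<rho>" "psd \<sigma>" "t > 0"
  shows "chi_form t \<rho> \<sigma> x \<le> chi_div t \<rho> \<sigma>" "\<exists>x. chi_form t \<rho> \<sigma> x = chi_div t \<rho> \<sigma>"
proof -
  obtain U p where 1: "unitary_mat U" "\<rho> = U ** diag_mat p ** madj U" "\<And>i. p i \<ge> 0"
    using psd_spectral[OF assms(1)] by metis
  obtain V q where 2: "unitary_mat V" "\<sigma> = V ** diag_mat q ** madj V" "\<And>i. q i \<ge> 0"
    using psd_spectral[OF assms(2)] by metis
  show "chi_form t \<rho> \<sigma> x \<le> chi_div t \<rho> \<sigma>" "\<exists>x. chi_form t \<rho> \<sigma> x = chi_div t \<rho> \<sigma>"
    using chi_div_spectral[OF 1(1) 2(1) 1(2) 2(2) 1(3) 2(3) assms(3)] by blast+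
qed

text \<open>Kadison--Schwarz for the dual \<open>x \<mapsto> \<Sum> A\<^sup>* x A\<close>, obtained by expanding
  \<open>\<Sum> (x\<^sup>* A - A x'\<^sup>*)\<^sup>* (x\<^sup>* A - A x'\<^sup>*)\<close>.\<close>
lemma kadison_schwarz:
  fixes A :: "'c::finite \<Rightarrow> 'n::finite cmat"
  assumes one: "(\<Sum>c\<in>UNIV. madj (A c) ** A c) = mat 1" and Y: "psd Y"
  defines "D \<equiv> \<lambda>x. \<Sum>c\<in>UNIV. madj (A c) ** x ** A c"
  shows "Re (mtrace (Y ** (D x ** madj (D x)))) \<le> Re (mtrace (Y ** D (x ** madj x)))"
proof -
  define Z where "Z c = madj (madj x ** A c - A c ** madj (D x))" for c
  have exp: "Z c ** madj (Z c) = madj (A c) ** (x ** madj x) ** A c - madj (A c) ** x ** A c ** madj (D x)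
     - D x ** (madj (A c) ** madj x ** A c) + D x ** (madj (A c) ** A c) ** madj (D x)" for c
    by (simp add: Z_def madj_diff madj_mult mm_diff_left mm_diff_right matrix_mul_assoc)
  have Dadj: "(\<Sum>c\<in>UNIV. madj (A c) ** madj x ** A c) = madj (D x)"
    by (simp add: D_def madj_sum madj_mult matrix_mul_assoc)
  have "(\<Sum>c\<in>UNIV. Z c ** madj (Z c)) = D (x ** madj x) - (\<Sum>c\<in>UNIV. madj (A c) ** x ** A c) ** madj (D x)
     - D x ** (\<Sum>c\<in>UNIV. madj (A c) ** madj x ** A c) + D x ** (\<Sum>c\<in>UNIV. madj (A c) ** A c) ** madj (D x)"
    by (simp only: exp sum.distrib sum_subtractf mm_sum_left mm_sum_right D_def)
  also have "\<dots> = D (x ** madj x) - D x ** madj (D x)"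
    unfolding Dadj one by (simp add: D_def)
  finally have Zs: "(\<Sum>c\<in>UNIV. Z c ** madj (Z c)) = D (x ** madj x) - D x ** madj (D x)" .
  have "Re (mtrace (Y ** (D (x ** madj x) - D x ** madj (D x)))) =
     (\<Sum>c\<in>UNIV. Re (mtrace (Y ** (Z c ** madj (Z c)))))"
    unfolding Zs[symmetric] by (simp add: mm_sum_right mtrace_sum)
  also have "\<dots> \<ge> 0" by (intro sum_nonneg psd_mtrace_nonneg Y)
  finally show ?thesis by (simp add: mm_diff_right mtrace_diff)
qed

text \<open>The shared part \<open>e *\<^sub>R \<alpha>\<close> cancels in the linear term and
  enters the quadratic terms with a favourable sign. The rest moves to the dual map, where
  Kadison--Schwarz is used for \<open>x ** madj x\<close> under \<open>\<rho>\<close> and for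
  \<open>madj x ** x\<close> under \<open>\<sigma>\<close>.\<close>

lemma chi_form_contract:
  fixes A :: "'c::finite \<Rightarrow> 'n::finite cmat"
  assumes one: "(\<Sum>c\<in>UNIV. madj (A c) ** A c) = mat 1"
    and psd: "psd \<rho>" "psd \<sigma>" "psd \<alpha>" and eps: "0 \<le> e" "e \<le> 1" and t: "t > 0"
  defines "P \<equiv> \<lambda>Y. \<Sum>c\<in>UNIV. A c ** Y ** madj (A c)"
  shows "chi_form t ((1 - e) *\<^sub>R P \<rho> + e *\<^sub>R \<alpha>) ((1 - e) *\<^sub>R P \<sigma> + e *\<^sub>R \<alpha>) x
    \<le> (1 - e) * chi_form t \<rho> \<sigma> (\<Sum>c\<in>UNIV. madj (A c) ** x ** A c)"
proof -
  define D where "D x = (\<Sum>c\<in>UNIV. madj (A c) ** x ** A c)" for x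
  have dual: "mtrace (P Y ** Z) = mtrace (Y ** D Z)" for Y Z
    unfolding P_def D_def mm_sum_left mm_sum_right mtrace_sum
  proof (rule sum.cong[OF refl])
    fix c
    have "mtrace (A c ** (Y ** madj (A c) ** Z)) = mtrace ((Y ** madj (A c) ** Z) ** A c)"
      by (rule mtrace_commute)
    then show "mtrace (A c ** Y ** madj (A c) ** Z) = mtrace (Y ** (madj (A c) ** Z ** A c))"
      by (simp add: matrix_mul_assoc)
  qed
  have Dadj: "D (madj x) = madj (D x)" for x
    by (simp add: D_def madj_sum madj_mult matrix_mul_assoc)
  have dual': "mtrace (madj x ** P Y) = mtrace (madj (D x) ** Y)" for x Y
    by (metis Dadj dual mtrace_commute)
  have ks1: "Re (mtrace (\<rho> ** (D x ** madj (D x)))) \<le> Re (mtrace (\<rho> ** D (x ** madj x)))"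
    unfolding D_def by (rule kadison_schwarz[OF one psd(1)])
  have ks2: "Re (mtrace (\<sigma> ** (madj (D x) ** D x))) \<le> Re (mtrace (\<sigma> ** D (madj x ** x)))"
    using kadison_schwarz[OF one psd(2), of "madj x"] unfolding D_def[symmetric] by (simp add: Dadj)
  have a1: "0 \<le> Re (mtrace (\<alpha> ** (x ** madj x)))" by (rule psd_mtrace_nonneg[OF psd(3)])
  have a2: "0 \<le> Re (mtrace (\<alpha> ** (madj x ** x)))"
    using psd_mtrace_nonneg[OF psd(3), of "madj x"] by simp
  have "chi_form t ((1 - e) *\<^sub>R P \<rho> + e *\<^sub>R \<alpha>) ((1 - e) *\<^sub>R P \<sigma> + e *\<^sub>R \<alpha>) x =
    (1 - e) * (2 * Re (mtrace (madj (D x) ** (\<rho> - \<sigma>)))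
      - Re (mtrace (\<rho> ** D (x ** madj x))) - t * Re (mtrace (\<sigma> ** D (madj x ** x))))
    - e * Re (mtrace (\<alpha> ** (x ** madj x))) - t * (e * Re (mtrace (\<alpha> ** (madj x ** x))))"
    unfolding chi_form_def
    by (simp add: mm_add_left mm_diff_left mm_scaleR_left mm_scaleR_right mm_diff_right mm_add_right mtrace_add mtrace_diff
        mtrace_scaleR dual dual' algebra_simps)
  also have "\<dots> \<le> (1 - e) * (2 * Re (mtrace (madj (D x) ** (\<rho> - \<sigma>)))
      - Re (mtrace (\<rho> ** D (x ** madj x))) - t * Re (mtrace (\<sigma> ** D (madj x ** x))))"
    using mult_nonneg_nonneg[OF eps(1) a1] mult_nonneg_nonneg[OF less_imp_le[OF t] mult_nonneg_nonneg[OF eps(1) a2]]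
    by linarith
  also have "\<dots> \<le> (1 - e) * chi_form t \<rho> \<sigma> (D x)"
    unfolding chi_form_def using eps ks1 mult_left_mono[OF ks2 less_imp_le[OF t]]
    by (intro mult_left_mono) auto
  finally show ?thesis by (simp add: D_def)
qed

text \<open>Partial fractions in \<open>t\<close> give the antiderivative \<open>?F\<close>. The
  summand \<open>q - p\<close> belongs to a nonnegative integrand, whose integrability comes with
  the fundamental theorem; it cancels after summation over normalised states.\<close>

lemma entropy_integral_scalar:
  assumes q: "q > 0" and p: "p \<ge> (0::real)"
  shows "((\<lambda>t. t / (1 + t)\<^sup>2 * ((p - q)\<^sup>2 / (p + t * q))) has_integral
     (p * (if p > 0 then ln p else 0) - p * ln q + q - p)) {0<..}"
proof -
  let ?f = "\<lambda>t. t / (1 + t)\<^sup>2 * ((p - q)\<^sup>2 / (p + t * q))"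
  let ?F = "\<lambda>t. p * (ln (1 + t) - ln (p + t * q)) - (q - p) / (1 + t)"
  have pos: "p + t * q > 0" if "t > 0" for t
    using p mult_pos_pos[OF that q] by linarith
  \<comment> \<open>For \<open>p = 0\<close> the boundary term with \<open>ln p\<close> is zero, in
    accordance with the value that \<open>mlog\<close> assigns to a zero eigenvalue.\<close>
  have A: "((?F \<circ> real_of_ereal) \<longlongrightarrow> - (p * (if p > 0 then ln p else 0)) - (q - p)) (at_right 0)"
  proof -
    have "(?F \<longlongrightarrow> - (p * (if p > 0 then ln p else 0)) - (q - p)) (at_right 0)"
    proof (cases "p = 0")
      case True
      have "((\<lambda>t. - q / (1 + t)) \<longlongrightarrow> - q / (1 + 0)) (at_right (0::real))"
        by (intro tendsto_intros) auto
      with True show ?thesis by simp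
    next
      case False
      with p have "p > 0" by simp
      then have "(?F \<longlongrightarrow> p * (ln (1 + 0) - ln (p + 0 * q)) - (q - p) / (1 + 0)) (at_right 0)"
        by (intro tendsto_intros) auto
      with \<open>p > 0\<close> show ?thesis by simp
    qed
    then show ?thesis
      by (simp only: zero_ereal_def ereal_tendsto_simps1)
  qed
  have B: "((?F \<circ> real_of_ereal) \<longlongrightarrow> - (p * ln q)) (at_left \<infinity>)"
  proof -
    have "(?F \<longlongrightarrow> - (p * ln q)) at_top"
    proof -
      have inv: "((\<lambda>t::real. c / (1 + t)) \<longlongrightarrow> 0) at_top" for c
        by (intro tendsto_divide_0[OF tendsto_const] filterlim_at_top_imp_at_infinity
            filterlim_tendsto_add_at_top[OF tendsto_const] filterlim_ident)
      have "((\<lambda>t. q + (p - q) / (1 + t)) \<longlongrightarrow> q + 0) at_top"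
        by (intro tendsto_add tendsto_const inv)
      moreover have "\<forall>\<^sub>F t in at_top. q + (p - q) / (1 + t) = (p + t * q) / (1 + t)"
        using eventually_gt_at_top[of 0] by eventually_elim (simp add: field_simps)
      ultimately have 1: "((\<lambda>t. (p + t * q) / (1 + t)) \<longlongrightarrow> q + 0) at_top"
        by (rule Lim_transform_eventually)
      then have "((\<lambda>t. ln ((p + t * q) / (1 + t))) \<longlongrightarrow> ln q) at_top"
        using tendsto_ln[OF 1] q by simp
      moreover have "((\<lambda>t. (q - p) / (1 + t)) \<longlongrightarrow> 0) at_top" by (rule inv)
      ultimately have "((\<lambda>t. p * (- ln ((p + t * q) / (1 + t))) - (q - p) / (1 + t)) \<longlongrightarrow> p * (- ln q) - 0) at_top"
        by (intro tendsto_diff tendsto_mult tendsto_const tendsto_minus)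
      moreover have "\<forall>\<^sub>F t in at_top. p * (- ln ((p + t * q) / (1 + t))) - (q - p) / (1 + t) = ?F t"
        using eventually_gt_at_top[of 0] by eventually_elim (use pos in \<open>simp add: ln_div less_imp_neq[symmetric]\<close>)
      ultimately have "(?F \<longlongrightarrow> p * (- ln q) - 0) at_top"
        by (rule Lim_transform_eventually)
      then show ?thesis by simp
    qed
    then show ?thesis by (simp only: ereal_tendsto_simps1)
  qed
  have D: "DERIV ?F t :> ?f t" if "t > 0" for t
  proof -
    have "DERIV ?F t :> p * (1 / (1 + t) - q / (p + t * q)) + (q - p) / (1 + t)\<^sup>2"
      using that pos[OF that]
      by (auto intro!: derivative_eq_intros simp: power2_eq_square diff_divide_distrib)
    also have "p * (1 / (1 + t) - q / (p + t * q)) + (q - p) / (1 + t)\<^sup>2 = ?f t"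
      using that pos[OF that]
      by (simp add: divide_simps less_imp_neq[symmetric]) (simp add: algebra_simps power2_eq_square)
    finally show ?thesis .
  qed
  have cont: "isCont ?f t" if "t > 0" for t
    using pos[OF that] that by (intro continuous_intros) auto
  have nonneg: "?f t \<ge> 0" if "t > 0" for t
    using pos[OF that] that by simp
  have e: "einterval 0 \<infinity> = {0::real<..}" by (auto simp: einterval_def)
  have I: "set_integrable lborel (einterval 0 \<infinity>) ?f"
    "(LBINT x=0..\<infinity>. ?f x) = - (p * ln q) - (- (p * (if p > 0 then ln p else 0)) - (q - p))"
    using D cont nonneg
    by (intro interval_integral_FTC_nonneg[OF _ _ _ _ A B]; auto)+
  have "?f integrable_on {0<..}" "integral {0<..} ?f = (LBINT x=0..\<infinity>. ?f x)"
    using set_borel_integral_eq_integral[OF I(1)]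
    by (simp_all add: e interval_lebesgue_integral_def)
  moreover have "- (p * ln q) - (- (p * (if p > 0 then ln p else 0)) - (q - p)) =
      p * (if p > 0 then ln p else 0) - p * ln q + q - p"
    by linarith
  ultimately show ?thesis
    using I(2) by (metis (lifting) has_integral_integral)
qed

section \<open>Integral representation and contraction of the relative entropy\<close>

definition supp_le :: "'n::finite cmat \<Rightarrow> 'n cmat \<Rightarrow> bool" where
  "supp_le \<rho> \<sigma> \<longleftrightarrow> (\<forall>v. \<sigma> *v v = 0 \<longrightarrow> \<rho> *v v = 0)"

theorem rel_entropy_integral:
  assumes r: "density \<rho>" and s: "density \<sigma>" and supp: "supp_le \<rho> \<sigma>"
  shows "((\<lambda>t. t / (1 + t)\<^sup>2 * chi_div t \<rho> \<sigma>) has_integral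
     Re (mtrace (\<rho> ** mlog \<rho> - \<rho> ** mlog \<sigma>))) {0<..}"
proof -
  define l where "l x = (if x > 0 then ln x else 0 :: real)" for x
  obtain U p where U: "unitary_mat U" and r': "\<rho> = U ** diag_mat p ** madj U" and p: "\<And>i. p i \<ge> 0"
    and lr: "mlog \<rho> = U ** diag_mat (\<lambda>i. l (p i)) ** madj U"
    using psd_spectral[of \<rho>] r unfolding density_def l_def by metis
  obtain V q where V: "unitary_mat V" and s': "\<sigma> = V ** diag_mat q ** madj V" and q: "\<And>i. q i \<ge> 0"
    and ls: "mlog \<sigma> = V ** diag_mat (\<lambda>i. l (q i)) ** madj V"
    using psd_spectral[of \<sigma>] s unfolding density_def l_def by metis
  define W where "W = madj U ** V"
  define w where "w i j = (cmod (W $ i $ j))\<^sup>2" for i j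
  have uW: "unitary_mat W" unfolding W_def by (rule unitary_mult[OF U V])
  have sp: "(\<Sum>i\<in>UNIV. p i) = 1"
  proof -
    have "complex_of_real (\<Sum>i\<in>UNIV. p i) = 1"
      using r mtrace_spectral[OF U, of p] unfolding density_def r'[symmetric] by simp
    then show ?thesis by (simp only: of_real_eq_1_iff)
  qed
  have sq: "(\<Sum>i\<in>UNIV. q i) = 1"
  proof -
    have "complex_of_real (\<Sum>i\<in>UNIV. q i) = 1"
      using s mtrace_spectral[OF V, of q] unfolding density_def s'[symmetric] by simp
    then show ?thesis by (simp only: of_real_eq_1_iff)
  qed
  have zero: "p i = 0 \<or> w i j = 0" if "q j = 0" for i j
  proof -
    have "\<sigma> *v column j V = 0"
    proof -
      have "\<sigma> ** V = V ** diag_mat q"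
        using V by (simp add: s' mm_assoc unitary_mat_def)
      then have "\<sigma> *v column j V = column j (V ** diag_mat q)"
        by (simp add: vec_eq_iff column_def mm_nth matrix_vector_mult_def flip: \<open>\<sigma> ** V = _\<close>)
      then show ?thesis using that by (simp add: column_def diag_mult_right_nth vec_eq_iff)
    qed
    then have "\<rho> *v column j V = 0" using supp by (simp add: supp_le_def)
    then have "madj U *v (\<rho> *v column j V) = 0" by (simp add: linear_0[OF mv_linear])
    moreover have "madj U *v (\<rho> *v column j V) = column j (diag_mat p ** W)"
    proof -
      have "madj U ** \<rho> ** V = diag_mat p ** W"
        using U by (simp add: r' W_def unitary_mat_def matrix_mul_assoc)
      moreover have "madj U *v (\<rho> *v column j V) = column j (madj U ** \<rho> ** V)"
        by (simp add: matrix_vector_mul_assoc) (simp add: vec_eq_iff column_def mm_nth matrix_vector_mult_def)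
      ultimately show ?thesis by simp
    qed
    ultimately have "(diag_mat p ** W) $ i $ j = 0" by (simp add: column_def vec_eq_iff)
    then show ?thesis by (simp add: diag_mult_left_nth w_def)
  qed
  have "Re (mtrace (\<rho> ** mlog \<rho> - \<rho> ** mlog \<sigma>)) =
     (\<Sum>i\<in>UNIV. p i * l (p i)) - (\<Sum>i\<in>UNIV. \<Sum>j\<in>UNIV. w i j * (p i * l (q j)))"
  proof -
    have "\<rho> ** mlog \<rho> = U ** diag_mat (\<lambda>i. p i * l (p i)) ** madj U"
    proof -
      have "\<rho> ** mlog \<rho> = U ** diag_mat p ** (madj U ** U) ** diag_mat (\<lambda>i. l (p i)) ** madj U"
        by (subst lr, subst r') (simp add: matrix_mul_assoc)
      also have "\<dots> = U ** (diag_mat p ** diag_mat (\<lambda>i. l (p i))) ** madj U"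
        using U by (simp add: unitary_mat_def matrix_mul_assoc)
      also have "diag_mat p ** diag_mat (\<lambda>i. l (p i)) = diag_mat (\<lambda>i. p i * l (p i))"
        by (rule matrix_eqI) (simp only: diag_mult_left_nth, simp add: diag_mat_def)
      finally show ?thesis .
    qed
    moreover have "mtrace (\<rho> ** mlog \<sigma>) = of_real (\<Sum>i\<in>UNIV. \<Sum>j\<in>UNIV. w i j * (p i * l (q j)))"
      unfolding ls r' w_def W_def by (rule mtrace_diag_diag)
    ultimately show ?thesis
      by (simp only: mtrace_diff mtrace_spectral[OF U] minus_complex.simps Re_complex_of_real)
  qed
  also have "(\<Sum>i\<in>UNIV. p i * l (p i)) = (\<Sum>i\<in>UNIV. \<Sum>j\<in>UNIV. w i j * (p i * l (p i)))"
    using unitary_row_sum[OF uW] by (simp add: w_def flip: sum_distrib_right)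
  \<comment> \<open>Rows and columns of the weights sum to one and both traces are one, so
    \<open>q j - p i\<close> has weighted sum zero and may be inserted.\<close>
  also have "\<dots> - (\<Sum>i\<in>UNIV. \<Sum>j\<in>UNIV. w i j * (p i * l (q j))) =
     (\<Sum>i\<in>UNIV. \<Sum>j\<in>UNIV. w i j * (p i * l (p i) - p i * l (q j) + q j - p i))"
  proof -
    have "(\<Sum>i\<in>UNIV. \<Sum>j\<in>UNIV. w i j * p i) = 1"
      using unitary_row_sum[OF uW] sp by (simp add: w_def flip: sum_distrib_right)
    moreover have "(\<Sum>i\<in>UNIV. \<Sum>j\<in>UNIV. w i j * q j) = 1"
      using unitary_col_sum[OF uW] sq by (subst sum.swap) (simp add: w_def flip: sum_distrib_right)
    ultimately show ?thesis
      by (simp add: algebra_simps sum.distrib sum_subtractf)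
  qed
  finally have val: "Re (mtrace (\<rho> ** mlog \<rho> - \<rho> ** mlog \<sigma>)) =
     (\<Sum>i\<in>UNIV. \<Sum>j\<in>UNIV. w i j * (p i * l (p i) - p i * l (q j) + q j - p i))" .
  have itm: "((\<lambda>t. w i j * (t / (1 + t)\<^sup>2 * ((p i - q j)\<^sup>2 / (p i + t * q j)))) has_integral
      w i j * (p i * l (p i) - p i * l (q j) + q j - p i)) {0<..}" for i j
  proof (cases "q j = 0")
    case True
    from zero[OF this, of i] True show ?thesis by auto
  next
    case False
    then have "q j > 0" using q[of j] by simp
    from entropy_integral_scalar[OF this p, of i] \<open>q j > 0\<close> show ?thesis
      by (intro has_integral_mult_right) (simp add: l_def)
  qed
  have "((\<lambda>t. \<Sum>i\<in>UNIV. \<Sum>j\<in>UNIV. w i j * (t / (1 + t)\<^sup>2 * ((p i - q j)\<^sup>2 / (p i + t * q j)))) has_integral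
     Re (mtrace (\<rho> ** mlog \<rho> - \<rho> ** mlog \<sigma>))) {0<..}"
    unfolding val by (intro has_integral_sum itm) auto
  moreover have "(\<Sum>i\<in>UNIV. \<Sum>j\<in>UNIV. w i j * (t / (1 + t)\<^sup>2 * ((p i - q j)\<^sup>2 / (p i + t * q j)))) =
      t / (1 + t)\<^sup>2 * chi_div t \<rho> \<sigma>" if "t \<in> {0<..}" for t
    using that chi_div_spectral(3)[OF U V r' s' p q, of t]
    by (simp add: w_def W_def sum_distrib_left mult_ac)
  ultimately show ?thesis
    by (rule has_integral_eq[rotated])
qed

lemma rel_entropy_eq:
  "rel_entropy \<rho> \<sigma> = (if supp_le \<rho> \<sigma> then ereal (Re (mtrace (\<rho> ** mlog \<rho> - \<rho> ** mlog \<sigma>))) else \<infinity>)"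
  by (simp add: rel_entropy_def supp_le_def)

lemma psd_iff: "psd A \<longleftrightarrow> hermitian A \<and> (\<forall>v. 0 \<le> v \<bullet> (A *v v))"
proof
  assume "psd A"
  then show "hermitian A \<and> (\<forall>v. 0 \<le> v \<bullet> (A *v v))"
    by (simp add: psd_hermitian) (simp add: psd_def cinner_inner)
next
  assume h: "hermitian A \<and> (\<forall>v. 0 \<le> v \<bullet> (A *v v))"
  have "cnj (cinner v (A *v v)) = cinner v (A *v v)" for v
    using h cinner_adj[of v A v] cinner_cnj[of v "A *v v"] by (simp add: hermitian_def)
  then have "Im (cinner v (A *v v)) = 0" for v by (simp add: complex_eq_iff)
  with h show "psd A" by (simp add: psd_def cinner_inner)
qed

lemma mv_add_left: "(A + B) *v v = A *v v + B *v (v :: complex ^ 'n)"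
  by (simp add: vec_eq_iff matrix_vector_mult_def algebra_simps sum.distrib)

lemma mv_diff_left: "(A - B) *v v = A *v v - B *v (v :: complex ^ 'n)"
  by (simp add: vec_eq_iff matrix_vector_mult_def algebra_simps sum_subtractf)

lemma mv_scaleR_left: "(r *\<^sub>R A) *v v = r *\<^sub>R (A *v (v :: complex ^ 'n))"
  by (simp add: vec_eq_iff matrix_vector_mult_def scaleR_sum_right)

lemma psd_add: "psd A \<Longrightarrow> psd B \<Longrightarrow> psd (A + B)"
  by (simp add: psd_iff hermitian_def madj_add mv_add_left inner_add_right)

lemma psd_scaleR: "psd A \<Longrightarrow> 0 \<le> r \<Longrightarrow> psd (r *\<^sub>R A)"
  by (simp add: psd_iff hermitian_def madj_scaleR mv_scaleR_left)

lemma bounded_bilinear_quad: "bounded_bilinear (\<lambda>v w. v \<bullet> ((A :: 'n::finite cmat) *v w))"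
proof -
  have "bounded_linear ((*v) A)" using mv_linear[of A] by (simp add: linear_conv_bounded_linear)
  then show ?thesis
    by (rule bounded_bilinear.comp[OF bounded_bilinear_inner bounded_linear_ident])
qed

lemma psd_quad_sym: "psd A \<Longrightarrow> v \<bullet> (A *v w) = w \<bullet> (A *v v)"
proof -
  assume "psd A"
  then have "madj A = A" using psd_hermitian hermitian_def by blast
  then have "Re (cinner v (A *v w)) = Re (cinner (A *v v) w)" by (simp only: cinner_adj)
  then show ?thesis by (simp only: cinner_inner inner_commute)
qed

lemma psd_quad_eq_0:
  assumes "psd A" "v \<bullet> (A *v v) = 0"
  shows "A *v v = 0"
proof -
  have "v \<bullet> (A *v w) = 0" for w
  proof (rule psd_form_kernel[OF bounded_bilinear_quad psd_quad_sym[OF assms(1)] _ assms(2)])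
    show "0 \<le> x \<bullet> (A *v x)" for x using assms(1) by (simp add: psd_iff)
  qed
  then have "(A *v v) \<bullet> (A *v v) = 0"
    using psd_quad_sym[OF assms(1), of v "A *v v"] by simp
  then show ?thesis by simp
qed

text \<open>Turns an inclusion of kernels into an operator inequality, which positive maps preserve.
  Together with \<open>dominates_supp_le\<close> it carries the support condition from inputs to
  outputs.\<close>

lemma supp_le_dominates:
  assumes r: "psd \<rho>" and s: "psd \<sigma>" and supp: "supp_le \<rho> \<sigma>"
  obtains C where "C \<ge> 1" "psd (C *\<^sub>R \<sigma> - \<rho>)"
proof -
  obtain C where C: "C > 0" "\<And>v. v \<bullet> (\<rho> *v v) \<le> C * (v \<bullet> (\<sigma> *v v))"
  proof (rule psd_form_dominates[OF bounded_bilinear_quad psd_quad_sym[OF s] _ bounded_bilinear_quad psd_quad_sym[OF r]])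
    show "0 \<le> v \<bullet> (\<sigma> *v v)" "0 \<le> v \<bullet> (\<rho> *v v)" for v
      using r s by (simp_all add: psd_iff)
    show "v \<bullet> (\<rho> *v v) = 0" if "v \<bullet> (\<sigma> *v v) = 0" for v
      using psd_quad_eq_0[OF s that] supp by (simp add: supp_le_def)
  qed (use that in blast)
  define C' where "C' = max 1 C"
  have "v \<bullet> (\<rho> *v v) \<le> C' * (v \<bullet> (\<sigma> *v v))" for v
  proof -
    have "C * (v \<bullet> (\<sigma> *v v)) \<le> C' * (v \<bullet> (\<sigma> *v v))"
      using s by (intro mult_right_mono) (auto simp: C'_def psd_iff)
    with C(2)[of v] show ?thesis by linarith
  qed
  then have "psd (C' *\<^sub>R \<sigma> - \<rho>)"
    using r s by (simp add: psd_iff hermitian_def madj_diff madj_scaleR mv_diff_left mv_scaleR_left inner_diff_right)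
  then show thesis by (intro that[of C']) (simp_all add: C'_def)
qed

lemma dominates_supp_le:
  assumes r: "psd \<rho>" and d: "psd (C *\<^sub>R \<sigma> - \<rho>)"
  shows "supp_le \<rho> \<sigma>"
  unfolding supp_le_def
proof safe
  fix v assume "\<sigma> *v v = 0"
  moreover have "0 \<le> v \<bullet> ((C *\<^sub>R \<sigma> - \<rho>) *v v)" using d by (simp add: psd_iff)
  ultimately have "v \<bullet> (\<rho> *v v) \<le> 0" by (simp add: mv_diff_left mv_scaleR_left)
  moreover have "0 \<le> v \<bullet> (\<rho> *v v)" using r by (simp add: psd_iff)
  ultimately show "\<rho> *v v = 0" by (intro psd_quad_eq_0[OF r]) simp
qed

text \<open>The integrands are compared for each \<open>t\<close> at an \<open>x\<close> optimal for
  the outputs. The case \<open>e = 0\<close> is data processing; for \<open>e > 0\<close> the common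
  state supplies the factor \<open>1 - e\<close>.\<close>

theorem rel_entropy_contract:
  fixes P :: "'n::finite cmat \<Rightarrow> 'n cmat"
  assumes lin: "superop_linear P" and pos: "choi_psd P" and tp: "\<And>X. mtrace (P X) = mtrace X"
    and r: "density \<rho>" and s: "density \<sigma>" and a: "density \<alpha>" and e: "0 \<le> e" "e < 1"
  shows "rel_entropy ((1 - e) *\<^sub>R P \<rho> + e *\<^sub>R \<alpha>) ((1 - e) *\<^sub>R P \<sigma> + e *\<^sub>R \<alpha>)
    \<le> ereal (1 - e) * rel_entropy \<rho> \<sigma>"
proof (cases "supp_le \<rho> \<sigma>")
  case False
  \<comment> \<open>The right-hand side is infinite, as \<open>1 - e\<close> is positive.\<close>
  then show ?thesis using e by (simp add: rel_entropy_eq[of \<rho>])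
next
  case True
  let ?r = "(1 - e) *\<^sub>R P \<rho> + e *\<^sub>R \<alpha>" and ?s = "(1 - e) *\<^sub>R P \<sigma> + e *\<^sub>R \<alpha>"
  have psd: "psd \<rho>" "psd \<sigma>" "psd \<alpha>" using r s a by (simp_all add: density_def)
  obtain A :: "'n \<times> 'n \<Rightarrow> 'n cmat" where A: "\<And>Y. P Y = (\<Sum>c\<in>UNIV. A c ** Y ** madj (A c))"
    using choi_psd_kraus[OF lin pos] by blast
  \<comment> \<open>Trace preservation is unitality of the dual map.\<close>
  have one: "(\<Sum>c\<in>UNIV. madj (A c) ** A c) = mat 1"
  proof -
    let ?D = "(\<Sum>c\<in>UNIV. madj (A c) ** A c) - mat 1"
    have "mtrace (?D ** X) = 0" for X
    proof -
      have "mtrace (A c ** X ** madj (A c)) = mtrace (madj (A c) ** A c ** X)" for c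
        using mtrace_commute[of "A c ** X" "madj (A c)"] by (simp add: matrix_mul_assoc)
      then show ?thesis
        using tp[of X] by (simp add: A mm_diff_left mm_sum_left mtrace_diff mtrace_sum)
    qed
    then have "hs (madj ?D) (madj ?D) = 0" by (simp add: hs_eq_mtrace)
    then have "madj ?D = 0" by (rule hs_eq_0)
    then have "?D = 0" by (metis madj_madj madj_zero)
    then show ?thesis by simp
  qed
  have pp: "psd (P \<rho>)" "psd (P \<sigma>)" using choi_psd_psd[OF lin pos] psd by auto
  have psd': "psd ?r" "psd ?s" using pp psd e by (auto intro!: psd_add psd_scaleR)
  have dens: "density ?r" "density ?s"
    using psd' r s a by (simp_all add: density_def mtrace_add mtrace_scaleR mtrace_diff tp scaleR_left_diff_distrib)
  obtain C where C: "C \<ge> 1" "psd (C *\<^sub>R \<sigma> - \<rho>)"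
    using supp_le_dominates[OF psd(1,2) True] .
  have "psd (P (C *\<^sub>R \<sigma> - \<rho>))" by (rule choi_psd_psd[OF lin pos C(2)])
  \<comment> \<open>In \<open>C *\<^sub>R ?s - ?r\<close> the state \<open>\<alpha>\<close> has the
    coefficient \<open>e * (C - 1)\<close>, nonnegative because \<open>C \<ge> 1\<close>.\<close>
  then have "psd ((1 - e) *\<^sub>R P (C *\<^sub>R \<sigma> - \<rho>) + (e * (C - 1)) *\<^sub>R \<alpha>)"
    using psd e C(1) by (intro psd_add psd_scaleR) auto
  also have "(1 - e) *\<^sub>R P (C *\<^sub>R \<sigma> - \<rho>) + (e * (C - 1)) *\<^sub>R \<alpha> = C *\<^sub>R ?s - ?r"
  proof -
    have "P (C *\<^sub>R \<sigma> - \<rho>) = C *\<^sub>R P \<sigma> - P \<rho>"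
      using superop_diff[OF lin, of "C *\<^sub>R \<sigma>" \<rho>] linear_scale[OF superop_linear_imp_linear[OF lin], of C \<sigma>]
      by simp
    then show ?thesis by (simp only:) (simp add: algebra_simps)
  qed
  finally have supp': "supp_le ?r ?s" by (rule dominates_supp_le[OF psd'(1)])
  let ?D = "Re (mtrace (\<rho> ** mlog \<rho> - \<rho> ** mlog \<sigma>))"
  let ?D' = "Re (mtrace (?r ** mlog ?r - ?r ** mlog ?s))"
  have "?D' \<le> (1 - e) * ?D"
  proof (rule has_integral_le[OF rel_entropy_integral[OF dens supp'] has_integral_mult_right[OF rel_entropy_integral[OF r s True]]])
    fix t :: real assume "t \<in> {0<..}"
    then have t: "t > 0" by simp
    obtain x where x: "chi_form t ?r ?s x = chi_div t ?r ?s"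
      using chi_div_psd(2)[OF psd' t] by blast
    have "chi_form t ?r ?s x \<le> (1 - e) * chi_form t \<rho> \<sigma> (\<Sum>c\<in>UNIV. madj (A c) ** x ** A c)"
      unfolding A using e by (intro chi_form_contract[OF one psd _ _ t]) auto
    also have "\<dots> \<le> (1 - e) * chi_div t \<rho> \<sigma>"
      using e by (intro mult_left_mono chi_div_psd(1)[OF psd(1,2) t]) auto
    finally have "t / (1 + t)\<^sup>2 * chi_div t ?r ?s \<le> t / (1 + t)\<^sup>2 * ((1 - e) * chi_div t \<rho> \<sigma>)"
      using t x by (intro mult_left_mono) auto
    then show "t / (1 + t)\<^sup>2 * chi_div t ?r ?s \<le> (1 - e) * (t / (1 + t)\<^sup>2 * chi_div t \<rho> \<sigma>)"
      by (simp add: mult_ac)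
  qed
  then show ?thesis
    by (simp add: rel_entropy_eq True supp')
qed

subsection \<open>Exponentials of linear maps on matrices\<close>

definition gexp :: "('n::finite cmat \<Rightarrow> 'n cmat) \<Rightarrow> real \<Rightarrow> 'n cmat \<Rightarrow> 'n cmat" where
  "gexp L t = superop_exp (\<lambda>X. t *\<^sub>R L X)"

lemma bounded_linear_nth2: "bounded_linear (\<lambda>X :: 'n::finite cmat. X $ i $ j)"
  by (intro linear_conv_bounded_linear[THEN iffD1] linearI) simp_all

lemma bounded_linear_madj: "bounded_linear (madj :: 'n::finite cmat \<Rightarrow> 'n cmat)"
  by (intro linear_conv_bounded_linear[THEN iffD1] linearI) (simp_all add: madj_add madj_scaleR)

lemma bounded_linear_mtrace: "bounded_linear (mtrace :: 'n::finite cmat \<Rightarrow> complex)"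
  by (intro linear_conv_bounded_linear[THEN iffD1] linearI) (simp_all add: mtrace_add mtrace_scaleR)

lemma bounded_linear_cscale_munit: "bounded_linear (\<lambda>c. cscale c (munit i j))"
  by (intro linear_conv_bounded_linear[THEN iffD1] linearI)
    (simp_all add: cscale_add_left scaleR_eq_cscale cscale_cscale scaleR_conv_of_real)

lemma linear_left_mult: "linear (\<lambda>X :: 'n::finite cmat. (P :: 'n cmat) ** X)"
  by (intro linearI) (simp_all add: mm_add_right mm_scaleR_right)

lemma has_vector_derivative_cmat:
  fixes f :: "real \<Rightarrow> 'n::finite cmat"
  assumes "\<And>i j. ((\<lambda>t. f t $ i $ j) has_vector_derivative f' $ i $ j) (at t)"
  shows "(f has_vector_derivative f') (at t)"
proof -
  have "((\<lambda>t. \<Sum>i\<in>UNIV. \<Sum>j\<in>UNIV. cscale (f t $ i $ j) (munit i j)) has_vector_derivative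
      (\<Sum>i\<in>UNIV. \<Sum>j\<in>UNIV. cscale (f' $ i $ j) (munit i j))) (at t)"
    by (intro has_vector_derivative_sum bounded_linear.has_vector_derivative[OF bounded_linear_cscale_munit] assms)
  then show ?thesis by (simp flip: munit_expand)
qed

lemma linear_funpow_bound:
  fixes L :: "'a::euclidean_space \<Rightarrow> 'a"
  assumes "linear L"
  obtains c where "c \<ge> 0" "\<And>k X. norm ((L ^^ k) X) \<le> c ^ k * norm X"
proof -
  from assms have "bounded_linear L" by (simp add: linear_conv_bounded_linear)
  then obtain c where c: "c > 0" "\<And>x. norm (L x) \<le> norm x * c"
    using bounded_linear.pos_bounded by blast
  have "norm ((L ^^ k) X) \<le> c ^ k * norm X" for k X
  proof (induction k)
    case (Suc k)
    have "norm ((L ^^ Suc k) X) \<le> c * norm ((L ^^ k) X)"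
      using c(2)[of "(L ^^ k) X"] by (simp add: mult.commute)
    also have "\<dots> \<le> c * (c ^ k * norm X)" using Suc c(1) by simp
    finally show ?case by (simp add: mult.assoc)
  qed simp
  with c(1) show thesis by (intro that[of c]) auto
qed

lemma gexp_funpow:
  fixes L :: "'a::real_vector \<Rightarrow> 'a"
  assumes "linear L"
  shows "((\<lambda>X. t *\<^sub>R L X) ^^ k) X = t ^ k *\<^sub>R (L ^^ k) X"
  by (induction k) (simp_all add: linear_scale[OF assms])

lemma gexp_sums:
  fixes L :: "'n::finite cmat \<Rightarrow> 'n cmat"
  assumes "linear L"
  shows "(\<lambda>k. (t ^ k / fact k) *\<^sub>R (L ^^ k) X) sums gexp L t X"
proof -
  obtain c where c: "c \<ge> 0" "\<And>k X. norm ((L ^^ k) X) \<le> c ^ k * norm X"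
    using linear_funpow_bound[OF assms] by metis
  have "summable (\<lambda>k. norm X * (inverse (fact k) * (\<bar>t\<bar> * c) ^ k))"
    using summable_exp[of "\<bar>t\<bar> * c"] by (intro summable_mult) simp
  then have "summable (\<lambda>k. (t ^ k / fact k) *\<^sub>R (L ^^ k) X)"
  proof (rule summable_comparison_test'[where N = 0])
    fix k :: nat
    have "norm ((t ^ k / fact k) *\<^sub>R (L ^^ k) X) = \<bar>t\<bar> ^ k / fact k * norm ((L ^^ k) X)"
      by (simp add: power_abs)
    also have "\<dots> \<le> \<bar>t\<bar> ^ k / fact k * (c ^ k * norm X)"
      by (intro mult_left_mono c(2)) simp
    finally show "norm ((t ^ k / fact k) *\<^sub>R (L ^^ k) X) \<le> norm X * (inverse (fact k) * (\<bar>t\<bar> * c) ^ k)"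
      by (simp add: power_mult_distrib field_simps)
  qed
  then have "(\<lambda>k. (t ^ k / fact k) *\<^sub>R (L ^^ k) X) sums (\<Sum>k. (t ^ k / fact k) *\<^sub>R (L ^^ k) X)"
    by (rule summable_sums)
  then show ?thesis
    by (simp add: gexp_def superop_exp_def gexp_funpow[OF assms] divide_inverse mult.commute)
qed

text \<open>An entry of the exponential at complex time. The power series yields the time derivative
  and, being entire, allows analytic continuation.\<close>

definition gser :: "('n::finite cmat \<Rightarrow> 'n cmat) \<Rightarrow> 'n cmat \<Rightarrow> 'n \<Rightarrow> 'n \<Rightarrow> complex \<Rightarrow> complex" where
  "gser L X i j z = (\<Sum>k. ((L ^^ k) X $ i $ j / fact k) * z ^ k)"

lemma gser_summable:
  fixes L :: "'n::finite cmat \<Rightarrow> 'n cmat"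
  assumes "linear L"
  shows "summable (\<lambda>k. ((L ^^ k) X $ i $ j / fact k) * z ^ k)"
proof -
  obtain c where c: "c \<ge> 0" "\<And>k X. norm ((L ^^ k) X) \<le> c ^ k * norm X"
    using linear_funpow_bound[OF assms] by metis
  have "summable (\<lambda>k. norm X * (inverse (fact k) * (cmod z * c) ^ k))"
    using summable_exp[of "cmod z * c"] by (intro summable_mult) simp
  then show ?thesis
  proof (rule summable_comparison_test'[where N = 0])
    fix k :: nat
    have "cmod ((L ^^ k) X $ i $ j) \<le> norm ((L ^^ k) X)"
      by (rule order_trans[OF Finite_Cartesian_Product.norm_nth_le Finite_Cartesian_Product.norm_nth_le])
    also have "\<dots> \<le> c ^ k * norm X" by (rule c(2))
    finally have "cmod ((L ^^ k) X $ i $ j) * (cmod z ^ k / fact k) \<le> c ^ k * norm X * (cmod z ^ k / fact k)"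
      by (intro mult_right_mono) auto
    then show "cmod (((L ^^ k) X $ i $ j / fact k) * z ^ k) \<le> norm X * (inverse (fact k) * (cmod z * c) ^ k)"
      by (simp add: norm_mult norm_divide norm_power power_mult_distrib field_simps)
  qed
qed

lemma gser_deriv:
  fixes L :: "'n::finite cmat \<Rightarrow> 'n cmat"
  assumes "linear L"
  shows "(gser L X i j has_field_derivative gser L (L X) i j z) (at z)"
proof -
  have "((\<lambda>z. \<Sum>k. ((L ^^ k) X $ i $ j / fact k) * z ^ k) has_field_derivative
      (\<Sum>k. diffs (\<lambda>k. (L ^^ k) X $ i $ j / fact k) k * z ^ k)) (at z)"
    by (rule termdiffs_strong_converges_everywhere) (rule gser_summable[OF assms])
  moreover have "diffs (\<lambda>k. (L ^^ k) X $ i $ j / fact k) k = (L ^^ k) (L X) $ i $ j / fact k" for k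
    by (simp add: diffs_def funpow_swap1 field_simps del: of_nat_Suc)
  ultimately show ?thesis unfolding gser_def[abs_def] by simp
qed

lemma gexp_nth:
  fixes L :: "'n::finite cmat \<Rightarrow> 'n cmat"
  assumes "linear L"
  shows "gexp L t X $ i $ j = gser L X i j (of_real t)"
proof -
  have "(\<lambda>k. ((t ^ k / fact k) *\<^sub>R (L ^^ k) X) $ i $ j) sums (gexp L t X $ i $ j)"
    by (rule bounded_linear.sums[OF bounded_linear_nth2 gexp_sums[OF assms]])
  then have "(\<lambda>k. ((L ^^ k) X $ i $ j / fact k) * of_real t ^ k) sums (gexp L t X $ i $ j)"
    by (simp add: scaleR_conv_of_real[where 'a = complex] mult_ac)
  then show ?thesis by (simp add: gser_def sums_iff)
qed

lemma gexp_deriv':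
  fixes L :: "'n::finite cmat \<Rightarrow> 'n cmat"
  assumes "linear L"
  shows "((\<lambda>t. gexp L t X) has_vector_derivative gexp L t (L X)) (at t)"
  by (rule has_vector_derivative_cmat)
    (unfold gexp_nth[OF assms], rule has_vector_derivative_real_field, rule gser_deriv[OF assms])

lemma gexp_commute:
  fixes L :: "'n::finite cmat \<Rightarrow> 'n cmat"
  assumes "linear L"
  shows "gexp L t (L X) = L (gexp L t X)"
proof -
  have "bounded_linear L" using assms by (simp add: linear_conv_bounded_linear)
  from bounded_linear.sums[OF this gexp_sums[OF assms]]
  have "(\<lambda>k. (t ^ k / fact k) *\<^sub>R (L ^^ k) (L X)) sums L (gexp L t X)"
    by (simp add: linear_scale[OF assms] funpow_swap1)
  with gexp_sums[OF assms] show ?thesis by (rule sums_unique2)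
qed

lemma gexp_deriv:
  fixes L :: "'n::finite cmat \<Rightarrow> 'n cmat"
  assumes "linear L"
  shows "((\<lambda>t. gexp L t X) has_vector_derivative L (gexp L t X)) (at t)"
  using gexp_deriv'[OF assms] by (simp add: gexp_commute[OF assms])

lemma gexp_0:
  fixes L :: "'n::finite cmat \<Rightarrow> 'n cmat"
  assumes "linear L"
  shows "gexp L 0 X = X"
  by (rule matrix_eqI) (simp only: gexp_nth[OF assms] gser_def of_real_0 powser_zero, simp)

section \<open>Uniqueness for differential equations, semigroup law and matrix exponential\<close>

lemma ode_zero:
  fixes y y' :: "real \<Rightarrow> 'a::euclidean_space"
  assumes der: "\<And>t. 0 \<le> t \<Longrightarrow> t \<le> T \<Longrightarrow> (y has_vector_derivative y' t) (at t)"
    and bd: "\<And>t. 0 \<le> t \<Longrightarrow> t \<le> T \<Longrightarrow> norm (y' t) \<le> c * norm (y t)"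
    and 0: "y 0 = 0" and t: "0 \<le> t" "t \<le> T"
  shows "y t = 0"
proof -
  \<comment> \<open>Gronwall: the factor outweighs the growth of the squared norm. A bound on the
    derivative is assumed instead of an equation because a projected curve with time-dependent
    coefficients has to be covered as well.\<close>
  define h where "h s = exp (- 2 * c * s) * (y s \<bullet> y s)" for s
  have dh: "DERIV h s :> exp (- 2 * c * s) * (2 * (y s \<bullet> y' s)) - 2 * c * exp (- 2 * c * s) * (y s \<bullet> y s)"
    if "0 \<le> s" "s \<le> T" for s
  proof -
    have "((\<lambda>s. y s \<bullet> y s) has_vector_derivative y s \<bullet> y' s + y' s \<bullet> y s) (at s)"
      by (rule bounded_bilinear.has_vector_derivative[OF bounded_bilinear_inner der[OF that] der[OF that]])
    then have "DERIV (\<lambda>s. y s \<bullet> y s) s :> 2 * (y s \<bullet> y' s)"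
      by (simp add: has_real_derivative_iff_has_vector_derivative inner_commute)
    then show ?thesis
      unfolding h_def by (auto intro!: derivative_eq_intros simp: algebra_simps)
  qed
  have "h t \<le> h 0"
  proof (rule DERIV_nonpos_imp_nonincreasing[OF t(1)])
    fix s assume s: "0 \<le> s" "s \<le> t"
    have "y s \<bullet> y' s \<le> norm (y s) * norm (y' s)" by (rule norm_cauchy_schwarz)
    also have "\<dots> \<le> norm (y s) * (c * norm (y s))"
      using bd[of s] s t by (intro mult_left_mono) auto
    also have "\<dots> = c * (y s \<bullet> y s)" by (simp add: dot_square_norm power2_eq_square)
    finally have "exp (- 2 * c * s) * (2 * (y s \<bullet> y' s)) \<le> exp (- 2 * c * s) * (2 * (c * (y s \<bullet> y s)))"
      by (intro mult_left_mono) auto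
    then have "exp (- 2 * c * s) * (2 * (y s \<bullet> y' s)) - 2 * c * exp (- 2 * c * s) * (y s \<bullet> y s) \<le> 0"
      by (simp add: mult_ac)
    with dh[of s] s t show "\<exists>z. DERIV h s :> z \<and> z \<le> 0" by auto
  qed
  then have "y t \<bullet> y t \<le> 0"
    by (simp add: h_def 0 mult_le_0_iff)
  then show ?thesis by (metis inner_eq_zero_iff inner_ge_zero order_antisym)
qed

lemma linear_ode_unique:
  fixes L :: "'a::euclidean_space \<Rightarrow> 'a"
  assumes L: "linear L" and der: "\<And>t. (y has_vector_derivative L (y t)) (at t)" and 0: "y 0 = 0"
  shows "y t = 0"
proof -
  have "bounded_linear L" using L by (simp add: linear_conv_bounded_linear)
  then obtain c where c: "\<And>x. norm (L x) \<le> norm x * c"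
    using bounded_linear.pos_bounded by blast
  show ?thesis
  proof (cases "t \<ge> 0")
    case True
    show ?thesis
      by (rule ode_zero[of t y "\<lambda>t. L (y t)" c]) (use der c 0 True in \<open>auto simp: mult.commute\<close>)
  next
    case False
    have "((\<lambda>t. y (- t)) has_vector_derivative - L (y (- t))) (at t)" for t
      using vector_diff_chain_at[of uminus "-1" t y "L (y (- t))"] der[of "- t"]
      by (simp add: o_def has_vector_derivative_minus)
    then have "y (- (- t)) = 0"
      by (intro ode_zero[of "- t" "\<lambda>t. y (- t)" "\<lambda>t. - L (y (- t))" c "- t"])
        (use c 0 False in \<open>auto simp: mult.commute\<close>)
    then show ?thesis by simp
  qed
qed

text \<open>Source of the identities for exponentials: the semigroup law, linearity and
  compatibility with adjoints follow by checking the equation and the value at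
  \<open>0\<close>.\<close>

lemma gexp_unique:
  fixes L :: "'n::finite cmat \<Rightarrow> 'n cmat"
  assumes L: "linear L" and der: "\<And>t. (y has_vector_derivative L (y t)) (at t)"
  shows "y t = gexp L t (y 0)"
proof -
  have "y t - gexp L t (y 0) = 0"
    by (rule linear_ode_unique[OF L, of "\<lambda>t. y t - gexp L t (y 0)"])
      (auto simp: gexp_0[OF L] linear_diff[OF L] intro!: has_vector_derivative_diff der gexp_deriv[OF L])
  then show ?thesis by simp
qed

lemma gexp_add:
  fixes L :: "'n::finite cmat \<Rightarrow> 'n cmat"
  assumes L: "linear L"
  shows "gexp L (s + t) X = gexp L s (gexp L t X)"
proof -
  have "((\<lambda>s. gexp L (s + t) X) has_vector_derivative L (gexp L (s + t) X)) (at s)" for s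
  proof -
    have "((\<lambda>s. s + t) has_vector_derivative 1) (at s)"
      by (auto intro!: derivative_eq_intros)
    from vector_diff_chain_at[OF this gexp_deriv[OF L]] show ?thesis by (simp add: o_def)
  qed
  from gexp_unique[OF L this] show ?thesis by simp
qed

lemma gexp_superop_linear:
  assumes "superop_linear L"
  shows "superop_linear (gexp L t)"
proof -
  have L: "linear L" using assms by (rule superop_linear_imp_linear)
  have "gexp L t X + gexp L t Y = gexp L t (X + Y)" for X Y
  proof -
    have "((\<lambda>t. gexp L t X + gexp L t Y) has_vector_derivative L (gexp L t X + gexp L t Y)) (at t)" for t
      unfolding linear_add[OF L] by (intro has_vector_derivative_add gexp_deriv L)
    from gexp_unique[OF L this, of t] show ?thesis by (simp add: gexp_0[OF L])
  qed
  moreover have "cscale c (gexp L t X) = gexp L t (cscale c X)" for c X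
  proof -
    have "bounded_linear (\<lambda>X. cscale c X)"
      by (intro linear_conv_bounded_linear[THEN iffD1] linearI)
        (simp_all add: cscale_add_right scaleR_eq_cscale cscale_cscale mult.commute)
    from bounded_linear.has_vector_derivative[OF this gexp_deriv[OF L]]
    have "((\<lambda>t. cscale c (gexp L t X)) has_vector_derivative L (cscale c (gexp L t X))) (at t)" for t
      by (simp add: superop_cscale[OF assms])
    from gexp_unique[OF L this, of t] show ?thesis by (simp add: gexp_0[OF L])
  qed
  ultimately show ?thesis by (simp add: superop_linear_def)
qed

lemma gexp_mtrace:
  fixes L :: "'n::finite cmat \<Rightarrow> 'n cmat"
  assumes L: "linear L" and "\<And>X. mtrace (L X) = 0"
  shows "mtrace (gexp L t X) = mtrace X"
proof -
  have "((\<lambda>t. mtrace (gexp L t X)) has_vector_derivative 0) (at t)" for t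
    using bounded_linear.has_vector_derivative[OF bounded_linear_mtrace gexp_deriv[OF L]] assms(2) by metis
  then obtain c where "\<And>t. mtrace (gexp L t X) = c"
    using has_vector_derivative_zero_constant[of UNIV "\<lambda>t. mtrace (gexp L t X)"] by auto
  from this[of t] this[of 0] show ?thesis by (simp add: gexp_0[OF L])
qed

lemma gexp_madj:
  fixes L :: "'n::finite cmat \<Rightarrow> 'n cmat"
  assumes L: "linear L" and "\<And>X. L (madj X) = madj (L X)"
  shows "gexp L t (madj X) = madj (gexp L t X)"
proof -
  have "((\<lambda>t. madj (gexp L t X)) has_vector_derivative L (madj (gexp L t X))) (at t)" for t
    unfolding assms(2)
    by (rule bounded_linear.has_vector_derivative[OF bounded_linear_madj gexp_deriv[OF L]])
  from gexp_unique[OF L this, of t] show ?thesis by (simp add: gexp_0[OF L])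
qed

text \<open>The matrix exponential, obtained from left multiplication so that the facts on
  exponentials of superoperators apply.\<close>

definition mexp :: "'n::finite cmat \<Rightarrow> real \<Rightarrow> 'n cmat" where
  "mexp P t = gexp (\<lambda>X. P ** X) t (mat 1)"

lemma mexp_deriv: "(mexp P has_vector_derivative P ** mexp P t) (at t)"
  unfolding mexp_def[abs_def] by (rule gexp_deriv[OF linear_left_mult])

lemma mexp_deriv_mult:
  fixes M :: "'n::finite cmat"
  shows "((\<lambda>t. mexp P t ** M) has_vector_derivative P ** (mexp P t ** M)) (at t)"
  using bounded_linear.has_vector_derivative
    [OF bounded_bilinear.bounded_linear_left[OF bounded_bilinear_mm] mexp_deriv[of P t], of M]
  by (simp add: matrix_mul_assoc)

lemma mexp_0: "mexp P 0 = mat 1"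
  by (simp add: mexp_def gexp_0[OF linear_left_mult])

lemma gexp_left_mult: "gexp (\<lambda>X. P ** X) t M = mexp P t ** M"
  using gexp_unique[OF linear_left_mult mexp_deriv_mult, of P t M] by (simp add: mexp_0)

lemma mexp_add: "mexp P (s + t) = mexp P s ** mexp P t"
  by (metis gexp_add gexp_left_mult linear_left_mult mexp_def)

lemma mexp_minus: "mexp P (- t) ** mexp P t = mat 1" "mexp P t ** mexp P (- t) = mat 1"
  using mexp_add[of P "- t" t] mexp_add[of P t "- t"] by (simp_all add: mexp_0)

lemma mexp_commute: "mexp P t ** P = P ** mexp P t"
  using gexp_commute[OF linear_left_mult, of P t "mat 1"]
  by (simp add: gexp_left_mult)

lemma mexp_deriv_neg: "((\<lambda>t. mexp P (- t)) has_vector_derivative - (mexp P (- t) ** P)) (at t)"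
  using vector_diff_chain_at[of uminus "-1" t "mexp P" "P ** mexp P (- t)"] mexp_deriv[of P "- t"]
  by (simp add: o_def has_vector_derivative_minus mexp_commute)

text \<open>For skew \<open>J\<close> the number \<open>hs X (J ** X)\<close> is imaginary, so the
  squared norm has derivative zero.\<close>

lemma mexp_isometry:
  fixes J M :: "'n::finite cmat"
  assumes "madj J = - J"
  shows "norm (mexp J t ** M) = norm M"
proof -
  let ?y = "\<lambda>t. mexp J t ** M"
  have z: "X \<bullet> (J ** X) = 0" for X :: "'n cmat"
  proof -
    have "hs X (J ** X) = - hs (J ** X) X"
      by (simp add: assms mm_minus_left mm_minus_right hs_eq_mtrace madj_mult mtrace_minus mm_assoc)
    then have "Re (hs X (J ** X)) = - Re (hs (J ** X) X)" by simp
    then show ?thesis by (simp add: hs_inner inner_commute)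
  qed
  have "((\<lambda>t. ?y t \<bullet> ?y t) has_vector_derivative 0) (at t)" for t
    using bounded_bilinear.has_vector_derivative[OF bounded_bilinear_inner mexp_deriv_mult[of J M t] mexp_deriv_mult[of J M t]]
    by (simp add: z inner_commute)
  then obtain c where "\<And>t. ?y t \<bullet> ?y t = c"
    using has_vector_derivative_zero_constant[of UNIV "\<lambda>t. ?y t \<bullet> ?y t"] by auto
  from this[of t] this[of 0] show ?thesis by (simp add: mexp_0 norm_eq)
qed

lemma ch_deriv:
  assumes X: "\<And>i j. ((\<lambda>t. X t (munit i j)) has_vector_derivative X' (munit i j)) (at t)"
    and m: "(m has_vector_derivative m') (at t)" and n: "(n has_vector_derivative n') (at t)"
  shows "((\<lambda>t. ch (X t) (m t) (n t)) has_vector_derivative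
    ch X' (m t) (n t) + ch (X t) m' (n t) + ch (X t) (m t) n') (at t)"
proof -
  have "((\<lambda>t. ch (X t) (m t) (n t)) has_vector_derivative
    (\<Sum>i\<in>UNIV. \<Sum>j\<in>UNIV. ((madj (m t) ** X t (munit i j)) ** n' +
       (madj (m t) ** X' (munit i j) + madj m' ** X t (munit i j)) ** n t) $ i $ j)) (at t)"
    unfolding ch_def
    by (intro has_vector_derivative_sum bounded_linear.has_vector_derivative[OF bounded_linear_nth2]
        bounded_bilinear.has_vector_derivative[OF bounded_bilinear_mm]
        bounded_linear.has_vector_derivative[OF bounded_linear_madj] assms)
  then show ?thesis
    by (simp add: ch_def mm_add_left sum.distrib add_ac)
qed

text \<open>Restriction to the real axis makes analyticity stable under conjugation, by passing from
  \<open>g\<close> to \<open>cnj \<circ> g \<circ> cnj\<close>; the conjugate-linear argument of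
  \<open>ch\<close> demands this.\<close>

definition real_entire :: "(real \<Rightarrow> complex) \<Rightarrow> bool" where
  "real_entire f \<longleftrightarrow> (\<exists>g. g holomorphic_on UNIV \<and> (\<forall>t. f t = g (of_real t)))"

lemma real_entireI:
  "g holomorphic_on UNIV \<Longrightarrow> (\<And>t. f t = g (of_real t)) \<Longrightarrow> real_entire f"
  by (auto simp: real_entire_def)

lemma real_entire_mult:
  assumes "real_entire f" "real_entire g"
  shows "real_entire (\<lambda>t. f t * g t)"
proof -
  obtain f' where f: "f' holomorphic_on UNIV" "\<And>t. f t = f' (of_real t)"
    using assms(1) unfolding real_entire_def by metis
  obtain g' where g: "g' holomorphic_on UNIV" "\<And>t. g t = g' (of_real t)"
    using assms(2) unfolding real_entire_def by metis
  show ?thesis by (rule real_entireI[OF holomorphic_on_mult[OF f(1) g(1)]]) (simp add: f g)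
qed

lemma real_entire_add:
  assumes "real_entire f" "real_entire g"
  shows "real_entire (\<lambda>t. f t + g t)"
proof -
  obtain f' where f: "f' holomorphic_on UNIV" "\<And>t. f t = f' (of_real t)"
    using assms(1) unfolding real_entire_def by metis
  obtain g' where g: "g' holomorphic_on UNIV" "\<And>t. g t = g' (of_real t)"
    using assms(2) unfolding real_entire_def by metis
  show ?thesis by (rule real_entireI[OF holomorphic_on_add[OF f(1) g(1)]]) (simp add: f g)
qed

lemma real_entire_const: "real_entire (\<lambda>t. c)"
  by (rule real_entireI[OF holomorphic_on_const]) simp

lemma real_entire_sum: "(\<And>i. i \<in> I \<Longrightarrow> real_entire (f i)) \<Longrightarrow> real_entire (\<lambda>t. \<Sum>i\<in>I. f i t)"
  by (induction I rule: infinite_finite_induct) (simp_all add: real_entire_const real_entire_add)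

lemma real_entire_cnj:
  assumes "real_entire f"
  shows "real_entire (\<lambda>t. cnj (f t))"
proof -
  obtain g where g: "g holomorphic_on UNIV" "\<And>t. f t = g (of_real t)"
    using assms unfolding real_entire_def by metis
  have "cnj \<circ> g \<circ> cnj holomorphic_on UNIV"
    by (rule holomorphic_on_compose_cnj_cnj[OF holomorphic_on_subset[OF g(1)]]) auto
  then show ?thesis by (rule real_entireI) (simp add: g(2))
qed

lemma real_entire_shift:
  assumes "real_entire f"
  shows "real_entire (\<lambda>t. f (t + a))"
proof -
  obtain g where g: "g holomorphic_on UNIV" "\<And>t. f t = g (of_real t)"
    using assms unfolding real_entire_def by metis
  have "(\<lambda>z. z + of_real a) holomorphic_on UNIV"
    by (intro holomorphic_intros)
  then have "g \<circ> (\<lambda>z. z + of_real a) holomorphic_on UNIV"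
    by (rule holomorphic_on_compose[OF _ holomorphic_on_subset[OF g(1)]]) auto
  then show ?thesis by (rule real_entireI) (simp add: g(2))
qed

lemma real_entire_gexp:
  fixes L :: "'n::finite cmat \<Rightarrow> 'n cmat"
  assumes "linear L"
  shows "real_entire (\<lambda>t. gexp L t X $ i $ j)"
proof (rule real_entireI)
  show "gser L X i j holomorphic_on UNIV"
    unfolding holomorphic_on_open[OF open_UNIV] by (intro ballI exI) (rule gser_deriv[OF assms])
qed (rule gexp_nth[OF assms])

lemma real_entire_ch:
  assumes "\<And>i j k l. real_entire (\<lambda>t. X t (munit i j) $ k $ l)"
    and "\<And>k l. real_entire (\<lambda>t. m t $ k $ l)" and "\<And>k l. real_entire (\<lambda>t. n t $ k $ l)"
  shows "real_entire (\<lambda>t. ch (X t) (m t) (n t))"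
  unfolding ch_nth by (intro real_entire_sum real_entire_mult real_entire_cnj assms)

lemma real_entire_zero:
  assumes "real_entire f" "a < b" "\<And>t. a \<le> t \<Longrightarrow> t \<le> b \<Longrightarrow> f t = 0"
  shows "f t = 0"
proof -
  obtain g where g: "g holomorphic_on UNIV" "\<And>t. f t = g (of_real t)"
    using assms(1) unfolding real_entire_def by metis
  have lim: "(of_real a :: complex) islimpt of_real ` {a..b}"
    unfolding islimpt_approachable
  proof safe
    fix e :: real assume e: "e > 0"
    let ?x = "a + min (b - a) (e / 2)"
    have "?x \<in> {a..b}" "?x \<noteq> a" using e assms(2) by (auto simp: min_def)
    moreover have "dist (complex_of_real ?x) (of_real a) < e"
      unfolding dist_of_real using e assms(2) by (simp add: dist_real_def min_def)
    ultimately show "\<exists>x'\<in>complex_of_real ` {a..b}. x' \<noteq> of_real a \<and> dist x' (of_real a) < e"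
      by (metis imageI of_real_eq_iff)
  qed
  have "g (of_real t) = 0"
    by (rule analytic_continuation[OF g(1), of "of_real ` {a..b}" "of_real a"])
      (auto simp: g(2)[symmetric] assms(3) lim)
  then show ?thesis by (simp add: g(2))
qed

subsection \<open>Kernels of the Choi forms of a Lindblad semigroup\<close>

lemma munit_madj: "madj (munit i j) = munit j i"
  by (rule matrix_eqI) (auto simp: munit_nth)

lemma continuous_on_mexp: "continuous_on S (mexp P)"
  using has_vector_derivative_continuous[OF mexp_deriv] by (intro continuous_at_imp_continuous_on) blast

lemma norm_mm_bound:
  obtains b where "b > 0" "\<And>(X :: 'n::finite cmat) (Y :: 'n cmat). norm (X ** Y) \<le> b * norm X * norm Y"
  using bounded_bilinear.pos_bounded[OF bounded_bilinear_mm] by (metis mult.commute mult.assoc)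

lemma mexp_bounded:
  fixes P :: "'n::finite cmat"
  obtains e where "e > 0" "\<And>t. \<bar>t\<bar> \<le> T \<Longrightarrow> norm (mexp P t) \<le> e"
proof -
  have "compact (mexp P ` {-T..T})"
    by (intro compact_continuous_image continuous_on_mexp compact_Icc)
  then have "bounded (mexp P ` {-T..T})" by (rule compact_imp_bounded)
  then obtain e where "e > 0" "\<And>x. x \<in> mexp P ` {-T..T} \<Longrightarrow> norm x \<le> e"
    unfolding bounded_pos by blast
  then show thesis by (intro that[of e]) (auto simp: abs_le_iff)
qed

text \<open>\<open>Q\<close> projects onto the orthogonal complement of \<open>N\<close>. Membership
  in \<open>N\<close> becomes the linear equation \<open>Q x = 0\<close>, to which
  \<open>ode_zero\<close> can be applied.\<close>

lemma subspace_projection: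
  fixes N :: "'a::euclidean_space set"
  assumes "subspace N"
  obtains Q :: "'a \<Rightarrow> 'a" where "bounded_linear Q" "\<And>x. Q x = 0 \<longleftrightarrow> x \<in> N" "\<And>x. x - Q x \<in> N"
proof -
  obtain B where B: "B \<subseteq> N" "pairwise orthogonal B" "\<And>x. x \<in> B \<Longrightarrow> norm x = 1"
    "independent B" "span B = N"
    using orthonormal_basis_subspace[OF assms] by metis
  define P where "P x = (\<Sum>b\<in>B. (x \<bullet> b) *\<^sub>R b)" for x
  have fin: "finite B" using B(4) by (rule independent_imp_finite)
  have linP: "linear P"
    by (intro linearI) (simp_all add: P_def inner_add_left scaleR_add_left sum.distrib scaleR_sum_right)
  have PN: "P x \<in> N" for x
    unfolding P_def using B(1) assms by (intro subspace_sum subspace_scale) auto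
  have PB: "P b = b" if "b \<in> B" for b
  proof -
    have "(b \<bullet> c) *\<^sub>R c = (if c = b then b else 0)" if "c \<in> B" for c
      using that \<open>b \<in> B\<close> B(2) B(3)[of c] by (auto simp: pairwise_def orthogonal_def dot_square_norm)
    then show ?thesis using that fin by (simp add: P_def)
  qed
  have Pid: "P x = x" if "x \<in> N" for x
    using that unfolding B(5)[symmetric]
    using linear_eq_on_span[OF linP linear_ident, of B x] PB by blast
  show thesis
  proof (rule that[of "\<lambda>x. x - P x"])
    show "bounded_linear (\<lambda>x. x - P x)"
      using linP by (intro bounded_linear_sub bounded_linear_ident) (simp add: linear_conv_bounded_linear)
    show "x - P x = 0 \<longleftrightarrow> x \<in> N" for x
      using PN[of x] Pid[of x] by auto
  qed (simp add: PN)
qed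

text \<open>Lindblad form of the generator. The condition \<open>adj_closed\<close> says that the span of the jump
  operators is closed under adjoints; this is all that is needed of detailed balance.\<close>
locale gkls =
  fixes A :: "'c::finite \<Rightarrow> 'n::finite cmat" and K :: "'n cmat"
  assumes tp: "(\<Sum>c\<in>UNIV. madj (A c) ** A c) = K + madj K"
    and adj_closed: "\<And>N. (\<And>c. hs (A c) N = 0) \<Longrightarrow> hs (madj (A d)) N = 0"
begin

definition gen :: "'n cmat \<Rightarrow> 'n cmat" where
  "gen X = (\<Sum>c\<in>UNIV. A c ** X ** madj (A c)) - K ** X - X ** madj K"

definition Phi :: "real \<Rightarrow> 'n cmat \<Rightarrow> 'n cmat" where
  "Phi t = gexp gen t"

lemma gen_superop: "superop_linear gen"
  unfolding superop_linear_def gen_def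
  by (simp add: mm_add_left mm_add_right sum.distrib cscale_mult_left cscale_mult_right cscale_diff_right
      flip: cscale_sum)

lemma gen_linear: "linear gen"
  by (rule superop_linear_imp_linear[OF gen_superop])

lemma Phi_superop: "superop_linear (Phi t)"
  unfolding Phi_def by (rule gexp_superop_linear[OF gen_superop])

lemma Phi_0: "Phi 0 X = X"
  by (simp add: Phi_def gexp_0[OF gen_linear])

lemma Phi_add: "Phi (s + t) X = Phi s (Phi t X)"
  by (simp add: Phi_def gexp_add[OF gen_linear])

lemma Phi_deriv: "((\<lambda>t. Phi t X) has_vector_derivative gen (Phi t X)) (at t)"
  unfolding Phi_def by (rule gexp_deriv[OF gen_linear])

lemma gen_mtrace: "mtrace (gen X) = 0"
proof -
  have "mtrace (A c ** X ** madj (A c)) = mtrace (madj (A c) ** A c ** X)" for c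
    using mtrace_commute[of "A c ** X" "madj (A c)"] by (simp add: matrix_mul_assoc)
  then have "mtrace (\<Sum>c\<in>UNIV. A c ** X ** madj (A c)) = mtrace ((K + madj K) ** X)"
    by (simp add: mtrace_sum mm_sum_left flip: tp)
  then show ?thesis
    by (simp add: gen_def mtrace_diff mm_add_left mtrace_add mtrace_commute[of X])
qed

lemma Phi_mtrace: "mtrace (Phi t X) = mtrace X"
  unfolding Phi_def by (rule gexp_mtrace[OF gen_linear gen_mtrace])

lemma gen_madj: "gen (madj X) = madj (gen X)"
  by (simp add: gen_def madj_diff madj_sum madj_mult matrix_mul_assoc)

lemma Phi_madj: "Phi t (madj X) = madj (Phi t X)"
  unfolding Phi_def by (rule gexp_madj[OF gen_linear gen_madj])

lemma ch_gen:
  "ch (\<lambda>Y. gen (X Y)) M N = (\<Sum>c\<in>UNIV. ch X (madj (A c) ** M) (madj (A c) ** N))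
     - ch X (madj K ** M) N - ch X M (madj K ** N)"
  unfolding gen_def by (simp add: ch_diff ch_sum ch_left ch_right)

lemma ch_Phi_cnj: "cnj (ch (Phi t) M N) = ch (Phi t) N M"
proof -
  have "cnj ((madj M ** Phi t (munit i j) ** N) $ i $ j) = (madj N ** Phi t (munit j i) ** M) $ j $ i" for i j
  proof -
    have "cnj ((madj M ** Phi t (munit i j) ** N) $ i $ j) = madj (madj M ** Phi t (munit i j) ** N) $ j $ i"
      by simp
    also have "\<dots> = (madj N ** Phi t (munit j i) ** M) $ j $ i"
      by (simp add: madj_mult matrix_mul_assoc munit_madj flip: Phi_madj)
    finally show ?thesis .
  qed
  then show ?thesis unfolding ch_def by simp (rule sum.swap)
qed

lemma ch_Phi_real: "Im (ch (Phi t) M M) = 0"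
  using ch_Phi_cnj[of t M M] by (simp add: complex_eq_iff)

abbreviation flow :: "real \<Rightarrow> 'n cmat \<Rightarrow> 'n cmat" where
  "flow t M \<equiv> mexp (madj K) t ** M"

text \<open>Following the flow of \<open>K\<^sup>*\<close> cancels the non-positive part of the generator.\<close>
lemma ch_flow_deriv:
  "((\<lambda>t. ch (Phi t) (flow (t + a) M) (flow (t + a) M)) has_vector_derivative
    (\<Sum>c\<in>UNIV. ch (Phi t) (madj (A c) ** flow (t + a) M) (madj (A c) ** flow (t + a) M))) (at t)"
proof -
  have fl: "((\<lambda>t. flow (t + a) M) has_vector_derivative madj K ** flow (t + a) M) (at t)"
  proof -
    have "((\<lambda>t. t + a) has_vector_derivative 1) (at t)"
      by (auto intro!: derivative_eq_intros)
    from vector_diff_chain_at[OF this mexp_deriv_mult[of "madj K" M "t + a"]]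
    show ?thesis by (simp add: o_def)
  qed
  have "((\<lambda>t. ch (Phi t) (flow (t + a) M) (flow (t + a) M)) has_vector_derivative
    ch (\<lambda>Y. gen (Phi t Y)) (flow (t + a) M) (flow (t + a) M)
    + ch (Phi t) (madj K ** flow (t + a) M) (flow (t + a) M)
    + ch (Phi t) (flow (t + a) M) (madj K ** flow (t + a) M)) (at t)"
    by (rule ch_deriv[OF Phi_deriv fl fl])
  then show ?thesis by (simp add: ch_gen)
qed

lemma Re_ch_flow_deriv:
  "DERIV (\<lambda>t. Re (ch (Phi t) (flow (t + a) M) (flow (t + a) M))) t :>
    (\<Sum>c\<in>UNIV. Re (ch (Phi t) (madj (A c) ** flow (t + a) M) (madj (A c) ** flow (t + a) M)))"
  using bounded_linear.has_vector_derivative[OF bounded_linear_Re ch_flow_deriv[of a M t]]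
  by (simp add: has_real_derivative_iff_has_vector_derivative)

section \<open>Complete positivity of the semigroup\<close>

lemma continuous_on_Phi: "continuous_on S (\<lambda>t. Phi t X)"
  using has_vector_derivative_continuous[OF Phi_deriv] by (intro continuous_at_imp_continuous_on) blast

text \<open>In the application complete positivity is assumed for \<open>S\<close> alone, so with a
  Hamiltonian it has to come from the Lindblad form. This is a minimum principle: if the least value
  \<open>r p\<close> over short times and the unit ball were negative, the derivative along the flow
  ending at the minimiser would be at least \<open>r p * a\<close>, and a start at a nonnegative
  value leaves too little time to descend to \<open>r p\<close>.\<close>

lemma Phi_choi_psd_small:
  obtains T where "T > 0" "\<And>t. 0 \<le> t \<Longrightarrow> t \<le> T \<Longrightarrow> choi_psd (Phi t)"
proof -
  obtain b where b: "b > 0" "\<And>(X :: 'n cmat) (Y :: 'n cmat). norm (X ** Y) \<le> b * norm X * norm Y"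
    using norm_mm_bound by metis
  obtain e where e: "e > 0" "\<And>t. \<bar>t\<bar> \<le> 1 \<Longrightarrow> norm (mexp (madj K) t) \<le> e"
    using mexp_bounded[of 1 "madj K"] by metis
  \<comment> \<open>Bounds the total squared norm of the arguments that the jump operators produce
    along the flow, for times in \<open>[-1, 1]\<close> and the unit ball.\<close>
  define a where "a = (\<Sum>c\<in>UNIV. (b * norm (madj (A c)) * (b * e))\<^sup>2)"
  have a0: "a \<ge> 0" by (simp add: a_def sum_nonneg)
  have abound: "(\<Sum>c\<in>UNIV. (norm (madj (A c) ** flow s M))\<^sup>2) \<le> a" if s: "\<bar>s\<bar> \<le> 1" and M: "norm M \<le> 1" for s M
    unfolding a_def
  proof (rule sum_mono, rule power_mono)
    fix c
    have "norm (flow s M) \<le> b * norm (mexp (madj K) s) * norm M" by (rule b(2))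
    also have "\<dots> \<le> b * e * 1"
      using b(1) e(2)[OF s] M e(1) by (intro mult_mono) auto
    finally have f: "norm (flow s M) \<le> b * e" by simp
    have "norm (madj (A c) ** flow s M) \<le> b * norm (madj (A c)) * norm (flow s M)" by (rule b(2))
    also have "\<dots> \<le> b * norm (madj (A c)) * (b * e)"
      using b(1) f by (intro mult_left_mono) auto
    finally show "norm (madj (A c) ** flow s M) \<le> b * norm (madj (A c)) * (b * e)" .
  qed simp
  \<comment> \<open>\<open>T * a < 1\<close> makes \<open>r p \<ge> r p * a * u\<close> impossible
    for negative \<open>r p\<close>; \<open>T \<le> 1\<close> keeps the flow within the range of the
    bound \<open>a\<close>.\<close>
  define T where "T = min 1 (1 / (a + 1))"
  have T: "T > 0" "T \<le> 1" "T * a < 1"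
  proof -
    show "T > 0" "T \<le> 1" using a0 by (auto simp: T_def)
    have "T * a \<le> 1 / (a + 1) * a" using a0 by (intro mult_right_mono) (auto simp: T_def)
    also have "\<dots> < 1" using a0 by (simp add: field_simps)
    finally show "T * a < 1" .
  qed
  define r where "r p = Re (ch (Phi (fst p)) (snd p) (snd p))" for p
  define D where "D = {0..T} \<times> cball (0 :: 'n cmat) 1"
  have "compact D" "D \<noteq> {}" using T by (auto simp: D_def intro: compact_Times)
  moreover have "continuous_on D r"
  proof -
    have "continuous_on D (\<lambda>p. Phi (fst p) (munit i j))" for i j
      by (rule continuous_on_compose2[OF continuous_on_Phi[of UNIV] continuous_on_fst[OF continuous_on_id]]) auto
    then show ?thesis
      unfolding r_def ch_def
      by (intro continuous_on_Re continuous_on_sum bounded_linear.continuous_on[OF bounded_linear_nth2]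
          bounded_bilinear.continuous_on[OF bounded_bilinear_mm]
          bounded_linear.continuous_on[OF bounded_linear_madj] continuous_on_snd continuous_on_id)
  qed
  ultimately obtain p where p: "p \<in> D" "\<And>q. q \<in> D \<Longrightarrow> r p \<le> r q"
    using continuous_attains_inf[of D r] by blast
  have low: "Re (ch (Phi u) M M) \<ge> r p * (norm M)\<^sup>2" if u: "0 \<le> u" "u \<le> T" for u M
  proof (cases "M = 0")
    case True
    then show ?thesis by (simp add: ch_def mm_zero_right)
  next
    case False
    have "(u, (1 / norm M) *\<^sub>R M) \<in> D" using u False by (simp add: D_def)
    from p(2)[OF this] have "r p \<le> Re (ch (Phi u) M M) / (norm M)\<^sup>2"
      by (simp add: r_def ch_scaleR_left ch_scaleR_right power2_eq_square)
    then show ?thesis using False by (simp add: field_simps)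
  qed
  obtain u M where pu: "p = (u, M)" by (cases p)
  with p(1) have u: "0 \<le> u" "u \<le> T" and M: "norm M \<le> 1" by (auto simp: D_def)
  have "r p \<ge> 0"
  proof (rule ccontr)
    assume neg: "\<not> r p \<ge> 0"
    let ?F = "\<lambda>t. Re (ch (Phi t) (flow (t + (- u)) M) (flow (t + (- u)) M))"
    let ?F' = "\<lambda>t. (\<Sum>c\<in>UNIV. Re (ch (Phi t) (madj (A c) ** flow (t + (- u)) M) (madj (A c) ** flow (t + (- u)) M)))"
    have F0: "?F 0 \<ge> 0"
    proof -
      have "Phi 0 = (\<lambda>Y. Y)" using Phi_0 by auto
      then show ?thesis by (simp add: ch_id)
    qed
    have Fu: "?F u = r p" by (simp add: r_def pu mexp_0)
    have lowF: "?F' t \<ge> r p * a" if "0 \<le> t" "t \<le> u" for t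
    proof -
      have "?F' t \<ge> (\<Sum>c\<in>UNIV. r p * (norm (madj (A c) ** flow (t + (- u)) M))\<^sup>2)"
        using that u by (intro sum_mono low) auto
      also have "(\<Sum>c\<in>UNIV. r p * (norm (madj (A c) ** flow (t + (- u)) M))\<^sup>2) =
          r p * (\<Sum>c\<in>UNIV. (norm (madj (A c) ** flow (t + (- u)) M))\<^sup>2)"
        by (simp add: sum_distrib_left)
      also have "\<dots> \<ge> r p * a"
        using abound[of "t + (- u)" M] that u T M neg by (intro mult_left_mono_neg) auto
      finally show ?thesis .
    qed
    have "?F 0 - r p * a * 0 \<le> ?F u - r p * a * u"
    proof (rule DERIV_nonneg_imp_nondecreasing[OF u(1)])
      fix t assume t: "0 \<le> t" "t \<le> u"
      have "DERIV (\<lambda>t. ?F t - r p * a * t) t :> ?F' t - r p * a"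
        by (intro DERIV_diff Re_ch_flow_deriv DERIV_cmult_Id)
      with lowF[OF t] show "\<exists>y. DERIV (\<lambda>t. ?F t - r p * a * t) t :> y \<and> 0 \<le> y"
        by (intro exI[of _ "?F' t - r p * a"]) auto
    qed
    with F0 Fu have "0 \<le> r p * (1 - a * u)" by (simp add: algebra_simps)
    moreover have "a * u \<le> T * a" using mult_right_mono[OF u(2) a0] by (simp add: mult.commute)
    ultimately show False using T(3) neg by (simp add: zero_le_mult_iff)
  qed
  show thesis
  proof (rule that[OF T(1)])
    fix t assume t: "0 \<le> t" "t \<le> T"
    have "Re (ch (Phi t) M M) \<ge> 0" for M
      using low[OF t, of M] \<open>r p \<ge> 0\<close> by (meson mult_nonneg_nonneg order_trans zero_le_power2)
    then show "choi_psd (Phi t)" by (simp add: choi_psd_def ch_Phi_real)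
  qed
qed

text \<open>Cut \<open>t\<close> into \<open>n\<close> steps no longer than \<open>T\<close>;
  positive Choi forms are closed under composition.\<close>

theorem Phi_choi_psd:
  assumes "t \<ge> 0"
  shows "choi_psd (Phi t)"
proof -
  obtain T where T: "T > 0" "\<And>t. 0 \<le> t \<Longrightarrow> t \<le> T \<Longrightarrow> choi_psd (Phi t)"
    using Phi_choi_psd_small by metis
  obtain n :: nat where n: "t / T < real n" using reals_Archimedean2 by blast
  have n0: "n > 0" using n assms T(1) by (metis divide_nonneg_pos gr0I leD of_nat_0)
  define h where "h = t / real n"
  have h: "0 \<le> h" "h \<le> T" using n n0 assms T(1) by (auto simp: h_def field_simps)
  have "choi_psd (Phi (real k * h))" for k
  proof (induction k)
    case 0
    show ?case by (rule T(2)) (use T(1) in auto)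
  next
    case (Suc k)
    have "Phi (real (Suc k) * h) = (\<lambda>Z. Phi h (Phi (real k * h) Z))"
      by (rule ext) (simp add: distrib_right flip: Phi_add)
    then show ?case using choi_psd_comp[OF Phi_superop T(2)[OF h] Suc] by simp
  qed
  from this[of n] show ?thesis using n0 by (simp add: h_def)
qed

section \<open>Invariance of the kernels under jump operators and drift\<close>

definition ker :: "real \<Rightarrow> 'n cmat set" where
  "ker t = {M. ch (Phi t) M M = 0}"

lemma ker_kraus:
  assumes "t \<ge> 0"
  obtains w :: "'n \<times> 'n \<Rightarrow> 'n cmat" where "ker t = {M. \<forall>c. hs (w c) M = 0}"
proof -
  obtain w :: "'n \<times> 'n \<Rightarrow> 'n cmat" where w: "\<And>Y. Phi t Y = (\<Sum>c\<in>UNIV. w c ** Y ** madj (w c))"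
    using choi_psd_kraus[OF Phi_superop Phi_choi_psd[OF assms]] by blast
  have "Phi t = (\<lambda>Y. \<Sum>c\<in>UNIV. w c ** Y ** madj (w c))" using w by auto
  then have "ch (Phi t) M M = of_real (\<Sum>c\<in>UNIV. (cmod (hs (w c) M))\<^sup>2)" for M
    by (simp add: ch_sum ch_kraus_term)
  then have "ker t = {M. \<forall>c. hs (w c) M = 0}"
    unfolding ker_def by (simp only: of_real_eq_0_iff) (simp add: sum_nonneg_eq_0_iff)
  then show thesis by (rule that)
qed

lemma ker_subspace:
  assumes "t \<ge> 0"
  shows "subspace (ker t)"
proof -
  obtain w :: "'n \<times> 'n \<Rightarrow> 'n cmat" where "ker t = {M. \<forall>c. hs (w c) M = 0}"
    using ker_kraus[OF assms] .
  then show ?thesis by (auto intro!: subspaceI simp: hs_add_right hs_scaleR_right)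
qed

text \<open>Along the flow the Choi form is nondecreasing and nonnegative, so once it vanishes at \<open>\<tau> > 0\<close> it
  vanishes on \<open>[0, \<tau>]\<close>, hence everywhere by analyticity.\<close>
lemma ker_flow_aux:
  assumes tau: "\<tau> > 0" and M: "M \<in> ker \<tau>"
  shows "ch (Phi t) (flow (t + (- \<tau>)) M) (flow (t + (- \<tau>)) M) = 0"
proof -
  let ?f = "\<lambda>t. ch (Phi t) (flow (t + (- \<tau>)) M) (flow (t + (- \<tau>)) M)"
  have m: "real_entire (\<lambda>t. flow (t + (- \<tau>)) M $ k $ l)" for k l
    unfolding gexp_left_mult[symmetric]
    by (rule real_entire_shift[OF real_entire_gexp[OF linear_left_mult]])
  have entire: "real_entire ?f"
    by (intro real_entire_ch m) (unfold Phi_def, rule real_entire_gexp[OF gen_linear])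
  have zero: "?f t = 0" if t: "0 \<le> t" "t \<le> \<tau>" for t
  proof -
  have "Re (?f t) \<le> Re (?f \<tau>)"
  proof (rule DERIV_nonneg_imp_nondecreasing[OF t(2)])
    fix x assume "t \<le> x" "x \<le> \<tau>"
    then have "choi_psd (Phi x)" using t by (intro Phi_choi_psd) auto
    then have "(\<Sum>c\<in>UNIV. Re (ch (Phi x) (madj (A c) ** flow (x + (- \<tau>)) M) (madj (A c) ** flow (x + (- \<tau>)) M))) \<ge> 0"
      by (intro sum_nonneg) (simp add: choi_psd_def)
    then show "\<exists>y. DERIV (\<lambda>t. Re (?f t)) x :> y \<and> 0 \<le> y"
      using Re_ch_flow_deriv by blast
  qed
  also have "\<dots> = 0" using M by (simp add: ker_def mexp_0)
  finally have "Re (?f t) \<le> 0" .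
  moreover have "Re (?f t) \<ge> 0" using Phi_choi_psd[OF t(1)] by (simp add: choi_psd_def)
  ultimately show ?thesis by (simp add: complex_eq_iff ch_Phi_real)
  qed
  from real_entire_zero[of ?f 0 \<tau> t, OF entire tau zero] show ?thesis by simp
qed

lemma ker_flow:
  assumes "\<tau> > 0" "M \<in> ker \<tau>"
  shows "flow (t - \<tau>) M \<in> ker t"
  using ker_flow_aux[OF assms, of t] by (simp add: ker_def)

text \<open>A function that vanishes identically has derivative zero. At \<open>\<tau>\<close> this
  derivative is a sum of nonnegative Choi values at the matrices \<open>madj (A c) ** M\<close>, so
  each of them vanishes.\<close>

lemma ker_A_adj:
  assumes tau: "\<tau> > 0" and M: "M \<in> ker \<tau>"
  shows "madj (A c) ** M \<in> ker \<tau>"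
proof -
  let ?f = "\<lambda>t. ch (Phi t) (flow (t + (- \<tau>)) M) (flow (t + (- \<tau>)) M)"
  have "(?f has_vector_derivative 0) (at \<tau>)"
    using ker_flow_aux[OF assms] by simp
  then have "(\<Sum>c\<in>UNIV. ch (Phi \<tau>) (madj (A c) ** M) (madj (A c) ** M)) = 0"
    using vector_derivative_unique_at[OF ch_flow_deriv[of "- \<tau>" M \<tau>]] by (simp add: mexp_0)
  then have "(\<Sum>c\<in>UNIV. Re (ch (Phi \<tau>) (madj (A c) ** M) (madj (A c) ** M))) = 0"
    by (metis Re_sum zero_complex.simps(1))
  moreover have "Re (ch (Phi \<tau>) X X) \<ge> 0" for X
    using Phi_choi_psd[of \<tau>] tau by (simp add: choi_psd_def)
  ultimately have "Re (ch (Phi \<tau>) (madj (A c) ** M) (madj (A c) ** M)) = 0"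
    by (simp add: sum_nonneg_eq_0_iff)
  then show ?thesis by (simp add: ker_def complex_eq_iff ch_Phi_real)
qed

text \<open>The place where detailed balance acts. For a Kraus operator \<open>w b\<close>,
  cyclicity of the trace turns \<open>ker_A_adj\<close> into orthogonality of all \<open>A c\<close>
  to \<open>M ** madj (w b)\<close>; then \<open>adj_closed\<close> replaces \<open>A c\<close> by
  \<open>madj (A d)\<close>, and cyclicity leads back.\<close>

lemma ker_A:
  assumes tau: "\<tau> > 0" and M: "M \<in> ker \<tau>"
  shows "A d ** M \<in> ker \<tau>"
proof -
  obtain w :: "'n \<times> 'n \<Rightarrow> 'n cmat" where w: "ker \<tau> = {M. \<forall>c. hs (w c) M = 0}"
    using ker_kraus[of \<tau>] tau by auto
  have swap: "hs (w b) (madj X ** M) = hs X (M ** madj (w b))" for X b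
    by (metis hs_eq_mtrace matrix_mul_assoc mtrace_commute)
  have "hs (w b) (A d ** M) = 0" for b
  proof -
    have "hs (A c) (M ** madj (w b)) = 0" for c
      using ker_A_adj[OF assms, of c] unfolding w swap[symmetric] by blast
    then have "hs (madj (A d)) (M ** madj (w b)) = 0" by (rule adj_closed)
    then show ?thesis by (simp flip: swap)
  qed
  then show ?thesis unfolding w by blast
qed

text \<open>By \<open>tp\<close> the operator is the sum of \<open>madj (A c) ** A c\<close>, and
  each factor preserves the kernel.\<close>

lemma ker_drift:
  assumes tau: "\<tau> > 0" and M: "M \<in> ker \<tau>"
  shows "(K + madj K) ** M \<in> ker \<tau>"
proof -
  have "(\<Sum>c\<in>UNIV. madj (A c) ** (A c ** M)) \<in> ker \<tau>"
    using tau by (intro subspace_sum ker_subspace ker_A_adj ker_A M) auto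
  then show ?thesis by (simp add: mm_sum_left mm_assoc flip: tp)
qed

text \<open>The skew part of \<open>K\<close>: thus \<open>madj K\<close> is \<open>- J\<close> plus
  a Hermitian part that preserves the kernels, and \<open>- J\<close> generates isometries.\<close>

definition J :: "'n cmat" where
  "J = (1 / 2) *\<^sub>R (K - madj K)"

lemma J_skew: "madj J = - J"
  by (simp add: J_def madj_scaleR madj_diff flip: scaleR_minus_right)

lemma adj_K_J: "madj K + J = (1 / 2) *\<^sub>R (K + madj K)"
  unfolding J_def by (simp add: algebra_simps flip: scaleR_left_distrib)

text \<open>Both flows move \<open>ker \<tau>\<close> in the same way since their generators differ by
  \<open>(K + K\<^sup>*) / 2\<close>, which preserves every \<open>ker t\<close>.\<close>
theorem ker_unitary_flow:
  assumes tau: "\<tau> > 0" and M: "M \<in> ker \<tau>" and T: "T \<ge> 0"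
  shows "mexp (- J) T ** M \<in> ker (\<tau> + T)"
proof -
  let ?G = "(1 / 2) *\<^sub>R (K + madj K)"
  obtain Q where Q: "bounded_linear Q" "\<And>x. Q x = 0 \<longleftrightarrow> x \<in> ker \<tau>" "\<And>x. x - Q x \<in> ker \<tau>"
    using subspace_projection[OF ker_subspace[of \<tau>]] tau by (metis less_imp_le)
  \<comment> \<open>Interaction picture: \<open>y\<close> is the unitary orbit seen in the frame
    moving with \<open>madj K\<close>, and \<open>C s\<close> is the Hermitian part
    \<open>?G\<close> in that frame. It maps \<open>ker \<tau>\<close> to itself, by
    \<open>ker_flow\<close> forth and back and \<open>ker_drift\<close> at time
    \<open>\<tau> + s\<close>.\<close>
  define C where "C s X = mexp (madj K) (- s) ** (?G ** (mexp (madj K) s ** X))" for s and X :: "'n cmat"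
  define y where "y s = mexp (madj K) (- s) ** (mexp (- J) s ** M)" for s
  have Cker: "C s X \<in> ker \<tau>" if s: "s \<ge> 0" and X: "X \<in> ker \<tau>" for s X
  proof -
    have "mexp (madj K) s ** X \<in> ker (\<tau> + s)" using ker_flow[OF tau X, of "\<tau> + s"] by simp
    then have "?G ** (mexp (madj K) s ** X) \<in> ker (\<tau> + s)"
      unfolding mm_scaleR_left using tau s by (intro subspace_scale ker_subspace ker_drift) auto
    then show ?thesis
      unfolding C_def using ker_flow[of "\<tau> + s" _ \<tau>] tau s by simp
  qed
  have yd: "(y has_vector_derivative - C s (y s)) (at s)" for s
  proof -
    have fy: "mexp (madj K) s ** y s = mexp (- J) s ** M"
      by (simp add: y_def matrix_mul_assoc mexp_minus)
    have "(y has_vector_derivative mexp (madj K) (- s) ** (- J ** (mexp (- J) s ** M)) +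
       - (mexp (madj K) (- s) ** madj K) ** (mexp (- J) s ** M)) (at s)"
      unfolding y_def
      by (rule bounded_bilinear.has_vector_derivative[OF bounded_bilinear_mm mexp_deriv_neg mexp_deriv_mult])
    also have "mexp (madj K) (- s) ** (- J ** (mexp (- J) s ** M)) +
       - (mexp (madj K) (- s) ** madj K) ** (mexp (- J) s ** M) = - C s (y s)"
      unfolding C_def fy adj_K_J[symmetric]
      by (simp add: mm_add_left mm_add_right mm_minus_left mm_minus_right matrix_mul_assoc)
    finally show ?thesis .
  qed
  obtain b where b: "b > 0" "\<And>(X :: 'n cmat) (Y :: 'n cmat). norm (X ** Y) \<le> b * norm X * norm Y"
    using norm_mm_bound by metis
  obtain e where e: "e > 0" "\<And>t. \<bar>t\<bar> \<le> T \<Longrightarrow> norm (mexp (madj K) t) \<le> e"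
    using mexp_bounded[of T "madj K"] by metis
  obtain q where q: "q > 0" "\<And>x. norm (Q x) \<le> norm x * q"
    using bounded_linear.pos_bounded[OF Q(1)] by blast
  define c where "c = b * e * (b * norm ?G * (b * e)) * q"
  have Cbound: "norm (Q (C s X)) \<le> c * norm X" if "0 \<le> s" "s \<le> T" for s X
  proof -
    have es: "norm (mexp (madj K) s) \<le> e" "norm (mexp (madj K) (- s)) \<le> e"
      using that by (auto intro!: e(2))
    have "norm (mexp (madj K) s ** X) \<le> b * norm (mexp (madj K) s) * norm X" by (rule b(2))
    also have "\<dots> \<le> b * e * norm X"
      using es b(1) by (intro mult_right_mono mult_left_mono) auto
    finally have 1: "norm (mexp (madj K) s ** X) \<le> b * e * norm X" .
    have "norm (?G ** (mexp (madj K) s ** X)) \<le> b * norm ?G * norm (mexp (madj K) s ** X)" by (rule b(2))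
    also have "\<dots> \<le> b * norm ?G * (b * e * norm X)"
      using 1 b(1) by (intro mult_left_mono) auto
    finally have 2: "norm (?G ** (mexp (madj K) s ** X)) \<le> b * norm ?G * (b * e * norm X)" .
    have "norm (C s X) \<le> b * norm (mexp (madj K) (- s)) * norm (?G ** (mexp (madj K) s ** X))"
      unfolding C_def by (rule b(2))
    also have "\<dots> \<le> b * e * (b * norm ?G * (b * e * norm X))"
      using 2 es b(1) e(1) by (intro mult_mono) auto
    finally have "norm (C s X) * q \<le> b * e * (b * norm ?G * (b * e * norm X)) * q"
      using q(1) by (intro mult_right_mono) auto
    with q(2)[of "C s X"] show ?thesis by (simp add: c_def mult_ac)
  qed
  have "Q (y T) = 0"
  proof (rule ode_zero[of T "\<lambda>s. Q (y s)" "\<lambda>s. Q (- C s (y s))" c])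
    fix s assume s: "0 \<le> s" "s \<le> T"
    show "((\<lambda>s. Q (y s)) has_vector_derivative Q (- C s (y s))) (at s)"
      by (rule bounded_linear.has_vector_derivative[OF Q(1) yd])
    \<comment> \<open>The component of \<open>y s\<close> in \<open>ker \<tau>\<close> stays there
      under \<open>C s\<close> and is killed by \<open>Q\<close>, so \<open>Q (y s)\<close> obeys a
      closed linear bound.\<close>
    have "C s (y s) = C s (y s - Q (y s)) + C s (Q (y s))"
      unfolding C_def by (simp add: mm_diff_right)
    moreover have "Q (C s (y s - Q (y s))) = 0"
      using Cker[OF s(1) Q(3)] Q(2) by blast
    ultimately have "Q (C s (y s)) = Q (C s (Q (y s)))"
      using Q(1) by (simp add: linear_add linear_conv_bounded_linear)
    then have "norm (Q (- C s (y s))) = norm (Q (C s (Q (y s))))"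
      using Q(1) by (simp add: linear_neg linear_conv_bounded_linear)
    with Cbound[OF s, of "Q (y s)"] show "norm (Q (- C s (y s))) \<le> c * norm (Q (y s))" by simp
  next
    show "Q (y 0) = 0" using M by (simp add: Q(2) y_def mexp_0)
  qed (use T in auto)
  then have "y T \<in> ker \<tau>" by (simp add: Q(2))
  then have "flow T (y T) \<in> ker (\<tau> + T)" using ker_flow[OF tau, of "y T" "\<tau> + T"] by simp
  then show ?thesis by (simp add: y_def matrix_mul_assoc mexp_minus)
qed

end

subsection \<open>Lindblad form of the generator and detailed balance\<close>

text \<open>Channel properties are known for nonnegative times only; the values on the right still
  determine the two-sided derivative at \<open>0\<close>.\<close>

lemma right_derivative_zero:
  fixes f :: "real \<Rightarrow> 'a::real_normed_vector"
  assumes d: "(f has_vector_derivative d) (at 0)" and c: "\<And>t. t \<ge> 0 \<Longrightarrow> f t = f 0"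
  shows "d = 0"
proof -
  have "(f has_vector_derivative 0) (at 0 within {0..})"
  proof (rule has_vector_derivative_transform)
    show "f t = f 0" if "t \<in> {0..}" for t using that by (intro c) simp
    show "((\<lambda>t. f 0) has_vector_derivative 0) (at 0 within {0..})" by (rule has_vector_derivative_const)
  qed simp
  moreover have "at (0::real) within {0..} \<noteq> bot"
    unfolding at_within_Ici_at_right by (rule trivial_limit_at_right_real)
  moreover have "(f has_vector_derivative d) (at 0 within {0..})"
    by (rule has_vector_derivative_at_within[OF d])
  ultimately show ?thesis using vector_derivative_unique_within by blast
qed

lemma right_derivative_nonneg:
  assumes "DERIV f (0::real) :> d" "f 0 = 0" "\<And>t. t \<ge> 0 \<Longrightarrow> f t \<ge> 0"
  shows "d \<ge> (0::real)"
proof (rule ccontr)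
  assume "\<not> d \<ge> 0"
  then obtain e where "e > 0" "\<And>h. h > 0 \<Longrightarrow> h < e \<Longrightarrow> f 0 > f (0 + h)"
    using has_real_derivative_neg_dec_right[OF assms(1)] by (metis UNIV_I not_le)
  from this(2)[of "e / 2"] this(1) assms(2) assms(3)[of "e / 2"] show False by simp
qed

lemma ch_hermitian:
  assumes "\<And>M. Im (ch X M M) = 0"
  shows "cnj (ch X M N) = ch X N M"
proof -
  have 1: "Im (ch X M N) + Im (ch X N M) = 0"
    using assms[of "M + N"] assms[of M] assms[of N] by (simp add: ch_add_left ch_add_right)
  have 2: "Re (ch X M N) - Re (ch X N M) = 0"
    using assms[of "M + cscale \<i> N"] assms[of M] assms[of N]
    by (simp add: ch_add_left ch_add_right ch_cscale_left ch_cscale_right)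
  show ?thesis using 1 2 by (simp add: complex_eq_iff)
qed

text \<open>The operator \<open>K\<close> is chosen so that adding \<open>K X + X K\<^sup>*\<close> to \<open>- S\<close> replaces the Choi form of
  \<open>- S\<close> by its compression to traceless matrices, where it is positive since \<open>exp (- t S)\<close> is
  completely positive and equals the identity at \<open>t = 0\<close>.\<close>
theorem lindbladian_gkls:
  fixes S :: "'n::finite cmat \<Rightarrow> 'n cmat"
  assumes "lindbladian S"
  obtains A :: "'n \<times> 'n \<Rightarrow> 'n cmat" and K where
    "\<And>X. - S X = (\<Sum>c\<in>UNIV. A c ** X ** madj (A c)) - K ** X - X ** madj K"
    "\<And>c. mtrace (A c) = 0"
    "(\<Sum>c\<in>UNIV. madj (A c) ** A c) = K + madj K"
proof -
  have S: "superop_linear S" and chan: "\<And>t. t \<ge> 0 \<Longrightarrow> quantum_channel (superop_exp (\<lambda>X. (- t) *\<^sub>R S X))"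
    using assms by (auto simp: lindbladian_def)
  define Z where "Z X = - S X" for X
  have Z: "superop_linear Z"
    using S by (simp add: superop_linear_def Z_def minus_eq_cscale cscale_cscale cscale_add_right mult.commute)
  have linZ: "linear Z" by (rule superop_linear_imp_linear[OF Z])
  have T: "quantum_channel (gexp Z t)" if "t \<ge> 0" for t
    using chan[OF that] by (simp add: gexp_def Z_def)
  have T0: "gexp Z 0 = (\<lambda>X. X)" by (rule ext) (rule gexp_0[OF linZ])
  define q where "q = ch Z"
  have der: "((\<lambda>t. ch (gexp Z t) M M) has_vector_derivative q M M) (at 0)" for M
  proof -
    have "((\<lambda>t. ch (gexp Z t) M M) has_vector_derivative
        ch (\<lambda>Y. Z (gexp Z 0 Y)) M M + ch (gexp Z 0) 0 M + ch (gexp Z 0) M 0) (at 0)"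
      by (rule ch_deriv[OF gexp_deriv[OF linZ]]) simp_all
    then show ?thesis by (simp add: q_def T0 ch_def mm_zero_right mm_zero_left)
  qed
  have pos: "choi_psd (gexp Z t)" if "t \<ge> 0" for t
    using T[OF that] by (intro cp_choi_psd) (simp add: quantum_channel_def)
  have qreal: "Im (q M M) = 0" for M
  proof (rule right_derivative_zero)
    show "((\<lambda>t. Im (ch (gexp Z t) M M)) has_vector_derivative Im (q M M)) (at 0)"
      by (rule bounded_linear.has_vector_derivative[OF bounded_linear_Im der])
  qed (use pos in \<open>simp add: choi_psd_def\<close>)
  have qpos: "Re (q M M) \<ge> 0" if "mtrace M = 0" for M
  proof (rule right_derivative_nonneg)
    show "DERIV (\<lambda>t. Re (ch (gexp Z t) M M)) 0 :> Re (q M M)"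
      unfolding has_real_derivative_iff_has_vector_derivative
      by (rule bounded_linear.has_vector_derivative[OF bounded_linear_Re der])
    show "Re (ch (gexp Z 0) M M) = 0" by (simp add: T0 ch_id that)
  qed (use pos in \<open>simp add: choi_psd_def\<close>)
  have qcnj: "cnj (q M N) = q N M" for M N
    unfolding q_def by (rule ch_hermitian) (use qreal in \<open>simp add: q_def\<close>)
  define n where "n = complex_of_nat CARD('n)"
  have n0: "n \<noteq> 0" "cnj n = n" by (simp_all add: n_def)
  \<comment> \<open>Represents the functional \<open>q M (mat 1)\<close> by the Hilbert--Schmidt
    product.\<close>
  define Q1 where "Q1 = (\<Sum>i\<in>UNIV. \<Sum>j\<in>UNIV. Z (munit i j) ** munit j i)"
  have Q1: "hs M Q1 = q M (mat 1)" for M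
  proof -
    have "mtrace (B ** munit j i) = B $ i $ j" for B :: "'n cmat" and i j
    proof -
      have "(B ** munit j i) $ k $ k = (if k = i then B $ i $ j else 0)" for k
        using munit_mult_nth[of B j i "mat 1" k k] by (simp add: mat_one_nth)
      then show ?thesis by (simp add: mtrace_def)
    qed
    then show ?thesis
      by (simp add: Q1_def q_def ch_def hs_eq_mtrace mm_sum_right mtrace_sum matrix_mul_assoc)
  qed
  define q11 where "q11 = q (mat 1) (mat 1)"
  have q11: "cnj q11 = q11" by (simp add: q11_def qcnj)
  \<comment> \<open>Expanding \<open>q\<close> at \<open>M - cscale (mtrace M / n) (mat 1)\<close>
    gives two cross terms and a multiple of \<open>q11\<close>; \<open>K\<close> and its adjoint
    each account for one cross term and half of the \<open>q11\<close> term.\<close>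
  define K where "K = cscale (- (1 / n)) Q1 + cscale (q11 / (2 * n * n)) (mat 1)"
  define P where "P X = Z X + K ** X + X ** madj K" for X
  have hsK: "hs M K = - (1 / n) * q M (mat 1) + q11 / (2 * n * n) * cnj (mtrace M)" for M
    using hs_cnj[of "mat 1" M] by (simp add: K_def hs_add_right hs_cscale_right Q1 hs_one_left)
  have hsK': "hs K M = - (1 / n) * q (mat 1) M + q11 / (2 * n * n) * mtrace M" for M
    using arg_cong[OF hsK[of M], of cnj] by (simp add: hs_cnj qcnj q11 n0)
  have chP: "ch P M N = q M N + hs M K * mtrace N + cnj (mtrace M) * hs K N" for M N
  proof -
    have "ch (\<lambda>X. K ** X) M N = hs M K * mtrace N"
      using ch_sandwich[of K "mat 1" M N] by simp
    moreover have "ch (\<lambda>X. X ** madj K) M N = cnj (mtrace M) * hs K N"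
      using ch_sandwich[of "mat 1" "madj K" M N] hs_cnj[of "mat 1" M]
      by (simp add: hs_one_left hs_eq_mtrace[of K])
    ultimately show ?thesis by (simp add: P_def[abs_def] ch_add q_def)
  qed
  have comp: "ch P M M = q (M - cscale (mtrace M / n) (mat 1)) (M - cscale (mtrace M / n) (mat 1))" for M
  proof -
    define c where "c = mtrace M / n"
    have tr: "mtrace M = c * n" using n0 by (simp add: c_def)
    have "q (M - cscale c (mat 1)) (M - cscale c (mat 1)) =
       q M M - c * q M (mat 1) - cnj c * q (mat 1) M + cnj c * c * q11"
      by (simp add: q_def q11_def ch_diff_left ch_diff_right ch_cscale_left ch_cscale_right algebra_simps)
    also have "\<dots> = ch P M M"
      unfolding chP hsK hsK' tr using n0 by (simp add: field_simps)
    finally show ?thesis by (simp add: c_def)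
  qed
  have tr0: "mtrace (M - cscale (mtrace M / n) (mat 1)) = 0" for M :: "'n cmat"
    using n0 by (simp add: mtrace_diff mtrace_cscale mtrace_mat_one n_def)
  have "choi_psd P"
    unfolding choi_psd_def comp using qreal qpos[OF tr0] by blast
  moreover have "superop_linear P"
    using Z by (simp add: superop_linear_def P_def mm_add_left mm_add_right cscale_add_right
        cscale_mult_left cscale_mult_right)
  ultimately obtain A :: "'n \<times> 'n \<Rightarrow> 'n cmat" where A: "\<And>X. P X = (\<Sum>c\<in>UNIV. A c ** X ** madj (A c))"
    using choi_psd_kraus by blast
  have form: "- S X = (\<Sum>c\<in>UNIV. A c ** X ** madj (A c)) - K ** X - X ** madj K" for X
    unfolding A[symmetric] P_def Z_def by simp
  \<comment> \<open>The compression sends \<open>mat 1\<close> to zero, so the form of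
    \<open>P\<close> vanishes there and every Kraus operator is orthogonal to
    \<open>mat 1\<close>.\<close>
  have A0: "mtrace (A c) = 0" for c
  proof -
    have "ch P (mat 1) (mat 1) = 0"
    proof -
      have "(mat 1 :: 'n cmat) - cscale (mtrace (mat 1 :: 'n cmat) / n) (mat 1) = 0"
        using n0 by (simp add: mtrace_mat_one n_def)
      then show ?thesis unfolding comp by (simp add: q_def ch_def mm_zero_right)
    qed
    moreover have "P = (\<lambda>Y. \<Sum>c\<in>UNIV. A c ** Y ** madj (A c))" using A by auto
    then have "ch P M M = of_real (\<Sum>c\<in>UNIV. (cmod (hs (A c) M))\<^sup>2)" for M
      by (simp add: ch_sum ch_kraus_term)
    ultimately have "(\<Sum>c\<in>UNIV. (cmod (hs (A c) (mat 1)))\<^sup>2) = 0"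
      by (metis of_real_eq_0_iff)
    then have "\<forall>c\<in>UNIV. (cmod (hs (A c) (mat 1)))\<^sup>2 = 0" by (subst (asm) sum_nonneg_eq_0_iff) auto
    then have "(cmod (hs (A c) (mat 1)))\<^sup>2 = 0" by blast
    then have "hs (A c) (mat 1) = 0" by simp
    then have "mtrace (madj (A c)) = 0" by (simp add: hs_eq_mtrace)
    then show ?thesis by (simp add: mtrace_madj)
  qed
  \<comment> \<open>Trace preservation differentiated at \<open>0\<close>.\<close>
  have tp: "(\<Sum>c\<in>UNIV. madj (A c) ** A c) = K + madj K"
  proof -
    let ?D = "(\<Sum>c\<in>UNIV. madj (A c) ** A c) - (K + madj K)"
    have "mtrace (Z X) = 0" for X
    proof (rule right_derivative_zero)
      show "((\<lambda>t. mtrace (gexp Z t X)) has_vector_derivative mtrace (Z X)) (at 0)"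
        using bounded_linear.has_vector_derivative[OF bounded_linear_mtrace gexp_deriv[OF linZ, of X 0]]
        by (simp add: T0)
    qed (use T in \<open>simp add: quantum_channel_def T0\<close>)
    moreover have "mtrace (Z X) = mtrace (?D ** X)" for X
    proof -
      have "mtrace (A c ** X ** madj (A c)) = mtrace (madj (A c) ** A c ** X)" for c
        using mtrace_commute[of "A c ** X" "madj (A c)"] by (simp add: matrix_mul_assoc)
      then show ?thesis
        using form[of X] by (simp add: Z_def mtrace_diff mtrace_sum mm_sum_left mm_diff_left mm_add_left
            mtrace_add mtrace_commute[of X])
    qed
    ultimately have "mtrace (?D ** madj ?D) = 0" by metis
    then have "hs (madj ?D) (madj ?D) = 0" by (simp add: hs_eq_mtrace)
    then have "madj ?D = 0" by (rule hs_eq_0)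
    then have "?D = 0" by (metis madj_madj madj_zero)
    then show ?thesis by simp
  qed
  show thesis by (rule that[OF form A0 tp])
qed

section \<open>Detailed balance and adjoints of the jump operators\<close>

lemma faithful_density_inverse:
  assumes "faithful_density \<omega>"
  obtains W where "W ** \<omega> = mat 1" "\<omega> ** W = mat 1" "madj \<omega> = \<omega>"
proof -
  have "inj ((*v) \<omega>)"
    using assms by (simp add: faithful_density_def linear_injective_0[OF mv_linear])
  then obtain W where W: "W ** \<omega> = mat 1"
    using matrix_left_invertible_injective by blast
  then have "\<omega> ** W = mat 1" by (simp add: matrix_left_right_inverse)
  moreover have "madj \<omega> = \<omega>"
    using assms psd_hermitian by (auto simp: faithful_density_def density_def hermitian_def)
  ultimately show thesis using that W by blast
qed

text \<open>In Choi form, detailed balance equates \<open>\<Sum> \<langle>M, A\<^sup>* \<omega>\<rangle> \<langle>A\<^sup>*, N\<rangle>\<close> with \<open>\<Sum> \<langle>M, \<omega> A\<rangle> \<langle>A, N\<rangle>\<close> for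
  traceless \<open>N\<close> and \<open>M\<close> orthogonal to \<open>\<omega>\<close>; the choice \<open>M = N \<omega>\<inverse>\<close> turns the left-hand side into a
  sum of squares.\<close>
theorem GNS_jump_adjoint_closed:
  fixes S :: "'n::finite cmat \<Rightarrow> 'n cmat"
  assumes form: "\<And>X. - S X = (\<Sum>c\<in>UNIV. A c ** X ** madj (A c)) - K ** X - X ** madj K"
    and tr0: "\<And>c::'c::finite. mtrace (A c) = 0"
    and faithful: "faithful_density \<omega>" and GNS: "GNS_detailed_balance S \<omega>"
    and N: "\<And>c. hs (A c) N = 0"
  shows "hs (madj (A d)) N = 0"
proof -
  obtain W where W: "W ** \<omega> = mat 1" "\<omega> ** W = mat 1" and om: "madj \<omega> = \<omega>"
    using faithful_density_inverse[OF faithful] by metis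
  have Wadj: "madj W ** \<omega> = mat 1" using W(2) om by (metis madj_mat_one madj_mult)
  have S: "S X = K ** X + X ** madj K - (\<Sum>c\<in>UNIV. A c ** X ** madj (A c))" for X
    using form[of X] by (simp add: algebra_simps)
  have Smadj: "madj (S X) = S (madj X)" for X
    by (simp add: S madj_diff madj_add madj_sum madj_mult matrix_mul_assoc)
  have bal: "mtrace (\<omega> ** a ** S y) = mtrace (\<omega> ** S a ** y)" for a y
    using GNS unfolding GNS_detailed_balance_def by (metis Smadj madj_madj)
  \<comment> \<open>The generator moved to the other factor:
    \<open>mtrace (F a ** y) = mtrace (\<omega> ** a ** S y)\<close>. Detailed balance becomes the
    identity \<open>F a = \<omega> ** S a\<close> of superoperators, whose Choi forms can be
    compared.\<close>
  define F where "F a = (\<omega> ** a ** K + madj K ** \<omega> ** a) - (\<Sum>c\<in>UNIV. (madj (A c) ** \<omega>) ** a ** A c)" for a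
  have F: "F a = \<omega> ** S a" for a
  proof -
    have "mtrace (F a ** y) = mtrace (\<omega> ** a ** S y)" for y
    proof -
      have "mtrace (madj (A c) ** \<omega> ** a ** A c ** y) = mtrace (\<omega> ** a ** (A c ** y ** madj (A c)))" for c
        using mtrace_commute[of "madj (A c)" "\<omega> ** a ** A c ** y"] by (simp add: matrix_mul_assoc)
      moreover have "mtrace (madj K ** \<omega> ** a ** y) = mtrace (\<omega> ** a ** (y ** madj K))"
        using mtrace_commute[of "madj K" "\<omega> ** a ** y"] by (simp add: matrix_mul_assoc)
      ultimately show ?thesis
        by (simp add: F_def S mm_diff_left mm_diff_right mm_add_left mm_add_right mtrace_add mtrace_diff
            mm_sum_left mm_sum_right mtrace_sum) (simp add: matrix_mul_assoc)
    qed
    then have "mtrace ((F a - \<omega> ** S a) ** y) = 0" for y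
      by (simp add: bal mm_diff_left mtrace_diff)
    then have "hs (madj (F a - \<omega> ** S a)) (madj (F a - \<omega> ** S a)) = 0" by (simp add: hs_eq_mtrace)
    then have "madj (F a - \<omega> ** S a) = 0" by (rule hs_eq_0)
    then have "F a - \<omega> ** S a = 0" by (metis madj_madj madj_zero)
    then show ?thesis by simp
  qed
  define n where "n = complex_of_nat CARD('n)"
  have n0: "n \<noteq> 0" by (simp add: n_def)
  \<comment> \<open>As the jump operators are traceless, removing the trace of \<open>N\<close>
    changes neither the hypothesis nor the conclusion, while it cancels the drift terms that carry
    \<open>mtrace N'\<close>.\<close>
  define N' where "N' = N - cscale (mtrace N / n) (mat 1)"
  have trN: "mtrace N' = 0"
    using n0 by (simp add: N'_def mtrace_diff mtrace_cscale mtrace_mat_one n_def)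
  have AN: "hs (A c) N' = 0" for c
    using N tr0 by (simp add: N'_def hs_diff_right hs_cscale_right hs_eq_mtrace[of _ "mat 1"] mtrace_madj)
  define M where "M = N' ** W"
  have Mo: "hs M (Y ** \<omega>) = hs N' Y" for Y
    by (simp add: hs_right_mult_right om M_def mm_assoc W)
  have "hs M \<omega> = hs N' (mat 1)" using Mo[of "mat 1"] by simp
  also have "\<dots> = 0" using hs_cnj[of "mat 1" N'] trN by (simp add: hs_one_left)
  finally have Mw: "hs M \<omega> = 0" .
  have "ch F M N' = hs M \<omega> * mtrace (K ** N') + hs M (madj K ** \<omega>) * mtrace N'
     - (\<Sum>c\<in>UNIV. hs M (madj (A c) ** \<omega>) * hs (madj (A c)) N')"
  proof -
    have "ch (\<lambda>a. madj K ** \<omega> ** a) M N' = hs M (madj K ** \<omega>) * mtrace N'"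
      using ch_sandwich[of "madj K ** \<omega>" "mat 1" M N'] by simp
    then show ?thesis
      by (simp add: F_def[abs_def] ch_diff ch_add ch_sum ch_sandwich hs_eq_mtrace[of "madj (A _)"])
  qed
  then have 1: "ch F M N' = - (\<Sum>c\<in>UNIV. hs N' (madj (A c)) * hs (madj (A c)) N')"
    by (simp add: Mw trN Mo)
  \<comment> \<open>Every jump term has the factor \<open>hs (A c) N'\<close>, and the drift terms
    carry \<open>mtrace N'\<close> or \<open>hs M \<omega>\<close>.\<close>
  have 2: "ch (\<lambda>a. \<omega> ** S a) M N' = 0"
  proof -
    have "(\<lambda>a. \<omega> ** S a) = (\<lambda>a. \<omega> ** K ** a + \<omega> ** a ** madj K - (\<Sum>c\<in>UNIV. (\<omega> ** A c) ** a ** madj (A c)))"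
      by (rule ext) (simp add: S mm_diff_right mm_add_right mm_sum_right matrix_mul_assoc)
    moreover have "ch (\<lambda>a. \<omega> ** K ** a) M N' = hs M (\<omega> ** K) * mtrace N'"
      using ch_sandwich[of "\<omega> ** K" "mat 1" M N'] by simp
    ultimately show ?thesis
      by (simp add: ch_diff ch_add ch_sum ch_sandwich Mw trN AN flip: hs_eq_mtrace)
  qed
  have "F = (\<lambda>a. \<omega> ** S a)" using F by auto
  with 1 2 have "(\<Sum>c\<in>UNIV. hs N' (madj (A c)) * hs (madj (A c)) N') = 0" by simp
  moreover have "hs N' (madj (A c)) * hs (madj (A c)) N' = of_real ((cmod (hs (madj (A c)) N'))\<^sup>2)" for c
    using hs_cnj[of "madj (A c)" N'] by (metis complex_norm_square mult.commute)
  ultimately have "complex_of_real (\<Sum>c\<in>UNIV. (cmod (hs (madj (A c)) N'))\<^sup>2) = 0" by simp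
  then have "(\<Sum>c\<in>UNIV. (cmod (hs (madj (A c)) N'))\<^sup>2) = 0" by (simp only: of_real_eq_0_iff)
  then have "hs (madj (A d)) N' = 0" by (simp add: sum_nonneg_eq_0_iff)
  then show ?thesis
    using tr0[of d] by (simp add: N'_def hs_diff_right hs_cscale_right hs_eq_mtrace[of _ "mat 1"])
qed

subsection \<open>Recurrence and conclusion\<close>

text \<open>Late terms of a convergent subsequence are close to each other; by invariance of the
  distance, the difference of their indices is a time of near return to the start.\<close>

lemma recurrent_sequence:
  fixes z :: "nat \<Rightarrow> 'a::heine_borel"
  assumes bd: "bounded (range z)" and iso: "\<And>k m. dist (z (k + m)) (z k) = dist (z m) (z 0)"
  obtains r :: "nat \<Rightarrow> nat" where "filterlim r at_top sequentially" "(\<lambda>j. z (r j)) \<longlonglongrightarrow> z 0"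
proof -
  obtain l s where s: "strict_mono s" "(z \<circ> s) \<longlonglongrightarrow> l"
    using bounded_imp_convergent_subsequence[OF bd] by blast
  then have "Cauchy (z \<circ> s)" by (intro LIMSEQ_imp_Cauchy)
  have "\<exists>m\<ge>j. dist (z m) (z 0) < 1 / real (Suc j)" for j
  proof -
    have "0 < 1 / real (Suc j)" by simp
    then obtain N where N: "\<And>p q. p \<ge> N \<Longrightarrow> q \<ge> N \<Longrightarrow> dist (z (s p)) (z (s q)) < 1 / real (Suc j)"
      using \<open>Cauchy (z \<circ> s)\<close> unfolding Cauchy_def o_def by metis
    have grow: "s N + i \<le> s (N + i)" for i
    proof (induction i)
      case (Suc i)
      then show ?case using strict_monoD[OF s(1), of "N + i" "N + Suc i"] by simp
    qed simp
    \<comment> \<open>Going \<open>j\<close> places further along the subsequence makes the return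
      time at least \<open>j\<close>.\<close>
    define m where "m = s (N + j) - s N"
    have sm: "s (N + j) = s N + m" using grow[of j] by (simp add: m_def)
    have "dist (z m) (z 0) = dist (z (s (N + j))) (z (s N))" by (simp add: sm iso)
    also have "\<dots> < 1 / real (Suc j)" by (rule N) auto
    finally show ?thesis using grow[of j] sm by (intro exI[of _ m]) auto
  qed
  then have "\<forall>j. \<exists>m. m \<ge> j \<and> dist (z m) (z 0) < 1 / real (Suc j)" by blast
  then obtain r where "\<forall>j. r j \<ge> j \<and> dist (z (r j)) (z 0) < 1 / real (Suc j)"
    by (rule choice[THEN exE])
  then have r: "\<And>j. r j \<ge> j" "\<And>j. dist (z (r j)) (z 0) < 1 / real (Suc j)" by blast+
  show thesis
  proof (rule that[of r])
    show "filterlim r at_top sequentially"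
      by (rule filterlim_at_top_mono[OF filterlim_ident]) (simp add: r(1))
    have "(\<lambda>j. dist (z (r j)) (z 0)) \<longlonglongrightarrow> 0"
    proof (rule tendsto_sandwich[OF _ _ tendsto_const])
      show "(\<lambda>j. 1 / real (Suc j)) \<longlonglongrightarrow> 0" by (rule lim_1_over_n[THEN LIMSEQ_Suc])
    qed (intro always_eventually allI zero_le_dist less_imp_le[OF r(2)])+
    then show "(\<lambda>j. z (r j)) \<longlonglongrightarrow> z 0" by (rule tendsto_dist_iff[THEN iffD2])
  qed
qed

lemma norm_unitary_conj:
  assumes "unitary_mat U"
  shows "norm (U ** X ** madj U) = norm X"
proof -
  have U: "madj U ** U = mat 1" using assms by (simp add: unitary_mat_def)
  have "hs (U ** X ** madj U) (U ** X ** madj U) = hs (U ** X) (U ** X ** madj U ** madj (madj U))"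
    by (rule hs_mult_right)
  also have "\<dots> = hs (U ** X) (U ** X)"
    by (simp add: U mm_assoc)
  also have "\<dots> = hs X (madj U ** (U ** X))" by (rule hs_mult_left)
  also have "\<dots> = hs X X" by (simp add: U matrix_mul_assoc)
  finally have "hs (U ** X ** madj U) (U ** X ** madj U) = hs X X" .
  then have "(norm (U ** X ** madj U))\<^sup>2 = (norm X)\<^sup>2"
    unfolding hs_self of_real_eq_iff .
  then show ?thesis by simp
qed

lemma norm_matrix:
  "norm (\<chi> i j. f i j) = L2_set (\<lambda>i. L2_set (\<lambda>j. norm (f i j)) UNIV) UNIV"
  by (simp add: norm_vec_def)

lemma ch_tendsto:
  assumes X: "\<And>i j. (\<lambda>k. X k (munit i j)) \<longlonglongrightarrow> X' (munit i j)" and m: "m \<longlonglongrightarrow> M"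
  shows "(\<lambda>k. ch (X k) (m k) (m k)) \<longlonglongrightarrow> ch X' M M"
  unfolding ch_def
  by (intro tendsto_sum bounded_linear.tendsto[OF bounded_linear_nth2]
      bounded_bilinear.tendsto[OF bounded_bilinear_mm] bounded_linear.tendsto[OF bounded_linear_madj] assms)

section \<open>Domination in the completely positive order\<close>

lemma bounded_bilinear_Re_ch: "bounded_bilinear (\<lambda>M N. Re (ch X M N))"
  unfolding bilinear_conv_bounded_bilinear[symmetric] bilinear_def
  by (auto intro!: linearI simp: ch_add_left ch_add_right ch_scaleR_left ch_scaleR_right)

lemma choi_psd_Re_sym:
  assumes "choi_psd X"
  shows "Re (ch X M N) = Re (ch X N M)"
proof -
  have "cnj (ch X M N) = ch X N M"
    by (rule ch_hermitian) (use assms in \<open>simp add: choi_psd_def\<close>)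
  then show ?thesis by (simp add: complex_eq_iff)
qed

theorem choi_dominates:
  assumes "choi_psd X" "choi_psd Y" and ker: "\<And>M. ch X M M = 0 \<Longrightarrow> ch Y M M = 0"
  obtains e where "0 < e" "e < 1" "choi_psd (\<lambda>Z. X Z - e *\<^sub>R Y Z)"
proof -
  obtain C where C: "C > 0" "\<And>M. Re (ch Y M M) \<le> C * Re (ch X M M)"
  proof (rule psd_form_dominates[OF bounded_bilinear_Re_ch choi_psd_Re_sym[OF assms(1)] _
        bounded_bilinear_Re_ch choi_psd_Re_sym[OF assms(2)]])
    show "0 \<le> Re (ch X M M)" "0 \<le> Re (ch Y M M)" for M
      using assms by (simp_all add: choi_psd_def)
    show "Re (ch Y M M) = 0" if "Re (ch X M M) = 0" for M
      using ker[of M] that assms(1) by (simp add: choi_psd_def complex_eq_iff)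
  qed (use that in blast)
  \<comment> \<open>Ensures \<open>e * C \<le> 1\<close> for the domination and \<open>e < 1\<close>
    for the normalisation of the remainder.\<close>
  define e where "e = 1 / (C + 1)"
  have e: "0 < e" "e < 1" "e * C \<le> 1" using C(1) by (simp_all add: e_def field_simps)
  have "choi_psd (\<lambda>Z. X Z - e *\<^sub>R Y Z)"
    unfolding choi_psd_def
  proof
    fix M
    have "e * Re (ch Y M M) \<le> e * (C * Re (ch X M M))" using C(2) e(1) by (intro mult_left_mono) auto
    also have "\<dots> \<le> 1 * Re (ch X M M)"
      unfolding mult.assoc[symmetric] using assms(1) e(3) by (intro mult_right_mono) (auto simp: choi_psd_def)
    finally show "Im (ch (\<lambda>Z. X Z - e *\<^sub>R Y Z) M M) = 0 \<and> 0 \<le> Re (ch (\<lambda>Z. X Z - e *\<^sub>R Y Z) M M)"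
      using assms(1,2) by (simp add: ch_diff ch_scaleR choi_psd_def)
  qed
  with e show thesis by (intro that[of e])
qed

lemma choi_psd_density:
  assumes "superop_linear X" "choi_psd X" "\<And>Y. mtrace (X Y) = mtrace Y" "density \<rho>"
  shows "density (X \<rho>)"
  using assms choi_psd_psd by (auto simp: density_def)

theorem theorem2:
  fixes H :: "'n::finite cmat"
    and S :: "'n cmat \<Rightarrow> 'n cmat"
    and \<omega> :: "'n cmat"
    and E :: "'n cmat \<Rightarrow> 'n cmat"
    and U :: "real \<Rightarrow> 'n cmat"
    and L :: "'n cmat \<Rightarrow> 'n cmat"
    and \<Phi> :: "real \<Rightarrow> 'n cmat \<Rightarrow> 'n cmat"
    and R :: "real \<Rightarrow> 'n cmat \<Rightarrow> 'n cmat"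
  assumes herm: "hermitian H"
    and lind: "lindbladian S"
    and faithful: "faithful_density \<omega>"
    and GNS: "GNS_detailed_balance S \<omega>"
    and L_def: "\<And>X. L X = cscale \<i> (H ** X - X ** H) + S X"
    and Phi_def: "\<And>t. \<Phi> t = superop_exp (\<lambda>X. (- t) *\<^sub>R L X)"
    and E_channel: "quantum_channel E"
    and E_idem: "\<And>X. E (E X) = E X"
    and U_unitary: "\<And>t. t \<ge> 0 \<Longrightarrow> unitary_mat (U t)"
    and R_def: "\<And>t X. R t X = U t ** X ** madj (U t)"
    and R_cont: "\<And>X. continuous_on {0..} (\<lambda>t. R t X)"
    and R_E_comm: "\<And>t X. t \<ge> 0 \<Longrightarrow> R t (E X) = E (R t X)"
    and Phi_E: "\<And>t X. t \<ge> 0 \<Longrightarrow> \<Phi> t (E X) = E (\<Phi> t X) \<and> \<Phi> t (E X) = R t (E X)"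
    and Phi_lim: "\<And>X. ((\<lambda>t. \<Phi> t X - R t (E X)) \<longlongrightarrow> 0) at_top"
  shows "\<forall>\<tau>::real. \<tau> > 0 \<longrightarrow> (\<exists>lam::real. lam > 0 \<and>
           (\<forall>t::real. \<forall>\<rho>. t > 0 \<and> density \<rho> \<longrightarrow>
              rel_entropy (\<Phi> t \<rho>) (R t (E \<rho>))
                \<le> ereal (exp (- lam * of_int \<lfloor>t / \<tau>\<rfloor>)) * rel_entropy \<rho> (E \<rho>)))"
proof (intro allI impI)
  fix \<tau> :: real assume tau: "\<tau> > 0"
  obtain A :: "'n \<times> 'n \<Rightarrow> 'n cmat" and K0 where
    form: "\<And>X. - S X = (\<Sum>c\<in>UNIV. A c ** X ** madj (A c)) - K0 ** X - X ** madj K0"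
    and tr0: "\<And>c. mtrace (A c) = 0" and tp0: "(\<Sum>c\<in>UNIV. madj (A c) ** A c) = K0 + madj K0"
    by (rule lindbladian_gkls[OF lind]) (rule that)
  \<comment> \<open>The Hamiltonian enters the drift only. The jump operators and
    \<open>K + madj K\<close> are those of \<open>S\<close>, so detailed balance of \<open>S\<close>
    supplies \<open>adj_closed\<close> for the full generator.\<close>
  define K where "K = K0 + cscale \<i> H"
  have adjK: "madj K = madj K0 - cscale \<i> H"
  proof -
    have "madj K = madj K0 + cscale (- \<i>) H"
      using herm by (simp add: K_def madj_add madj_cscale hermitian_def)
    also have "\<dots> = madj K0 - cscale \<i> H" by (rule matrix_eqI) simp
    finally show ?thesis .
  qed
  have \<Phi>_exp: "\<Phi> t = superop_exp (\<lambda>X. (- t) *\<^sub>R L X)" for t by (rule Phi_def)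
  interpret gkls A K
  proof
    show "(\<Sum>c\<in>UNIV. madj (A c) ** A c) = K + madj K"
      by (simp add: tp0 adjK) (simp add: K_def)
    show "hs (madj (A d)) N = 0" if "\<And>c. hs (A c) N = 0" for N d
      by (rule GNS_jump_adjoint_closed[OF form tr0 faithful GNS that])
  qed
  have gen: "gen X = - L X" for X
  proof -
    have "gen X = - S X - cscale \<i> (H ** X) + cscale \<i> (X ** H)"
      unfolding form gen_def adjK
      by (simp add: K_def mm_add_left mm_diff_right cscale_mult_left cscale_mult_right)
    then show ?thesis by (simp add: L_def cscale_diff_right)
  qed
  have Phi: "\<Phi> t = Phi t" for t
    by (simp only: \<Phi>_exp gkls.Phi_def[OF gkls_axioms] gexp_def gen scaleR_minus_left scaleR_minus_right)
  have E: "superop_linear E" "choi_psd E" "\<And>X. mtrace (E X) = mtrace X"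
    using E_channel by (auto simp: quantum_channel_def intro: cp_choi_psd)
  have PhiE_conj: "Phi t (E X) = E (Phi t X) \<and> Phi t (E X) = R t (E X)" if "t \<ge> 0" for t X
    using Phi_E[OF that, of X] unfolding Phi .
  have PhiE: "Phi t (E X) = E (Phi t X)" "Phi t (E X) = R t (E X)" if "t \<ge> 0" for t X
    using PhiE_conj[OF that, of X] by blast+
  have PhiE_norm: "norm (Phi t (E X)) = norm (E X)" if "t \<ge> 0" for t X
    using PhiE(2)[OF that] norm_unitary_conj[OF U_unitary[OF that]] by (simp add: R_def)
  have Jskew: "madj (- J) = - (- J)" by (simp add: madj_minus J_skew)

  have kernel: "ch (\<lambda>Y. Phi \<tau> (E Y)) M M = 0" if M: "ch (Phi \<tau>) M M = 0" for M
  proof -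
    \<comment> \<open>One sequence collects the unitary orbit of \<open>M\<close> and the orbits of
      all \<open>E (munit i j)\<close>, so that both have common return times.\<close>
    define z where "z k = (mexp (- J) (real k) ** M, \<chi> i j. Phi (real k) (E (munit i j)))" for k :: nat
    have z1: "norm (mexp (- J) (real (k + m)) ** M - mexp (- J) (real k) ** M) = norm (mexp (- J) (real m) ** M - M)" for k m
    proof -
      have "mexp (- J) (real (k + m)) ** M - mexp (- J) (real k) ** M
         = mexp (- J) (real k) ** (mexp (- J) (real m) ** M - M)"
        by (simp add: mexp_add mm_diff_right matrix_mul_assoc)
      then show ?thesis by (simp add: mexp_isometry[OF Jskew])
    qed
    \<comment> \<open>On the range of \<open>E\<close> the semigroup acts by the rotations
      \<open>R\<close>, hence isometrically; the difference lies in that range since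
      \<open>E\<close> is idempotent and commutes with the semigroup.\<close>
    have z2: "norm (Phi (real (k + m)) (E X) - Phi (real k) (E X)) = norm (Phi (real m) (E X) - E X)" for k m X
    proof -
      have "Phi (real m) (E X) - E X = E (Phi (real m) (E X) - E X)"
        using PhiE(1)[of "real m" X] by (simp add: superop_diff[OF E(1)] E_idem)
      moreover have "Phi (real (k + m)) (E X) - Phi (real k) (E X) = Phi (real k) (Phi (real m) (E X) - E X)"
        by (simp add: superop_diff[OF Phi_superop] Phi_add)
      ultimately show ?thesis using PhiE_norm[of "real k"] by (metis of_nat_0_le_iff)
    qed
    have iso: "dist (z (k + m)) (z k) = dist (z m) (z 0)" for k m
    proof -
      have diff: "z p - z q = (mexp (- J) (real p) ** M - mexp (- J) (real q) ** M,
          \<chi> i j. Phi (real p) (E (munit i j)) - Phi (real q) (E (munit i j)))" for p q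
        by (simp add: z_def vec_eq_iff)
      show ?thesis
        unfolding dist_norm diff norm_Pair norm_matrix z1 z2 by (simp add: mexp_0 Phi_0)
    qed
    have zn: "norm (z k) = norm (z 0)" for k
      unfolding z_def norm_Pair norm_matrix by (simp add: PhiE_norm mexp_isometry[OF Jskew])
    have "bounded (range z)"
    proof (rule boundedI)
      fix x assume "x \<in> range z"
      then obtain k where "x = z k" by blast
      then show "norm x \<le> norm (z 0)" by (simp only: zn[of k])
    qed
    then obtain r where r: "filterlim r at_top sequentially" and zr: "(\<lambda>j. z (r j)) \<longlonglongrightarrow> z 0"
      by (rule recurrent_sequence[OF _ iso])
    have lim1: "(\<lambda>j. mexp (- J) (real (r j)) ** M) \<longlonglongrightarrow> M"
      using tendsto_fst[OF zr] by (simp add: z_def mexp_0)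
    have lim2: "(\<lambda>j. Phi (real (r j)) (E (munit i k))) \<longlonglongrightarrow> E (munit i k)" for i k
      using tendsto_vec_nth[OF tendsto_vec_nth[OF tendsto_snd[OF zr], of i], of k] by (simp add: z_def Phi_0)
    have rr: "filterlim (\<lambda>j. real (r j)) at_top sequentially"
      by (rule filterlim_compose[OF filterlim_real_sequentially r])
    \<comment> \<open>Along return times \<open>Phi\<close> approaches its rotating part, and that
      part has come back to \<open>E\<close>.\<close>
    have lim3: "(\<lambda>j. Phi (\<tau> + real (r j)) (munit i k)) \<longlonglongrightarrow> Phi \<tau> (E (munit i k))" for i k
    proof -
      have "(\<lambda>j. Phi (real (r j)) (munit i k) - Phi (real (r j)) (E (munit i k))) \<longlonglongrightarrow> 0"
        using filterlim_compose[OF Phi_lim[of "munit i k"] rr] by (simp add: Phi PhiE(2))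
      from tendsto_add[OF this lim2[of i k]]
      have lim: "(\<lambda>j. Phi (real (r j)) (munit i k)) \<longlonglongrightarrow> E (munit i k)" by simp
      have "bounded_linear (Phi \<tau>)"
        using superop_linear_imp_linear[OF Phi_superop] by (simp add: linear_conv_bounded_linear)
      from bounded_linear.tendsto[OF this lim] show ?thesis by (simp add: Phi_add)
    qed
    have "ch (Phi (\<tau> + real (r j))) (mexp (- J) (real (r j)) ** M) (mexp (- J) (real (r j)) ** M) = 0" for j
      using ker_unitary_flow[OF tau, of M "real (r j)"] M by (simp add: ker_def)
    with ch_tendsto[of "\<lambda>j. Phi (\<tau> + real (r j))" "\<lambda>Y. Phi \<tau> (E Y)", OF lim3 lim1]
    show ?thesis by (simp add: LIMSEQ_const_iff)
  qed

  have Phi_pos: "choi_psd (Phi t)" if "t \<ge> 0" for t using that by (rule Phi_choi_psd)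
  have Phi_dens: "density (Phi t \<rho>)" if "t \<ge> 0" "density \<rho>" for t \<rho>
    by (rule choi_psd_density[OF Phi_superop Phi_pos[OF that(1)] Phi_mtrace that(2)])
  have E_dens: "density (E \<rho>)" if "density \<rho>" for \<rho>
    by (rule choi_psd_density[OF E that])

  obtain e where e: "0 < e" "e < 1" and dom: "choi_psd (\<lambda>Z. Phi \<tau> Z - e *\<^sub>R Phi \<tau> (E Z))"
  proof (rule choi_dominates)
    show "choi_psd (Phi \<tau>)" using tau by (intro Phi_pos) simp
    then show "choi_psd (\<lambda>Y. Phi \<tau> (E Y))" by (rule choi_psd_comp[OF Phi_superop _ E(2)])
  qed (use kernel that in blast)+
  \<comment> \<open>What remains of one step after the part of weight \<open>e\<close> is removed:
    \<open>dom\<close> gives positivity and the prefactor restores the trace.\<close>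
  define P where "P Z = (1 / (1 - e)) *\<^sub>R (Phi \<tau> Z - e *\<^sub>R Phi \<tau> (E Z))" for Z
  have P_lin: "superop_linear P"
    unfolding superop_linear_def P_def
    by (simp add: superop_add[OF E(1)] superop_add[OF Phi_superop] superop_cscale[OF E(1)]
        superop_cscale[OF Phi_superop] scaleR_eq_cscale cscale_cscale cscale_diff_right cscale_add_right mult_ac)
  have P_pos: "choi_psd P"
    using dom e unfolding P_def[abs_def] by (simp add: choi_psd_def ch_scaleR)
  have P_tr: "mtrace (P X) = mtrace X" for X
  proof -
    have "mtrace (P X) = (1 / (1 - e)) *\<^sub>R ((1 - e) *\<^sub>R mtrace X)"
      by (simp add: P_def mtrace_scaleR mtrace_diff Phi_mtrace E(3) scaleR_left_diff_distrib)
    then show ?thesis using e by simp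
  qed
  have P_split: "Phi \<tau> Z = (1 - e) *\<^sub>R P Z + e *\<^sub>R Phi \<tau> (E Z)" for Z
    using e by (simp add: P_def)

  have step: "rel_entropy (Phi \<tau> \<rho>) (Phi \<tau> (E \<rho>)) \<le> ereal (1 - e) * rel_entropy \<rho> (E \<rho>)"
    if "density \<rho>" for \<rho>
  proof -
    \<comment> \<open>Since \<open>E\<close> is idempotent, the splittings of
      \<open>Phi \<tau> \<rho>\<close> and \<open>Phi \<tau> (E \<rho>)\<close> contain this same
      state with weight \<open>e\<close>.\<close>
    define \<alpha> where "\<alpha> = Phi \<tau> (E \<rho>)"
    have "density \<alpha>" unfolding \<alpha>_def using tau by (intro Phi_dens E_dens that) simp
    then have "rel_entropy ((1 - e) *\<^sub>R P \<rho> + e *\<^sub>R \<alpha>) ((1 - e) *\<^sub>R P (E \<rho>) + e *\<^sub>R \<alpha>)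
        \<le> ereal (1 - e) * rel_entropy \<rho> (E \<rho>)"
      using e by (intro rel_entropy_contract[OF P_lin P_pos P_tr that E_dens[OF that]]) auto
    moreover have "(1 - e) *\<^sub>R P \<rho> + e *\<^sub>R \<alpha> = Phi \<tau> \<rho>"
      unfolding \<alpha>_def by (rule P_split[symmetric])
    moreover have "(1 - e) *\<^sub>R P (E \<rho>) + e *\<^sub>R \<alpha> = Phi \<tau> (E \<rho>)"
      using P_split[of "E \<rho>", symmetric] unfolding \<alpha>_def E_idem .
    ultimately show ?thesis by simp
  qed
  \<comment> \<open>Data processing, as the case \<open>e = 0\<close>; it covers the incomplete last
    step.\<close>
  have mono: "rel_entropy (Phi s \<rho>) (Phi s (E \<rho>)) \<le> rel_entropy \<rho> (E \<rho>)"
    if "s \<ge> 0" "density \<rho>" for s \<rho>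
    using rel_entropy_contract[OF Phi_superop Phi_pos[OF that(1)] Phi_mtrace that(2) E_dens[OF that(2)] that(2), of 0]
    by (simp add: one_ereal_def[symmetric])
  have iter: "rel_entropy (Phi (real k * \<tau>) \<rho>) (Phi (real k * \<tau>) (E \<rho>)) \<le> ereal ((1 - e) ^ k) * rel_entropy \<rho> (E \<rho>)"
    if "density \<rho>" for k \<rho>
  proof (induction k)
    case 0
    then show ?case by (simp add: Phi_0 one_ereal_def[symmetric])
  next
    case (Suc k)
    let ?\<rho> = "Phi (real k * \<tau>) \<rho>"
    have "density ?\<rho>" using that tau by (intro Phi_dens) auto
    \<comment> \<open>\<open>E\<close> commutes with the semigroup, so the moved reference state is
      the projection of the moved state and \<open>step\<close> applies again.\<close>
    have E1: "E ?\<rho> = Phi (real k * \<tau>) (E \<rho>)" using PhiE(1)[of "real k * \<tau>" \<rho>] tau by simp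
    have split: "Phi (real (Suc k) * \<tau>) X = Phi \<tau> (Phi (real k * \<tau>) X)" for X
      by (simp add: distrib_right flip: Phi_add)
    have "rel_entropy (Phi (real (Suc k) * \<tau>) \<rho>) (Phi (real (Suc k) * \<tau>) (E \<rho>))
        \<le> ereal (1 - e) * rel_entropy ?\<rho> (E ?\<rho>)"
      using step[OF \<open>density ?\<rho>\<close>] unfolding split E1 .
    also have "\<dots> \<le> ereal (1 - e) * (ereal ((1 - e) ^ k) * rel_entropy \<rho> (E \<rho>))"
      unfolding E1 using Suc e by (intro ereal_mult_left_mono) auto
    also have "\<dots> = ereal ((1 - e) ^ Suc k) * rel_entropy \<rho> (E \<rho>)"
      by (simp add: mult.assoc[symmetric])
    finally show ?case .
  qed
  show "\<exists>lam::real. lam > 0 \<and> (\<forall>t::real. \<forall>\<rho>. t > 0 \<and> density \<rho> \<longrightarrow>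
      rel_entropy (\<Phi> t \<rho>) (R t (E \<rho>)) \<le> ereal (exp (- lam * of_int \<lfloor>t / \<tau>\<rfloor>)) * rel_entropy \<rho> (E \<rho>))"
  proof (intro exI conjI allI impI)
    \<comment> \<open>With this rate \<open>exp (- lam)\<close> is the factor \<open>1 - e\<close>
      gained in one step.\<close>
    show "- ln (1 - e) > 0" using e by simp
    fix t :: real and \<rho> :: "'n cmat" assume "t > 0 \<and> density \<rho>"
    then have t: "t > 0" and rho: "density \<rho>" by auto
    define k where "k = nat \<lfloor>t / \<tau>\<rfloor>"
    have k: "of_int \<lfloor>t / \<tau>\<rfloor> = real k" using t tau by (simp add: k_def)
    define s where "s = t - real k * \<tau>"
    have "real k \<le> t / \<tau>" unfolding k[symmetric] by (rule of_int_floor_le)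
    then have s: "s \<ge> 0" using tau by (simp add: s_def field_simps)
    let ?\<rho> = "Phi (real k * \<tau>) \<rho>"
    have "density ?\<rho>" using rho tau by (intro Phi_dens) auto
    have E1: "E ?\<rho> = Phi (real k * \<tau>) (E \<rho>)" using PhiE(1)[of "real k * \<tau>" \<rho>] tau by simp
    have split: "Phi t X = Phi s (Phi (real k * \<tau>) X)" for X
      by (simp add: s_def flip: Phi_add)
    have "rel_entropy (\<Phi> t \<rho>) (R t (E \<rho>)) = rel_entropy (Phi s ?\<rho>) (Phi s (E ?\<rho>))"
      unfolding E1 split[symmetric] Phi PhiE(2)[OF less_imp_le[OF t], symmetric] ..
    also have "\<dots> \<le> rel_entropy ?\<rho> (E ?\<rho>)" by (rule mono[OF s \<open>density ?\<rho>\<close>])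
    also have "\<dots> \<le> ereal ((1 - e) ^ k) * rel_entropy \<rho> (E \<rho>)" unfolding E1 by (rule iter[OF rho])
    also have "(1 - e) ^ k = exp (- (- ln (1 - e)) * of_int \<lfloor>t / \<tau>\<rfloor>)"
      using e unfolding k by (simp add: exp_of_nat_mult mult.commute[of "ln _"])
    finally show "rel_entropy (\<Phi> t \<rho>) (R t (E \<rho>))
        \<le> ereal (exp (- (- ln (1 - e)) * of_int \<lfloor>t / \<tau>\<rfloor>)) * rel_entropy \<rho> (E \<rho>)" .
  qed
qed

end
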